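(* Let $t=2$; if the Generalized Riemann Hypothesis is assumed, one can take $t=1$. There is an absolute constant $C$ such that the maximal operator $A^{\ast}$ satisfies the following. (1) For all $1<p<2$ and all finite sets $F,G\subset\mathbb Z$, $$\langle A^{\ast}\mathbf 1_F,\mathbf 1_G\rangle\le C\,(p-1)^{-t}\sup_{\mathcal S}\sum_{I\in\mathcal S}\langle\mathbf 1_F\rangle_{I,p}\,\langle\mathbf 1_G\rangle_{I,p}\,|I|,$$ where the supremum is over all sparse collections of intervals $\mathcal S$. (2) For all finite sets $F\subset\mathbb Z$, $$\sup_{0<\lambda<1}\frac{\lambda}{(\operatorname{Log}\lambda)^t}\,\bigl|\{x\in\mathbb Z: A^{\ast}\mathbf 1_F(x)>\lambda\}\bigr|\le C|F|.$$ (3) For all finitely supported non-negative functions $f$ on $\mathbb Z$, $$\sup_{\lambda>0}\lambda\,\bigl|\{x\in\mathbb Z: A^{\ast}f(x)>\lambda\}\bigr|\le C\,\lVert f\rVert_{\ell(\log\ell)^t(\log\log\ell)}.$$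
   Context: An interval is a finite set of consecutive integers, with cardinality $|I|$. A collection of intervals $\mathcal S$ is sparse if to each $I\in\mathcal S$ there is a set $E_I\subset I$ with $4|E_I|\ge|I|$ such that the sets $\{E_I: I\in\mathcal S\}$ are pairwise disjoint. The von Mangoldt function is $\Lambda(n)=\log p$ if $n=p^a$ with $p$ prime and $a\ge1$, and $\Lambda(n)=0$ otherwise. For finitely supported $f$ on $\mathbb Z$, $$A_Nf(x)=\frac1N\sum_{1\le n\le N}f(x-n)\Lambda(n),\qquad A^{\ast}f=\sup_N|A_Nf|,$$ the supremum being over positive integers $N$. $\langle u,v\rangle=\sum_{x\in\mathbb Z}u(x)\overline{v(x)}$. $\langle f\rangle_{I,p}=\bigl[|I|^{-1}\sum_{x\in I}|f(x)|^p\bigr]^{1/p}$. $\operatorname{Log}x=1+|\log x|$ for $x>0$. The norm in (3): for finitely supported $f$ on $\mathbb Z$ let $f^{\ast}:[0,\infty)\to[0,\infty)$ be its decreasing rearrangement, $f^{\ast}(s)=\inf\{\lambda\ge0: |\{x\in\mathbb Z:|f(x)|>\lambda\}|\le s\}$. For a slowly varying function $\varphi$, $\lVert f\rVert_{\ell\varphi(\ell)}=\int_0^\infty f^{\ast}(s)\varphi(s)\,ds$ (so that $\lVert\mathbf 1_F\rVert_{\ell\varphi(\ell)}=\int_0^{|F|}\varphi(s)\,ds$). The norm $\lVert f\rVert_{\ell(\log\ell)^t(\log\log\ell)}$ is the one with $\varphi(s)=(\operatorname{Log}s)^t\cdot\operatorname{Log}\operatorname{Log}s$. The Generalized Riemann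 Hypothesis is the assertion that, for every Dirichlet character, all zeros of the associated Dirichlet $L$-function in the strip $0<\operatorname{Re}(s)<1$ lie on the line $\operatorname{Re}(s)=\frac12$. *)

theory Defs
  imports "HOL-Analysis.Analysis" "HOL-Number_Theory.Prime_Powers"
begin

text \<open>
  Suprema, infinite sums, inner products and cardinalities of level sets are taken in
  \<^typ>\<open>ennreal\<close>, so that none of them can silently degenerate on an unbounded, divergent or
  infinite argument. The von Mangoldt function is \<^const>\<open>mangoldt\<close>.
\<close>

definition Log :: "real \<Rightarrow> real" where
  "Log x = 1 + \<bar>ln x\<bar>"

definition avg_N :: "nat \<Rightarrow> (int \<Rightarrow> 'a::real_normed_vector) \<Rightarrow> int \<Rightarrow> 'a" where
  "avg_N N f x = (\<Sum>n=1..N. (mangoldt n :: real) *\<^sub>R f (x - int n)) /\<^sub>R real N"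

definition A_star :: "(int \<Rightarrow> 'a::real_normed_vector) \<Rightarrow> int \<Rightarrow> ennreal" where
  "A_star f x = (SUP N\<in>{1..}. ennreal (norm (avg_N N f x)))"

text \<open>Only needed for non-negative functions, where complex conjugation is trivial.\<close>

definition pairing :: "(int \<Rightarrow> ennreal) \<Rightarrow> (int \<Rightarrow> ennreal) \<Rightarrow> ennreal" where
  "pairing u v = (\<Sum>\<^sub>\<infinity>x\<in>UNIV. u x * v x)"

definition is_interval_int :: "int set \<Rightarrow> bool" where
  "is_interval_int I \<longleftrightarrow> (\<exists>a b. a \<le> b \<and> I = {a..b})"

definition sparse_family :: "int set set \<Rightarrow> bool" where
  "sparse_family S \<longleftrightarrow>
     (\<forall>I\<in>S. is_interval_int I) \<and>
     (\<exists>E. (\<forall>I\<in>S. E I \<subseteq> I \<and> 4 * card (E I) \<ge> card I) \<and>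
          (\<forall>I\<in>S. \<forall>J\<in>S. I \<noteq> J \<longrightarrow> E I \<inter> E J = {}))"

definition local_avg :: "real \<Rightarrow> int set \<Rightarrow> (int \<Rightarrow> 'a::real_normed_vector) \<Rightarrow> real" where
  "local_avg p I f = ((\<Sum>x\<in>I. norm (f x) powr p) / real (card I)) powr (1 / p)"

definition sparse_form ::
    "real \<Rightarrow> int set set \<Rightarrow> (int \<Rightarrow> 'a::real_normed_vector) \<Rightarrow> (int \<Rightarrow> 'b::real_normed_vector) \<Rightarrow> ennreal"
  where
  "sparse_form p S f g =
     (\<Sum>\<^sub>\<infinity>I\<in>S. ennreal (local_avg p I f * local_avg p I g * real (card I)))"

definition counting :: "int set \<Rightarrow> ennreal" where
  "counting X = emeasure (count_space UNIV) X"

definition decr_rearr :: "(int \<Rightarrow> 'a::real_normed_vector) \<Rightarrow> real \<Rightarrow> real" where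
  "decr_rearr f s = Inf {l. 0 \<le> l \<and> counting {x. norm (f x) > l} \<le> ennreal s}"

definition lorentz_norm :: "(real \<Rightarrow> real) \<Rightarrow> (int \<Rightarrow> 'a::real_normed_vector) \<Rightarrow> ennreal" where
  "lorentz_norm \<phi> f = (\<integral>\<^sup>+s\<in>{0<..}. ennreal (decr_rearr f s * \<phi> s) \<partial>lborel)"

definition dirichlet_character :: "nat \<Rightarrow> (nat \<Rightarrow> complex) \<Rightarrow> bool" where
  "dirichlet_character q chi \<longleftrightarrow>
     q > 0 \<and>
     (\<forall>a. chi (a + q) = chi a) \<and>
     (\<forall>a b. chi (a * b) = chi a * chi b) \<and>
     (\<forall>a. chi a \<noteq> 0 \<longleftrightarrow> coprime a q)"

text \<open>
  The analytic continuation of the Dirichlet series. The point 1 is removed because of the pole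
  for principal characters. The continuation exists by a classical theorem, and it is unique on
  the connected set \<^term>\<open>- {1 :: complex}\<close>; only the value at 1 is unspecified.
\<close>

definition dirichlet_L :: "(nat \<Rightarrow> complex) \<Rightarrow> complex \<Rightarrow> complex" where
  "dirichlet_L chi = (SOME L. L holomorphic_on (- {1}) \<and>
     (\<forall>s. Re s > 1 \<longrightarrow> (\<lambda>n. chi (Suc n) / of_nat (Suc n) powr s) sums L s))"

definition GRH :: bool where
  "GRH \<longleftrightarrow> (\<forall>q chi s. dirichlet_character q chi \<and> 0 < Re s \<and> Re s < 1 \<and>
     dirichlet_L chi s = 0 \<longrightarrow> Re s = 1 / 2)"

end

theory Submission
  imports Defs "HOL-Number_Theory.Cong"
begin

text \<open>
  All three bounds are upper bounds for averages of a non-negative function, so the von Mangoldt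
  function may be replaced by something larger. The majorant is Selberg's, with a free parameter \<open>s\<close>:
  at scale \<open>N = 2^k\<close> one sifts by the primes in \<open>(2^s, N^(1/20)]\<close> only. Written in Ramanujan sums, the
  majorant has a constant term of size \<open>O(s)\<close> (Mertens), no frequency \<open>a/q\<close> with \<open>1 < q \<le> 2^s\<close>, and
  coefficients \<open>O(s q^(\<epsilon> - 1))\<close> at the larger \<open>q\<close>, uniformly in the scale. Hence an average at scale
  \<open>N\<close> is at most \<open>O(s)\<close> times an ordinary average of \<open>f\<close>, plus a high frequency part.

  The maximal function of the high frequency part has \<open>\<ell>\<^sup>2\<close> norm \<open>O(s 2^(-s/4))\<close> times that of \<open>f\<close>. For a
  single \<open>q\<close> it is controlled by Hardy-Littlewood maximal functions along the multiples of the divisors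
  of \<open>q\<close>, at the cost of a factor \<open>2^\<omega>(q)\<close>, which is \<open>q^\<epsilon>\<close> as all prime factors exceed \<open>2^s\<close>. The
  components of \<open>f\<close> at different \<open>q\<close> of the same size \<open>X\<close> are almost orthogonal, so that summing over
  these \<open>q\<close> by Cauchy-Schwarz costs \<open>\<surd>X\<close> while the coefficients gain \<open>X^(\<epsilon> - 1)\<close>. The outcome is
  \<open>mangoldt_avg_dominated\<close>.

  For the indicator of a set, \<open>s\<close> is chosen so that the high frequency part just becomes harmless. At
  level \<open>\<lambda>\<close> this needs \<open>s\<close> comparable to \<open>Log \<lambda>\<close>, which gives \<open>restricted_weak_type\<close>. On an interval on
  which \<open>F\<close> and \<open>G\<close> have densities with product \<open>u\<close> it needs \<open>s\<close> comparable to \<open>Log u\<close>; a stopping time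
  argument on the density of \<open>F\<close> turns these local estimates into a sum of \<open>u Log u\<close> over sparse
  intervals, and \<open>u Log u \<le> 3 u^(1/p) / (p - 1)\<close> gives \<open>sparse_bound\<close>.

  The Lorentz bound needs only Chebyshev's estimates. List the mass points of \<open>f\<close> by decreasing value.
  For the point of rank \<open>r\<close>, the scales at which it can matter for the level \<open>\<lambda>\<close> form a window of
  \<open>O(1 + log r)\<close> dyadic scales: below, the points reached through prime powers are so few that they
  can be discarded; above, it contributes at most \<open>O(\<lambda> / r\<^sup>2)\<close>, which is summable over the ranks. Inside
  the window Markov's inequality suffices (\<open>weak_type_rank_sum\<close>), and the rank sum that results is
  at most a multiple of the Lorentz norm (\<open>lorentz_norm_ge\<close>).

  The estimates are obtained with exponent 1; since \<open>Log \<ge> 1\<close> and \<open>0 < p - 1 < 1\<close>, they imply those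
  with a larger exponent.
\<close>

section \<open>Chebyshev and Mertens bounds\<close>

text \<open>
  In passing from \<open>N\<close> to \<open>N + 1\<close> the quotient \<open>N div d\<close> grows exactly for the divisors \<open>d\<close> of \<open>N + 1\<close>, and
  the values of the von Mangoldt function at these add up to \<open>ln (N + 1)\<close>.
\<close>

lemma ln_fact_eq_sum_mangoldt:
  "ln (fact N :: real) = (\<Sum>d=1..N. mangoldt d * real (N div d))"
proof (induction N)
  case 0
  then show ?case by simp
next
  case (Suc N)
  have "(\<Sum>d=1..Suc N. mangoldt d * real (Suc N div d))
      = (\<Sum>d=1..Suc N. mangoldt d * real (N div d) + (if d dvd Suc N then mangoldt d else 0))"
    by (rule sum.cong) (auto simp: div_Suc dvd_eq_mod_eq_0 algebra_simps)
  also have "\<dots> = (\<Sum>d=1..Suc N. mangoldt d * real (N div d))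
      + (\<Sum>d=1..Suc N. if d dvd Suc N then mangoldt d else 0)"
    by (simp only: sum.distrib)
  also have "(\<Sum>d=1..Suc N. mangoldt d * real (N div d)) = ln (fact N)"
    by (simp add: Suc.IH)
  also have "(\<Sum>d=1..Suc N. if d dvd Suc N then mangoldt d else (0::real))
      = (\<Sum>d | d dvd Suc N. mangoldt d)"
    by (rule sum.mono_neutral_cong_right) (auto simp: dvd_imp_le Suc_le_eq intro!: Nat.gr0I)
  also have "\<dots> = ln (Suc N)"
    by (subst mangoldt_sum) auto
  finally show ?case
    by (simp add: ln_mult)
qed

text \<open>
  Chebyshev's argument: \<open>(2m) div d - 2 (m div d)\<close> is never negative and equals 1 for \<open>m < d \<le> 2m\<close>,
  so the sum is at most the logarithm of a central binomial coefficient.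
\<close>

lemma mangoldt_sum_dyadic_le:
  "(\<Sum>d\<in>{m<..2*m}. mangoldt d :: real) \<le> 2 * real m"
proof -
  have fac: "(fact (2*m) :: real) = real ((2*m) choose m) * fact m * fact m"
  proof -
    have "2 * m - m = m" by simp
    then have "fact m * fact m * ((2*m) choose m) = (fact (2*m) :: nat)"
      using binomial_fact_lemma[of m "2*m"] by simp
    then have "real (fact m * fact m * ((2*m) choose m)) = real (fact (2*m))" by (rule arg_cong)
    then show ?thesis by (simp only: of_nat_mult of_nat_fact mult_ac)
  qed
  have pos: "real ((2*m) choose m) > 0" by simp
  have "(\<Sum>d\<in>{m<..2*m}. mangoldt d :: real)
      = (\<Sum>d\<in>{m<..2*m}. mangoldt d * (real ((2*m) div d) - 2 * real (m div d)))"
  proof (rule sum.cong)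
    fix d assume "d \<in> {m<..2*m}"
    then have "(2*m) div d = 1" "m div d = 0"
      by (auto simp: div_nat_eqI)
    then show "mangoldt d = mangoldt d * (real ((2*m) div d) - 2 * real (m div d))" by simp
  qed simp
  also have "\<dots> \<le> (\<Sum>d=1..2*m. mangoldt d * (real ((2*m) div d) - 2 * real (m div d)))"
  proof (rule sum_mono2)
    fix d
    have "2 * (m div d) \<le> (2*m) div d"
    proof (cases "d = 0")
      case False
      have "m div d * d \<le> m" by (rule div_times_less_eq_dividend)
      then have "2 * (m div d) * d \<le> 2 * m" by simp
      with False show ?thesis by (simp add: less_eq_div_iff_mult_less_eq)
    qed simp
    then have "2 * real (m div d) \<le> real ((2*m) div d)" by linarith
    then show "0 \<le> mangoldt d * (real ((2*m) div d) - 2 * real (m div d))"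
      by (simp add: mangoldt_nonneg)
  qed auto
  also have "\<dots> = (\<Sum>d=1..2*m. mangoldt d * real ((2*m) div d))
       - 2 * (\<Sum>d=1..2*m. mangoldt d * real (m div d))"
    by (simp add: sum_subtractf sum_distrib_left algebra_simps)
  also have "(\<Sum>d=1..2*m. mangoldt d * real (m div d)) = (\<Sum>d=1..m. mangoldt d * real (m div d))"
    by (rule sum.mono_neutral_right) auto
  also have "(\<Sum>d=1..2*m. mangoldt d * real ((2*m) div d)) - 2 * \<dots> = ln ((2*m) choose m)"
    using pos unfolding ln_fact_eq_sum_mangoldt[symmetric] fac by (simp add: ln_mult)
  also have "\<dots> \<le> ln (2 ^ (2*m))"
  proof (subst ln_le_cancel_iff)
    have "(2*m) choose m \<le> 2 ^ (2*m)" by (rule binomial_le_pow2)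
    then show "real ((2*m) choose m) \<le> 2 ^ (2*m)"
      by (metis of_nat_le_iff of_nat_numeral of_nat_power)
  qed (use pos in auto)
  also have "\<dots> = 2 * real m * ln 2" by (simp add: ln_realpow)
  also have "\<dots> \<le> 2 * real m * 1"
    using ln_2_less_1 by (intro mult_left_mono) auto
  finally show ?thesis by simp
qed

lemma sum_mangoldt_le: "(\<Sum>d=1..N. mangoldt d :: real) \<le> 4 * real N"
proof (induction N rule: less_induct)
  case (less N)
  show ?case
  proof (cases "N = 0")
    case False
    define m where "m = N div 2"
    have IH: "(\<Sum>d=1..m. mangoldt d :: real) \<le> 4 * real m"
      using less.IH[of m] False by (simp add: m_def)
    have "{1..2*m} = {1..m} \<union> {m<..2*m}" by auto
    then have "(\<Sum>d=1..2*m. mangoldt d :: real)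
        = (\<Sum>d=1..m. mangoldt d) + (\<Sum>d\<in>{m<..2*m}. mangoldt d)"
      by (simp only:) (rule sum.union_disjoint, auto)
    with IH mangoldt_sum_dyadic_le[of m] have *: "(\<Sum>d=1..2*m. mangoldt d :: real) \<le> 6 * real m"
      by linarith
    show ?thesis
    proof (cases "even N")
      case True
      then have "N = 2 * m" by (simp add: m_def)
      with * show ?thesis by simp
    next
      case odd: False
      then have N: "N = Suc (2 * m)" by (simp add: m_def)
      have "mangoldt N \<le> ln (real N)" using N by (intro mangoldt_le) simp
      also have "\<dots> \<le> real N - 1" using N by (intro ln_le_minus_one) simp
      finally show ?thesis using * by (simp add: N)
    qed
  qed simp
qed

lemma sum_mangoldt_over_le:
  assumes "N > 0"
  shows "(\<Sum>d=1..N. mangoldt d / real d :: real) \<le> ln N + 4"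
proof -
  have "real N * (\<Sum>d=1..N. mangoldt d / real d) - (\<Sum>d=1..N. mangoldt d)
      = (\<Sum>d=1..N. mangoldt d * (real N / real d - 1))"
    by (simp add: sum_distrib_left sum_subtractf algebra_simps)
  also have "\<dots> \<le> (\<Sum>d=1..N. mangoldt d * real (N div d))"
  proof (intro sum_mono mult_left_mono mangoldt_nonneg)
    fix d
    show "real N / real d - 1 \<le> real (N div d)"
      proof (cases "d = 0")
      case False
      have "real N < real d * (real (N div d) + 1)"
        using dividend_less_times_div[of d N] False
        by (metis (no_types) add.commute distrib_left gr0I mult.right_neutral of_nat_1 of_nat_add of_nat_less_iff of_nat_mult)
      then show ?thesis using False by (simp add: field_simps)
    qed simp
  qed
  also have "\<dots> = ln (fact N)" by (rule ln_fact_eq_sum_mangoldt[symmetric])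
  also have "\<dots> \<le> ln (real N ^ N)"
  proof (subst ln_le_cancel_iff)
    show "fact N \<le> real N ^ N"
      by (metis fact_le_power order_refl of_nat_power)
  qed (use assms in auto)
  also have "\<dots> = real N * ln N" using assms by (simp add: ln_realpow)
  finally have "real N * (\<Sum>d=1..N. mangoldt d / real d) \<le> real N * (ln N + 4)"
    using sum_mangoldt_le[of N] by (simp add: algebra_simps)
  then show ?thesis using assms by simp
qed

definition primes_upto :: "nat \<Rightarrow> nat set" where
  "primes_upto N = {p. prime p \<and> p \<le> N}"

lemma finite_primes_upto [simp]: "finite (primes_upto N)"
  by (simp add: primes_upto_def)

lemma sum_ln_prime_over_le:
  assumes "N > 0"
  shows "(\<Sum>p\<in>primes_upto N. ln p / real p :: real) \<le> ln N + 4"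
proof -
  have "(\<Sum>p\<in>primes_upto N. ln p / real p :: real) = (\<Sum>p\<in>primes_upto N. mangoldt p / real p)"
    by (rule sum.cong) (auto simp: primes_upto_def)
  also have "\<dots> \<le> (\<Sum>d=1..N. mangoldt d / real d)"
    by (rule sum_mono2) (auto simp: primes_upto_def mangoldt_nonneg prime_gt_0_nat Suc_leI)
  finally show ?thesis using sum_mangoldt_over_le[OF assms] by simp
qed

lemma half_le_ln_2: "ln 2 \<ge> (1/2::real)"
  using ln_le_minus_one[of "1/2::real"] by (simp add: ln_div)

text \<open>
  Mertens' theorem by Abel summation over the blocks \<open>(2^s, 2^(s+1)]\<close>, on which \<open>1/p\<close> is at most
  \<open>(ln p / p) / (s ln 2)\<close>.
\<close>

lemma sum_inverse_primes_le:
  assumes "s \<ge> 1"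
  shows "(\<Sum>p\<in>primes_upto (2^s). 1 / real p) \<le> ln s + 20"
proof -
  define U where "U s = (\<Sum>p\<in>primes_upto (2^s). 1 / real p)" for s
  define L where "L s = (\<Sum>p\<in>primes_upto (2^s). ln p / real p)" for s
  have L: "L s \<le> real s * ln 2 + 4" for s
    using sum_ln_prime_over_le[of "2^s"] by (simp add: L_def ln_realpow)
  have split: "sum g (primes_upto (2 ^ Suc s))
      = sum g (primes_upto (2^s)) + sum g (primes_upto (2 ^ Suc s) - primes_upto (2^s))"
    for g :: "nat \<Rightarrow> real" and s
    using sum.subset_diff[of "primes_upto (2^s)" "primes_upto (2 ^ Suc s)" g]
    by (fastforce simp: primes_upto_def)
  have step1: "U (Suc s) - U s \<le> (L (Suc s) - L s) / (real s * ln 2)" if "s \<ge> 1" for s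
  proof -
    have "(\<Sum>p\<in>primes_upto (2 ^ Suc s) - primes_upto (2^s). 1 / real p)
      \<le> (\<Sum>p\<in>primes_upto (2 ^ Suc s) - primes_upto (2^s). ln p / real p / (real s * ln 2))"
    proof (rule sum_mono)
      fix p assume p: "p \<in> primes_upto (2 ^ Suc s) - primes_upto (2^s)"
      then have "p > 2 ^ s" by (auto simp: primes_upto_def)
      then have "real p \<ge> 2 ^ s"
        by (metis less_imp_le of_nat_le_iff of_nat_numeral of_nat_power)
      moreover have "real p > 0" using \<open>p > 2 ^ s\<close> by auto
      ultimately have "ln p \<ge> ln (2 ^ s :: real)" by (subst ln_le_cancel_iff) auto
      then have "ln p \<ge> real s * ln 2" by (simp add: ln_realpow)
      then show "1 / real p \<le> ln p / real p / (real s * ln 2)"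
        using that \<open>real p > 0\<close> by (simp add: field_simps)
    qed
    also have "\<dots> = (\<Sum>p\<in>primes_upto (2 ^ Suc s) - primes_upto (2^s). ln p / real p) / (real s * ln 2)"
      by (rule sum_divide_distrib[symmetric])
    finally show ?thesis
      using split[of "\<lambda>p. 1 / real p" s] split[of "\<lambda>p. ln p / real p" s] by (simp add: U_def L_def)
  qed
  have P1: "primes_upto 2 = {2}" by (auto simp: primes_upto_def prime_ge_2_nat le_antisym)
  (* Subtracting the boundary term of the summation by parts leaves increments of at most 1/s
     + O(1/s^2), whence the logarithm. *)
  have A: "U s - L s / (real s * ln 2) \<le> ln s + 9 * (1 - 1 / s) + 1/2" if "s \<ge> 1" for s
    using that
  proof (induction s rule: dec_induct)
    case base
    show ?case by (simp add: U_def L_def P1)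
  next
    case (step s)
    have s: "s \<ge> 1" using step by simp
    have l2: "ln 2 > (0::real)" by simp
    have "L (Suc s) * (1 / real s - 1 / real (Suc s)) / ln 2
      \<le> (real (Suc s) * ln 2 + 4) * (1 / real s - 1 / real (Suc s)) / ln 2"
      using s by (intro divide_right_mono mult_right_mono L) (auto simp: field_simps)
    also have "\<dots> = 1 / s + 4 / ln 2 * (1 / (real s * real (Suc s)))"
      using s l2 by (simp add: field_simps del: of_nat_Suc) (simp add: algebra_simps)
    also have "\<dots> \<le> 1 / s + 8 * (1 / (real s * real (Suc s)))"
      using half_le_ln_2 by (intro add_left_mono mult_right_mono) (auto simp: field_simps)
    finally have 1: "L (Suc s) * (1 / real s - 1 / real (Suc s)) / ln 2
       \<le> 1 / s + 8 * (1 / (real s * real (Suc s)))" .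
    have 2: "(L (Suc s) - L s) / (real s * ln 2) - L (Suc s) / (real (Suc s) * ln 2) + L s / (real s * ln 2)
       = L (Suc s) * (1 / real s - 1 / real (Suc s)) / ln 2"
      using s l2 by (simp add: field_simps del: of_nat_Suc)
    have "ln (real s / real (Suc s)) \<le> real s / real (Suc s) - 1"
      using s by (intro ln_le_minus_one) auto
    then have "ln (Suc s) \<ge> ln s + 1 / real (Suc s)"
      using s by (simp add: ln_div field_simps)
    moreover have "1 / real s - 1 / real (Suc s) = 1 / (real s * real (Suc s))"
      using s by (simp add: field_simps)
    ultimately show ?case
      using 1 2 step.IH step1[OF s] by argo
  qed
  have "L s / (real s * ln 2) \<le> (real s * ln 2 + 4) / (real s * ln 2)"
    using assms by (intro divide_right_mono L) auto
  also have "\<dots> = 1 + 4 / (real s * ln 2)" using assms by (simp add: field_simps)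
  also have "4 / (real s * ln 2) \<le> 8"
  proof -
    have "real s * ln 2 \<ge> 1 * (1/2)" using half_le_ln_2 assms by (intro mult_mono) auto
    then show ?thesis by (simp add: field_simps)
  qed
  finally have "L s / (real s * ln 2) \<le> 9" by simp
  moreover have "9 * (1 - 1 / real s) \<le> 9" by simp
  ultimately show ?thesis using A[OF assms] unfolding U_def by linarith
qed

lemma sum_inverse_pronic_le:
  assumes "finite A" "\<And>n. n \<in> A \<Longrightarrow> n \<ge> (2::nat)"
  shows "(\<Sum>n\<in>A. 1 / (real n * (real n - 1))) \<le> 1"
proof -
  define M where "M = Suc (Max (insert 1 A))"
  have telescope: "(\<Sum>n\<in>{2..<m}. 1 / (real n * (real n - 1))) = 1 - 1 / (real m - 1)" if "m \<ge> 2" for m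
    using that
  proof (induction m rule: dec_induct)
    case (step m)
    have "1 - 1 / (real m - 1) + 1 / (real m * (real m - 1)) = 1 - 1 / real m"
      using step.hyps by (simp add: divide_simps) (simp add: algebra_simps)
    with step show ?case by simp
  qed simp
  have "(\<Sum>n\<in>A. 1 / (real n * (real n - 1))) \<le> (\<Sum>n\<in>{2..<M}. 1 / (real n * (real n - 1)))"
  proof (rule sum_mono2)
    show "A \<subseteq> {2..<M}"
      using assms by (auto simp: M_def less_Suc_eq_le intro: Max_ge)
  qed auto
  also have "\<dots> \<le> 1"
  proof -
    have "M \<ge> 2" using Max_ge[of "insert 1 A" 1] assms(1) by (simp add: M_def)
    then show ?thesis using telescope[of M] by simp
  qed
  finally show ?thesis .
qed

text \<open>
  The exact power of \<open>s\<close> matters here: this bound is what makes the constant term of the sieve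
  majorant linear in \<open>s\<close>, and thereby gives exponent 1 in the end.
\<close>

lemma prod_primes_le:
  assumes "s \<ge> 1"
  shows "(\<Prod>p\<in>primes_upto (2^s). 1 / (1 - 1 / real p)) \<le> exp 21 * real s"
proof -
  have ge2: "p \<ge> 2" if "p \<in> primes_upto N" for p N
    using that by (auto simp: primes_upto_def prime_ge_2_nat)
  have "(\<Prod>p\<in>primes_upto (2^s). 1 / (1 - 1 / real p))
      \<le> (\<Prod>p\<in>primes_upto (2^s). exp (1 / real p + 1 / (real p * (real p - 1))))"
  proof (rule prod_mono)
    fix p assume "p \<in> primes_upto (2^s)"
    then have p: "real p \<ge> 2" using ge2 by force
    have "1 / (1 - 1 / real p) = 1 + (1 / real p + 1 / (real p * (real p - 1)))"
      using p by (simp add: field_simps)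
    also have "\<dots> \<le> exp (1 / real p + 1 / (real p * (real p - 1)))"
      by (rule exp_ge_add_one_self)
    finally show "0 \<le> 1 / (1 - 1 / real p) \<and>
        1 / (1 - 1 / real p) \<le> exp (1 / real p + 1 / (real p * (real p - 1)))"
      using p by simp
  qed
  also have "\<dots> = exp ((\<Sum>p\<in>primes_upto (2^s). 1 / real p)
      + (\<Sum>p\<in>primes_upto (2^s). 1 / (real p * (real p - 1))))"
    by (simp only: exp_sum[OF finite_primes_upto, symmetric] sum.distrib)
  also have "\<dots> \<le> exp (ln s + 21)"
  proof -
    have "(\<Sum>p\<in>primes_upto (2^s). 1 / (real p * (real p - 1))) \<le> 1"
      by (rule sum_inverse_pronic_le) (auto intro: ge2)
    with sum_inverse_primes_le[OF assms] show ?thesis by simp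
  qed
  also have "\<dots> = exp 21 * real s"
    using assms by (simp add: exp_add)
  finally show ?thesis .
qed

lemma primepow_aprimedivisor_decomp:
  assumes "primepow (n::nat)" "n \<le> 2 ^ k"
  obtains p j where "prime p" "j \<in> {1..k}" "n = p ^ j" "aprimedivisor n = p" "mangoldt n = ln (real p)"
proof -
  from assms(1) obtain p j where pj: "prime p" "j > 0" "n = p ^ j"
    by (auto simp: primepow_def)
  have "2 ^ j \<le> p ^ j" using pj(1) by (intro power_mono) (auto simp: prime_ge_2_nat)
  with assms(2) pj(3) have "(2::nat) ^ j \<le> 2 ^ k" by linarith
  then have "j \<le> k" by simp
  then show ?thesis using pj
    by (intro that[of p j]) (auto simp: aprimedivisor_prime_power)
qed

lemma card_primepow_small_base_le:
  "card {n\<in>{1..2^k::nat}. primepow n \<and> aprimedivisor n \<le> M} \<le> M * k"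
proof -
  have "{n\<in>{1..2^k::nat}. primepow n \<and> aprimedivisor n \<le> M} \<subseteq> (\<lambda>(p, j). p ^ j) ` ({1..M} \<times> {1..k})"
  proof
    fix n assume n: "n \<in> {n\<in>{1..2^k::nat}. primepow n \<and> aprimedivisor n \<le> M}"
    then have "primepow n" "n \<le> 2 ^ k" "aprimedivisor n \<le> M" by auto
    then obtain p j where "prime p" "j \<in> {1..k}" "n = p ^ j" "aprimedivisor n = p"
      by (metis primepow_aprimedivisor_decomp)
    then show "n \<in> (\<lambda>(p, j). p ^ j) ` ({1..M} \<times> {1..k})"
      using \<open>aprimedivisor n \<le> M\<close> prime_gt_0_nat[of p]
      by (intro image_eqI[of _ _ "(p, j)"]) auto
  qed
  then have "card {n\<in>{1..2^k::nat}. primepow n \<and> aprimedivisor n \<le> M}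
      \<le> card ((\<lambda>(p, j). p ^ j) ` ({1..M} \<times> {1..k}))"
    by (intro card_mono) auto
  also have "\<dots> \<le> card ({1..M} \<times> {1..k})" by (rule card_image_le) simp
  finally show ?thesis by simp
qed

text \<open>
  The powers of the primes up to the sieving limit \<open>2^r\<close> are the ones that the sieve majorant does not
  see. They are too sparse to matter.
\<close>

lemma sum_mangoldt_small_base_le:
  "(\<Sum>n | n \<in> {1..2^k::nat} \<and> primepow n \<and> aprimedivisor n \<le> 2^r. mangoldt n :: real) \<le> 2^r * real k * real r"
proof -
  have "(\<Sum>n | n \<in> {1..2^k::nat} \<and> primepow n \<and> aprimedivisor n \<le> 2^r. mangoldt n :: real)
     \<le> (\<Sum>n | n \<in> {1..2^k::nat} \<and> primepow n \<and> aprimedivisor n \<le> 2^r. real r)"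
  proof (rule sum_mono)
    fix n assume n: "n \<in> {n. n \<in> {1..2^k::nat} \<and> primepow n \<and> aprimedivisor n \<le> 2^r}"
    then have n': "primepow n" "n \<le> 2^k" by auto
    obtain p j where p: "prime p" "aprimedivisor n = p" "mangoldt n = ln (real p)"
      using primepow_aprimedivisor_decomp[OF n'] by metis
    from p n have "p \<le> 2^r" by simp
    then have "real p \<le> 2^r" by (metis of_nat_le_iff of_nat_numeral of_nat_power)
    then have "ln (real p) \<le> ln (2^r)" using prime_gt_0_nat[OF p(1)] by (subst ln_le_cancel_iff) auto
    also have "\<dots> = real r * ln 2" by (simp add: ln_realpow)
    also have "\<dots> \<le> real r * 1" using ln_2_less_1 by (intro mult_left_mono) auto
    finally show "mangoldt n \<le> real r" using p by simp
  qed
  also have "\<dots> = real (card {n\<in>{1..2^k::nat}. primepow n \<and> aprimedivisor n \<le> 2^r}) * real r"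
    by (simp add: Collect_conj_eq)
  also have "\<dots> \<le> real (2^r * k) * real r"
    by (intro mult_right_mono of_nat_mono card_primepow_small_base_le) auto
  finally show ?thesis by simp
qed

text \<open>
  A prime power up to \<open>2^k\<close> with base above \<open>2^(k/4)\<close> has a von Mangoldt value of at least
  \<open>(k/4) ln 2\<close>, so Chebyshev's bound counts these; the others are at most \<open>k\<close> powers of each of about
  \<open>2^(k/4)\<close> bases.
\<close>

lemma card_primepow_le:
  "real k * real (card {n\<in>{1..2^k::nat}. mangoldt n \<noteq> (0::real)}) \<le> 64 * 2^k"
proof -
  define m where "m = k div 4"
  define S where "S = {n\<in>{1..2^k::nat}. primepow n \<and> aprimedivisor n \<le> 2^(m+1)}"
  define L where "L = {n\<in>{1..2^k::nat}. primepow n \<and> aprimedivisor n > 2^(m+1)}"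
  have fin: "finite S" "finite L" by (auto simp: S_def L_def)
  have k: "4 * m \<le> k" "k < 4 * m + 4" by (auto simp: m_def)
  have "{n\<in>{1..2^k::nat}. mangoldt n \<noteq> (0::real)} \<subseteq> S \<union> L"
    by (auto simp: S_def L_def mangoldt_def split: if_splits)
  then have "card {n\<in>{1..2^k::nat}. mangoldt n \<noteq> (0::real)} \<le> card S + card L"
    by (meson fin card_mono card_Un_le finite_UnI le_trans)
  then have 1: "real k * real (card {n\<in>{1..2^k::nat}. mangoldt n \<noteq> (0::real)})
     \<le> real k * real (card S) + real k * real (card L)"
    by (subst distrib_left[symmetric], intro mult_left_mono) (auto simp flip: of_nat_add)
  have "k * card S \<le> k * (2^(m+1) * k)"
    unfolding S_def by (intro mult_left_mono card_primepow_small_base_le) auto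
  also have "\<dots> = 2 * 2^m * (k * k)" by simp
  also have "\<dots> \<le> 2 * 2^m * ((4 * 2^m) * (4 * 2^m))"
  proof -
    have "m < 2^m" by (rule less_exp)
    with k have "k \<le> 4 * 2^m" by linarith
    then show ?thesis by (intro mult_left_mono mult_mono) auto
  qed
  also have "\<dots> \<le> 32 * 2^(4*m)"
  proof -
    have "2 * 2^m * ((4 * 2^m) * (4 * 2^m)) = 32 * ((2::nat)^m * 2^m * 2^m)" by simp
    also have "(2::nat)^m * 2^m * 2^m = 2^(3*m)"
    proof -
      have "3 * m = m + m + m" by simp
      then show ?thesis by (simp only: power_add)
    qed
    also have "32 * (2::nat)^(3*m) \<le> 32 * 2^(4*m)" by (simp add: power_increasing)
    finally show ?thesis .
  qed
  also have "\<dots> \<le> 32 * 2^k" using k by simp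
  finally have "real (k * card S) \<le> real (32 * 2^k)" by (rule of_nat_mono)
  then have 2: "real k * real (card S) \<le> 32 * 2^k" by simp
  have "real (card L) * (real k / 4 * ln 2) = (\<Sum>n\<in>L. real k / 4 * ln 2)" by simp
  also have "\<dots> \<le> (\<Sum>n\<in>L. mangoldt n)"
  proof (rule sum_mono)
    fix n assume n: "n \<in> L"
    then have n': "primepow n" "n \<le> 2^k" by (auto simp: L_def)
    obtain p j where p: "prime p" "aprimedivisor n = p" "mangoldt n = ln (real p)"
      using primepow_aprimedivisor_decomp[OF n'] by metis
    from p n have "2^(m+1) \<le> p" by (simp add: L_def)
    then have "2^(m+1) \<le> real p" by (metis of_nat_le_iff of_nat_numeral of_nat_power)
    then have "ln (2^(m+1)) \<le> ln (real p)" using prime_gt_0_nat[OF p(1)] by (subst ln_le_cancel_iff) auto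
    then have "real (m+1) * ln 2 \<le> mangoldt n" using p by (simp only: ln_realpow)
    moreover have "real k / 4 * ln 2 \<le> real (m+1) * ln 2"
      using k by (intro mult_right_mono) auto
    ultimately show "real k / 4 * ln 2 \<le> mangoldt n" by linarith
  qed
  also have "\<dots> \<le> (\<Sum>n=1..2^k. mangoldt n)"
    by (intro sum_mono2) (auto simp: L_def mangoldt_nonneg)
  also have "\<dots> \<le> 4 * 2^k" using sum_mangoldt_le[of "2^k"] by simp
  finally have "(real k * real (card L)) * ln 2 \<le> 16 * 2^k" by (simp add: field_simps)
  moreover have "(real k * real (card L)) * (1/2) \<le> (real k * real (card L)) * ln 2"
    using half_le_ln_2 by (intro mult_left_mono) auto
  ultimately have 3: "real k * real (card L) \<le> 32 * 2^k" by linarith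
  from 1 2 3 show ?thesis by linarith
qed

section \<open>Square norms, maximal functions and almost orthogonality\<close>

text \<open>
  A bound on all finite partial norms: this is the \<open>\<ell>\<^sup>2\<close> norm bound, free of summability conditions.
\<close>

definition l2_bounded :: "(int \<Rightarrow> real) \<Rightarrow> real \<Rightarrow> bool" where
  "l2_bounded f B \<longleftrightarrow> (\<forall>S. finite S \<longrightarrow> L2_set f S \<le> B)"

lemma l2_boundedD: "l2_bounded f B \<Longrightarrow> finite S \<Longrightarrow> L2_set f S \<le> B"
  by (simp add: l2_bounded_def)

lemma l2_boundedI: "(\<And>S. finite S \<Longrightarrow> L2_set f S \<le> B) \<Longrightarrow> l2_bounded f B"
  by (simp add: l2_bounded_def)

lemma l2_bounded_nonneg: "l2_bounded f B \<Longrightarrow> B \<ge> 0"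
  using l2_boundedD[of f B "{}"] by simp

lemma l2_bounded_le: "l2_bounded f B \<Longrightarrow> B \<le> B' \<Longrightarrow> l2_bounded f B'"
  by (meson l2_bounded_def order_trans)

lemma L2_set_abs_mono:
  assumes "\<And>x. x \<in> S \<Longrightarrow> \<bar>f x\<bar> \<le> \<bar>g x\<bar>"
  shows "L2_set f S \<le> L2_set g S"
  unfolding L2_set_def using assms by (intro real_sqrt_le_mono sum_mono) (simp add: abs_le_square_iff)

lemma l2_bounded_mono:
  assumes "l2_bounded g B" "\<And>x. \<bar>f x\<bar> \<le> \<bar>g x\<bar>"
  shows "l2_bounded f B"
  by (intro l2_boundedI order_trans[OF L2_set_abs_mono l2_boundedD[OF assms(1)]] assms(2))

lemma l2_bounded_zero: "l2_bounded (\<lambda>x. 0) 0"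
  by (simp add: l2_bounded_def L2_set_def)

lemma l2_bounded_add:
  assumes "l2_bounded f A" "l2_bounded g B"
  shows "l2_bounded (\<lambda>x. f x + g x) (A + B)"
  by (intro l2_boundedI order_trans[OF L2_set_triangle_ineq] add_mono l2_boundedD[OF assms(1)]
      l2_boundedD[OF assms(2)])

lemma l2_bounded_sum:
  assumes "finite I" "\<And>i. i \<in> I \<Longrightarrow> l2_bounded (f i) (B i)"
  shows "l2_bounded (\<lambda>x. \<Sum>i\<in>I. f i x) (\<Sum>i\<in>I. B i)"
  using assms
proof (induction I rule: finite_induct)
  case empty
  then show ?case by (simp add: l2_bounded_zero)
next
  case (insert i I)
  then show ?case by (simp add: l2_bounded_add)
qed

lemma l2_bounded_cmult:
  assumes "l2_bounded f B"
  shows "l2_bounded (\<lambda>x. c * f x) (\<bar>c\<bar> * B)"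
proof (rule l2_boundedI)
  fix S :: "int set" assume S: "finite S"
  have "L2_set (\<lambda>x. c * f x) S = \<bar>c\<bar> * L2_set f S"
    by (simp add: L2_set_def power_mult_distrib real_sqrt_mult flip: sum_distrib_left)
  also have "\<dots> \<le> \<bar>c\<bar> * B" using l2_boundedD[OF assms S] by (intro mult_left_mono) auto
  finally show "L2_set (\<lambda>x. c * f x) S \<le> \<bar>c\<bar> * B" .
qed

lemma l2_bounded_shift:
  assumes "l2_bounded f B"
  shows "l2_bounded (\<lambda>x. f (x - h)) B"
proof (rule l2_boundedI)
  fix S :: "int set" assume S: "finite S"
  have "L2_set (\<lambda>x. f (x - h)) S = L2_set f ((\<lambda>x. x - h) ` S)"
    by (simp add: L2_set_def sum.reindex inj_on_def)
  also have "\<dots> \<le> B" using l2_boundedD[OF assms] S by auto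
  finally show "L2_set (\<lambda>x. f (x - h)) S \<le> B" .
qed

lemma l2_bounded_conv:
  assumes "l2_bounded f B" "finite T"
  shows "l2_bounded (\<lambda>x. \<Sum>n\<in>T. K n * f (x - h n)) ((\<Sum>n\<in>T. \<bar>K n\<bar>) * B)"
  unfolding sum_distrib_right
  by (intro l2_bounded_sum l2_bounded_cmult l2_bounded_shift[OF assms(1)] assms(2))

lemma l2_bounded_finite_support:
  assumes "finite S" "\<And>x. x \<notin> S \<Longrightarrow> f x = 0"
  shows "l2_bounded f (L2_set f S)"
proof (rule l2_boundedI)
  fix T :: "int set" assume T: "finite T"
  have "(\<Sum>x\<in>T. (f x)\<^sup>2) = (\<Sum>x\<in>T \<inter> S. (f x)\<^sup>2)"
    by (rule sum.mono_neutral_right) (use T assms in auto)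
  also have "\<dots> \<le> (\<Sum>x\<in>S. (f x)\<^sup>2)" by (rule sum_mono2) (use assms in auto)
  finally show "L2_set f T \<le> L2_set f S" by (simp add: L2_set_def)
qed

lemma l2_bounded_card_le:
  assumes "l2_bounded V B" "finite S" "\<And>x. x \<in> S \<Longrightarrow> \<mu> \<le> V x" "\<mu> \<ge> 0"
  shows "\<mu>\<^sup>2 * real (card S) \<le> B\<^sup>2"
proof -
  have "\<mu>\<^sup>2 * real (card S) = (\<Sum>x\<in>S. \<mu>\<^sup>2)" by simp
  also have "\<dots> \<le> (\<Sum>x\<in>S. (V x)\<^sup>2)" using assms by (intro sum_mono power_mono) auto
  also have "\<dots> = (L2_set V S)\<^sup>2" by (simp add: L2_set_def sum_nonneg)
  also have "\<dots> \<le> B\<^sup>2" using l2_boundedD[OF assms(1,2)] by (intro power_mono) auto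
  finally show ?thesis .
qed

text \<open>
  The weak type (1,1) bound for averages that look to the left along a progression with step \<open>d\<close>. As the
  windows are one-sided, no covering lemma is needed: take the largest point of \<open>E\<close> and discard
  all points of \<open>E\<close> in its window. The windows of the remaining points are disjoint from this one,
  because they lie further to the left or in another residue class.
\<close>

lemma card_one_sided_maximal_le:
  fixes f :: "int \<Rightarrow> real" and d :: int
  assumes "finite E" "d > 0" "\<mu> > 0" "\<And>x. f x \<ge> 0"
    and "\<And>x. x \<in> E \<Longrightarrow> \<exists>N\<ge>1. \<mu> * real N < (\<Sum>n=1..N. f (x - d * int n))"
  shows "\<exists>W. finite W \<and> W \<subseteq> {z. \<exists>y\<in>E. z < y \<and> d dvd (y - z)} \<and> \<mu> * real (card E) \<le> 2 * (\<Sum>z\<in>W. f z)"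
  using assms(1,5)
proof (induction "card E" arbitrary: E rule: less_induct)
  case less
  show ?case
  proof (cases "E = {}")
    case True
    then show ?thesis by (intro exI[of _ "{}"]) auto
  next
    case False
    define x where "x = Max E"
    have x: "x \<in> E" "\<And>y. y \<in> E \<Longrightarrow> y \<le> x"
      using less.prems(1) False by (auto simp: x_def)
    obtain N where N: "N \<ge> 1" "\<mu> * real N < (\<Sum>n=1..N. f (x - d * int n))"
      using less.prems(2)[OF x(1)] by blast
    define B where "B = (\<lambda>n. x - d * int n) ` {1..N}"
    have inj: "inj_on (\<lambda>n. x - d * int n) {1..N}" using assms(2) by (auto simp: inj_on_def)
    have B: "finite B" "card B = N" "(\<Sum>z\<in>B. f z) = (\<Sum>n=1..N. f (x - d * int n))"
      using inj by (auto simp: B_def card_image sum.reindex)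
    define E' where "E' = E - insert x B"
    have "E' \<subset> E" using x by (auto simp: E'_def)
    then have "card E' < card E" using less.prems(1) by (simp add: psubset_card_mono)
    moreover have "finite E'" using less.prems(1) by (simp add: E'_def)
    ultimately obtain W' where W': "finite W'" "W' \<subseteq> {z. \<exists>y\<in>E'. z < y \<and> d dvd (y - z)}"
       "\<mu> * real (card E') \<le> 2 * (\<Sum>z\<in>W'. f z)"
      using less.hyps[of E'] less.prems(2) by (auto simp: E'_def)
    have disj: "W' \<inter> B = {}"
    proof (rule ccontr)
      assume "W' \<inter> B \<noteq> {}"
      then obtain z where z: "z \<in> W'" "z \<in> B" by auto
      then obtain y where y: "y \<in> E'" "z < y" "d dvd (y - z)" using W' by auto
      obtain n where n: "n \<in> {1..N}" "z = x - d * int n" using z by (auto simp: B_def)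
      have "y \<le> x" "y \<noteq> x" using y(1) x(2) by (auto simp: E'_def)
      obtain j where j: "y - z = d * j" using y(3) by (auto elim: dvdE)
      have "d * j > 0" using j y(2) by linarith
      then have "j > 0" using assms(2) by (simp add: zero_less_mult_iff)
      have yx: "y = x - d * (int n - j)" using j n(2) by (simp add: algebra_simps)
      have "d * (int n - j) > 0" using yx \<open>y \<le> x\<close> \<open>y \<noteq> x\<close> by linarith
      then have "int n - j > 0" using assms(2) by (simp add: zero_less_mult_iff)
      then have "y = x - d * int (nat (int n - j))" "nat (int n - j) \<in> {1..N}"
        using yx n(1) \<open>j > 0\<close> by auto
      then have "y \<in> B" unfolding B_def by blast
      then show False using y(1) by (simp add: E'_def)
    qed
    have "card E \<le> card (E' \<union> insert x B)"
      using less.prems(1) B by (intro card_mono) (auto simp: E'_def)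
    also have "\<dots> \<le> card E' + card (insert x B)" by (rule card_Un_le)
    also have "\<dots> \<le> card E' + 2 * N" using B N(1) by (simp add: card_insert_if)
    finally have "\<mu> * real (card E) \<le> \<mu> * real (card E' + 2 * N)"
      using assms(3) by (intro mult_left_mono) auto
    also have "\<dots> \<le> 2 * (\<Sum>z\<in>W'. f z) + 2 * (\<Sum>z\<in>B. f z)"
      using W'(3) N(2) B(3) by (simp add: algebra_simps)
    also have "\<dots> = 2 * (\<Sum>z\<in>W' \<union> B. f z)"
      using W'(1) B(1) disj by (simp add: sum.union_disjoint)
    finally have "\<mu> * real (card E) \<le> 2 * (\<Sum>z\<in>W' \<union> B. f z)" .
    moreover have "W' \<union> B \<subseteq> {z. \<exists>y\<in>E. z < y \<and> d dvd (y - z)}"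
      using W'(2) x(1) assms(2) by (force simp: B_def E'_def)
    ultimately show ?thesis using W'(1) B(1) by (intro exI[of _ "W' \<union> B"]) auto
  qed
qed

lemma square_le_sum_dyadic_levels:
  fixes \<eta> m :: real
  assumes "\<eta> > 0" "\<eta> < m" "m \<le> \<eta> * 2^I"
  shows "m\<^sup>2 \<le> 4 * (\<Sum>i<I. if \<eta> * 2^i < m then (\<eta> * 2^i)\<^sup>2 else 0)"
proof -
  define i where "i = (LEAST i. m \<le> \<eta> * 2^i)"
  have i: "m \<le> \<eta> * 2^i" unfolding i_def using assms(3) by (rule LeastI)
  have "i \<noteq> 0" using i assms(2) by (cases i) auto
  then obtain j where j: "i = Suc j" by (cases i) auto
  have "\<not> m \<le> \<eta> * 2^j" using not_less_Least[of j "\<lambda>i. m \<le> \<eta> * 2^i"] j by (simp add: i_def)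
  then have lt: "\<eta> * 2^j < m" by simp
  have "i \<le> I" unfolding i_def using assms(3) by (rule Least_le)
  then have "j < I" using j by simp
  have "m\<^sup>2 \<le> (2 * (\<eta> * 2^j))\<^sup>2" using i j assms by (intro power_mono) auto
  also have "\<dots> = 4 * (\<Sum>i\<in>{j}. if \<eta> * 2^i < m then (\<eta> * 2^i)\<^sup>2 else 0)"
    using lt by (simp add: power2_eq_square)
  also have "\<dots> \<le> 4 * (\<Sum>i<I. if \<eta> * 2^i < m then (\<eta> * 2^i)\<^sup>2 else 0)"
    using \<open>j < I\<close> by (intro mult_left_mono sum_mono2) auto
  finally show ?thesis .
qed

lemma sum_dyadic_levels_le:
  fixes \<eta> v :: real
  assumes "\<eta> > 0" "v \<ge> 0"
  shows "(\<Sum>i<I. if \<eta> * 2^i < v then \<eta> * 2^i else 0) \<le> 2 * v"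
proof (induction I)
  case (Suc I)
  show ?case
  proof (cases "\<eta> * 2^I < v")
    case True
    have "(\<Sum>i<Suc I. if \<eta> * 2^i < v then \<eta> * 2^i else 0) \<le> (\<Sum>i<Suc I. \<eta> * 2^i)"
      using assms by (intro sum_mono) auto
    also have "\<dots> = \<eta> * (2^Suc I - 1)"
      by (simp only: sum_distrib_left[symmetric]) (simp add: geometric_sum)
    also have "\<dots> \<le> 2 * v" using True assms by (simp add: algebra_simps)
    finally show ?thesis .
  qed (use Suc in simp)
qed (use assms in simp)

text \<open>
  Interpolation between the weak type bound and the trivial bound on bounded functions: at the level
  \<open>\<lambda> = \<eta> 2^i\<close> only the part of \<open>f\<close> above \<open>\<lambda>/2\<close> matters, and summing the levels dyadically leaves a
  geometric sum below \<open>2 f\<close> at each point. In place of a supremum, \<open>m\<close> is any function whose positive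
  values are attained by some average.
\<close>

lemma l2_bounded_one_sided_maximal:
  fixes f m :: "int \<Rightarrow> real" and d :: int
  assumes "d > 0" "\<And>x. f x \<ge> 0" "\<And>x. m x \<ge> 0" "l2_bounded f B"
    and max: "\<And>x. m x > 0 \<Longrightarrow> \<exists>N\<ge>1. m x * real N \<le> (\<Sum>n=1..N. f (x - d * int n))"
  shows "l2_bounded m (8 * B)"
proof (rule l2_boundedI)
  fix S0 :: "int set" assume "finite S0"
  define S where "S = {x\<in>S0. m x > 0}"
  have S: "finite S" "\<And>x. x \<in> S \<Longrightarrow> m x > 0" using \<open>finite S0\<close> by (auto simp: S_def)
  have B0: "B \<ge> 0" by (rule l2_bounded_nonneg[OF assms(4)])
  have "L2_set m S0 = L2_set m S"
    unfolding L2_set_def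
    by (intro arg_cong[of _ _ sqrt] sum.mono_neutral_right)
       (use \<open>finite S0\<close> assms(3) in \<open>auto simp: S_def less_le\<close>)
  also have "\<dots> \<le> 8 * B"
  proof (cases "S = {}")
    case True then show ?thesis using B0 by simp
  next
    case False
    define \<eta> where "\<eta> = Min (m ` S) / 2"
    have \<eta>: "\<eta> > 0" "\<And>x. x \<in> S \<Longrightarrow> \<eta> < m x"
    proof -
      have "Min (m ` S) \<in> m ` S" using S(1) False by (intro Min_in) auto
      then have "Min (m ` S) > 0" using S(2) by auto
      moreover have "Min (m ` S) \<le> m x" if "x \<in> S" for x using that S(1) by simp
      ultimately show "\<eta> > 0" "\<And>x. x \<in> S \<Longrightarrow> \<eta> < m x" by (force simp: \<eta>_def)+
    qed
    obtain I where I: "Max (m ` S) / \<eta> < 2^I" using real_arch_pow[of 2 "Max (m ` S) / \<eta>"] by auto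
    have mI: "m x \<le> \<eta> * 2^I" if "x \<in> S" for x
    proof -
      have "m x \<le> Max (m ` S)" using that S(1) by simp
      with I \<eta>(1) show ?thesis by (simp add: field_simps)
    qed
    (* The part of f below half the level cannot raise an average to the level. *)
    define g where "g i z = (if \<eta> * 2^i < 2 * f z then f z else 0)" for i z
    have "\<exists>W. finite W \<and> (\<eta> * 2^i / 2) * real (card {x\<in>S. \<eta> * 2^i < m x}) \<le> 2 * (\<Sum>z\<in>W. g i z)" for i
    proof -
      have "\<exists>N\<ge>1. (\<eta> * 2^i / 2) * real N < (\<Sum>n=1..N. g i (x - d * int n))"
        if "x \<in> {x\<in>S. \<eta> * 2^i < m x}" for x
      proof -
        from that have x: "m x > 0" "\<eta> * 2^i < m x" using S(2) by auto
        obtain N where N: "N \<ge> 1" "m x * real N \<le> (\<Sum>n=1..N. f (x - d * int n))"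
          using max[OF x(1)] by blast
        have "(\<eta> * 2^i) * real N < m x * real N" using x N(1) by (intro mult_strict_right_mono) auto
        also note N(2)
        also have "(\<Sum>n=1..N. f (x - d * int n)) \<le> (\<Sum>n=1..N. g i (x - d * int n) + \<eta> * 2^i / 2)"
          using \<eta>(1) by (intro sum_mono) (auto simp: g_def)
        also have "\<dots> = (\<Sum>n=1..N. g i (x - d * int n)) + real N * (\<eta> * 2^i / 2)"
          by (simp add: sum.distrib)
        finally show ?thesis using N(1) by (intro exI[of _ N]) (auto simp: algebra_simps)
      qed
      then have "\<exists>W. finite W \<and> W \<subseteq> {z. \<exists>y\<in>{x\<in>S. \<eta> * 2^i < m x}. z < y \<and> d dvd (y - z)} \<and>
         (\<eta> * 2^i / 2) * real (card {x\<in>S. \<eta> * 2^i < m x}) \<le> 2 * (\<Sum>z\<in>W. g i z)"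
        using S(1) \<eta>(1) assms(1,2) by (intro card_one_sided_maximal_le) (auto simp: g_def)
      then show ?thesis by blast
    qed
    then obtain W where W: "\<And>i. finite (W i)"
      "\<And>i. (\<eta> * 2^i / 2) * real (card {x\<in>S. \<eta> * 2^i < m x}) \<le> 2 * (\<Sum>z\<in>W i. g i z)"
      by metis
    define Y where "Y = (\<Union>i<I. W i)"
    have Y: "finite Y" using W(1) by (auto simp: Y_def)
    have "(\<Sum>x\<in>S. (m x)\<^sup>2) \<le> (\<Sum>x\<in>S. 4 * (\<Sum>i<I. if \<eta> * 2^i < m x then (\<eta> * 2^i)\<^sup>2 else 0))"
      using \<eta> mI by (intro sum_mono square_le_sum_dyadic_levels) auto
    also have "\<dots> = 4 * (\<Sum>i<I. \<Sum>x\<in>S. if \<eta> * 2^i < m x then (\<eta> * 2^i)\<^sup>2 else 0)"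
      unfolding sum_distrib_left[symmetric] by (subst sum.swap) simp
    also have "\<dots> = 4 * (\<Sum>i<I. (\<eta> * 2^i)\<^sup>2 * real (card {x\<in>S. \<eta> * 2^i < m x}))"
      using S(1) by (simp add: sum.If_cases Int_def mult.commute)
    also have "\<dots> \<le> 4 * (\<Sum>i<I. 4 * (\<eta> * 2^i) * (\<Sum>z\<in>Y. g i z))"
    proof (intro mult_left_mono sum_mono)
      fix i assume i: "i \<in> {..<I}"
      have "(\<eta> * 2^i)\<^sup>2 * real (card {x\<in>S. \<eta> * 2^i < m x})
        = 2 * (\<eta> * 2^i) * ((\<eta> * 2^i / 2) * real (card {x\<in>S. \<eta> * 2^i < m x}))"
        by (simp add: power2_eq_square)
      also have "\<dots> \<le> 2 * (\<eta> * 2^i) * (2 * (\<Sum>z\<in>W i. g i z))"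
        using \<eta>(1) by (intro mult_left_mono W(2)) auto
      also have "\<dots> \<le> 2 * (\<eta> * 2^i) * (2 * (\<Sum>z\<in>Y. g i z))"
        using \<eta>(1) Y i assms(2)
        by (intro mult_left_mono sum_mono2) (auto simp: Y_def g_def)
      finally show "(\<eta> * 2^i)\<^sup>2 * real (card {x\<in>S. \<eta> * 2^i < m x}) \<le> 4 * (\<eta> * 2^i) * (\<Sum>z\<in>Y. g i z)"
        by simp
    qed simp
    also have "\<dots> = 16 * (\<Sum>z\<in>Y. f z * (\<Sum>i<I. if \<eta> * 2^i < 2 * f z then \<eta> * 2^i else 0))"
      unfolding sum_distrib_left
      by (subst sum.swap, intro sum.cong refl) (auto simp: g_def)
    also have "\<dots> \<le> 16 * (\<Sum>z\<in>Y. f z * (2 * (2 * f z)))"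
      using \<eta>(1) assms(2) by (intro mult_left_mono sum_mono sum_dyadic_levels_le) auto
    also have "\<dots> = 64 * (L2_set f Y)\<^sup>2"
      by (simp add: L2_set_def sum_nonneg sum_distrib_left sum_distrib_right power2_eq_square algebra_simps)
    also have "\<dots> \<le> 64 * B\<^sup>2"
      using l2_boundedD[OF assms(4) Y] by (intro mult_left_mono power_mono) auto
    finally have "(\<Sum>x\<in>S. (m x)\<^sup>2) \<le> (8 * B)\<^sup>2" by (simp add: power_mult_distrib)
    then show ?thesis using B0 unfolding L2_set_def by (intro real_le_lsqrt) (auto simp: sum_nonneg)
  qed
  finally show "L2_set m S0 \<le> 8 * B" .
qed

lemma sum_mult_shift_swap:
  fixes f g :: "int \<Rightarrow> real"
  assumes "finite S" "finite S'" "\<And>x. x \<notin> S \<Longrightarrow> f x = 0" "\<And>x. x \<notin> S' \<Longrightarrow> g x = 0"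
  shows "(\<Sum>x\<in>S'. g x * f (x - h)) = (\<Sum>y\<in>S. f y * g (y + h))"
proof -
  have "(\<Sum>x\<in>S'. g x * f (x - h)) = (\<Sum>x\<in>S' \<inter> (\<lambda>y. y + h) ` S. g x * f (x - h))"
  proof (rule sum.mono_neutral_right)
    show "\<forall>i\<in>S' - S' \<inter> (\<lambda>y. y + h) ` S. g i * f (i - h) = 0"
    proof
      fix i assume "i \<in> S' - S' \<inter> (\<lambda>y. y + h) ` S"
      then have "i - h \<notin> S" by (auto simp: image_iff)
      then show "g i * f (i - h) = 0" using assms(3) by simp
    qed
  qed (use assms in auto)
  also have "\<dots> = (\<Sum>x\<in>(\<lambda>y. y + h) ` S. g x * f (x - h))"
    by (rule sum.mono_neutral_left) (use assms in auto)
  also have "\<dots> = (\<Sum>y\<in>S. g (y + h) * f y)" by (simp add: sum.reindex inj_on_def)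
  finally show ?thesis by (simp add: mult.commute)
qed

definition differences :: "int set \<Rightarrow> int set" where
  "differences T = (\<lambda>(m, m'). m' - m) ` (T \<times> T)"

text \<open>
  This and \<open>differences\<close> describe the composition of the convolution with \<open>v\<close> and the adjoint of the
  convolution with \<open>u\<close>, for kernels supported in \<open>T\<close>.
\<close>

definition correlation :: "int set \<Rightarrow> (int \<Rightarrow> real) \<Rightarrow> (int \<Rightarrow> real) \<Rightarrow> int \<Rightarrow> real" where
  "correlation T u v h = (\<Sum>(m, m') | m \<in> T \<and> m' \<in> T \<and> m' - m = h. u m * v m')"

text \<open>
  The duality argument for a family of convolutions whose mutual correlations are small. With
  \<open>g i\<close> the convolution of \<open>f\<close> with \<open>K i\<close>, the left-hand side \<open>A\<close> is the inner product of \<open>f\<close> with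
  \<open>u\<close>, the sum of the adjoint convolutions of the \<open>g i\<close>; expanding the norm of \<open>u\<close> produces the
  correlations and gives \<open>\<parallel>u\<parallel>\<^sup>2 \<le> \<kappa> A\<close>, hence \<open>A\<^sup>2 \<le> \<parallel>f\<parallel>\<^sup>2 \<kappa> A\<close>.
\<close>

lemma bessel_almost_orthogonal:
  fixes f :: "int \<Rightarrow> real" and K :: "'i \<Rightarrow> int \<Rightarrow> real"
  assumes "\<kappa> \<ge> 0" and fin: "finite I" "finite T" "finite S" "\<And>x. x \<notin> S \<Longrightarrow> f x = 0"
    and corr: "\<And>i j. i \<in> I \<Longrightarrow> j \<in> I \<Longrightarrow>
      (\<Sum>h\<in>differences T. \<bar>correlation T (K i) (K j) h\<bar>) \<le> e i j"
    and row: "\<And>i. i \<in> I \<Longrightarrow> (\<Sum>j\<in>I. e i j) \<le> \<kappa>"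
    and col: "\<And>j. j \<in> I \<Longrightarrow> (\<Sum>i\<in>I. e i j) \<le> \<kappa>"
    and S': "finite S'" "\<And>i x. i \<in> I \<Longrightarrow> x \<notin> S' \<Longrightarrow> (\<Sum>m\<in>T. K i m * f (x - m)) = 0"
  shows "(\<Sum>i\<in>I. (L2_set (\<lambda>x. \<Sum>m\<in>T. K i m * f (x - m)) S')\<^sup>2) \<le> \<kappa> * (L2_set f S)\<^sup>2"
proof -
  define g where "g i x = (\<Sum>m\<in>T. K i m * f (x - m))" for i x
  have g0: "g i x = 0" if "i \<in> I" "x \<notin> S'" for i x using S'(2) that by (simp add: g_def)
  define n where "n i = L2_set (g i) S'" for i
  define A where "A = (\<Sum>i\<in>I. (n i)\<^sup>2)"
  define u where "u y = (\<Sum>i\<in>I. \<Sum>m\<in>T. K i m * g i (y + m))" for y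
  have n2: "(n i)\<^sup>2 = (\<Sum>x\<in>S'. g i x * g i x)" for i
    by (simp add: n_def L2_set_def sum_nonneg power2_eq_square)
  have A0: "A \<ge> 0" by (simp add: A_def sum_nonneg)
  have "A = (\<Sum>i\<in>I. \<Sum>x\<in>S'. g i x * (\<Sum>m\<in>T. K i m * f (x - m)))"
    unfolding A_def n2 by (simp add: g_def)
  also have "\<dots> = (\<Sum>i\<in>I. \<Sum>m\<in>T. K i m * (\<Sum>x\<in>S'. g i x * f (x - m)))"
    unfolding sum_distrib_left by (rule sum.cong[OF refl], subst sum.swap) (simp add: mult_ac)
  also have "\<dots> = (\<Sum>i\<in>I. \<Sum>m\<in>T. K i m * (\<Sum>y\<in>S. f y * g i (y + m)))"
    by (intro sum.cong refl arg_cong2[of _ _ _ _ "(*)"] sum_mult_shift_swap) (use fin S'(1) g0 in auto)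
  also have "\<dots> = (\<Sum>i\<in>I. \<Sum>y\<in>S. \<Sum>m\<in>T. f y * (K i m * g i (y + m)))"
    unfolding sum_distrib_left by (rule sum.cong[OF refl], subst sum.swap) (simp add: mult_ac)
  also have "\<dots> = (\<Sum>y\<in>S. f y * u y)"
    unfolding u_def sum_distrib_left by (rule sum.swap)
  also have "\<dots> \<le> (\<Sum>y\<in>S. \<bar>f y\<bar> * \<bar>u y\<bar>)" by (intro sum_mono) (simp add: abs_mult[symmetric])
  also have "\<dots> \<le> L2_set f S * L2_set u S" by (rule L2_set_mult_ineq)
  finally have A1: "A \<le> L2_set f S * L2_set u S" .
  define Y where "Y = S \<union> (\<Union>m\<in>T. (\<lambda>x. x - m) ` S')"
  have Y: "finite Y" "S \<subseteq> Y" using fin S' by (auto simp: Y_def)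
  have corr_shift: "(\<Sum>y\<in>Y. g i (y + m) * g j (y + m')) = (\<Sum>z\<in>S'. g i z * g j (z + (m' - m)))"
    if "i \<in> I" "m \<in> T" for i j m m'
  proof -
    have "(\<Sum>y\<in>Y. g i (y + m) * g j (y + m')) = (\<Sum>y\<in>(\<lambda>x. x - m) ` S'. g i (y + m) * g j (y + m'))"
    proof (rule sum.mono_neutral_right)
      show "\<forall>y\<in>Y - (\<lambda>x. x - m) ` S'. g i (y + m) * g j (y + m') = 0"
      proof
        fix y assume "y \<in> Y - (\<lambda>x. x - m) ` S'"
        then have "y + m \<notin> S'" by (auto simp: image_iff)
        then show "g i (y + m) * g j (y + m') = 0" using g0[OF that(1)] by simp
      qed
    qed (use Y that in \<open>auto simp: Y_def\<close>)
    also have "\<dots> = (\<Sum>z\<in>S'. g i z * g j (z + (m' - m)))"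
      by (simp add: sum.reindex inj_on_def algebra_simps)
    finally show ?thesis .
  qed
  have bound: "\<bar>\<Sum>z\<in>S'. g i z * g j (z + h)\<bar> \<le> n i * n j" if "j \<in> I" for i j h
  proof -
    have "\<bar>\<Sum>z\<in>S'. g i z * g j (z + h)\<bar> \<le> (\<Sum>z\<in>S'. \<bar>g i z\<bar> * \<bar>g j (z + h)\<bar>)"
      by (rule order_trans[OF sum_abs]) (simp add: abs_mult)
    also have "\<dots> \<le> L2_set (g i) S' * L2_set (\<lambda>z. g j (z + h)) S'" by (rule L2_set_mult_ineq)
    also have "L2_set (\<lambda>z. g j (z + h)) S' \<le> n j"
      using l2_boundedD[OF l2_bounded_shift[OF l2_bounded_finite_support[of S' "g j"], of "-h"] S'(1)]
        S'(1) g0[OF that] by (simp add: n_def)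
    finally show ?thesis by (simp add: n_def mult_left_mono)
  qed
  have "(L2_set u S)\<^sup>2 = (\<Sum>y\<in>S. (u y)\<^sup>2)" by (simp add: L2_set_def sum_nonneg)
  also have "\<dots> \<le> (\<Sum>y\<in>Y. (u y)\<^sup>2)" using Y by (intro sum_mono2) auto
  also have "\<dots> = (\<Sum>y\<in>Y. \<Sum>i\<in>I. \<Sum>j\<in>I. \<Sum>m\<in>T. \<Sum>m'\<in>T. (K i m * K j m') * (g i (y + m) * g j (y + m')))"
    unfolding u_def power2_eq_square sum_product by (intro sum.cong refl) (simp add: mult_ac)
  also have "\<dots> = (\<Sum>i\<in>I. \<Sum>j\<in>I. \<Sum>m\<in>T. \<Sum>m'\<in>T. \<Sum>y\<in>Y. (K i m * K j m') * (g i (y + m) * g j (y + m')))"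
    by (subst sum.swap, rule sum.cong[OF refl], subst sum.swap, rule sum.cong[OF refl],
        subst sum.swap, rule sum.cong[OF refl], rule sum.swap)
  also have "\<dots> = (\<Sum>i\<in>I. \<Sum>j\<in>I. \<Sum>m\<in>T. \<Sum>m'\<in>T. (K i m * K j m') * (\<Sum>z\<in>S'. g i z * g j (z + (m' - m))))"
    unfolding sum_distrib_left[symmetric] by (intro sum.cong refl) (simp add: corr_shift)
  also have "\<dots> \<le> (\<Sum>i\<in>I. \<Sum>j\<in>I. e i j * (n i * n j))"
  proof (intro sum_mono)
    fix i j assume ij: "i \<in> I" "j \<in> I"
    define c where "c h = (\<Sum>z\<in>S'. g i z * g j (z + h))" for h
    define H where "H = differences T"
    have "(\<Sum>m\<in>T. \<Sum>m'\<in>T. (K i m * K j m') * c (m' - m))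
       = (\<Sum>(m, m')\<in>T \<times> T. (K i m * K j m') * c (m' - m))"
      by (rule sum.cartesian_product)
    also have "\<dots> = (\<Sum>h\<in>H. \<Sum>p\<in>{p\<in>T \<times> T. (case p of (m, m') \<Rightarrow> m' - m) = h}.
        (case p of (m, m') \<Rightarrow> (K i m * K j m') * c (m' - m)))"
      unfolding H_def differences_def by (rule sum.image_gen) (use fin in auto)
    also have "\<dots> = (\<Sum>h\<in>H. correlation T (K i) (K j) h * c h)"
    proof (rule sum.cong[OF refl])
      fix h
      show "(\<Sum>p\<in>{p\<in>T \<times> T. (case p of (m, m') \<Rightarrow> m' - m) = h}.
          (case p of (m, m') \<Rightarrow> (K i m * K j m') * c (m' - m)))
        = correlation T (K i) (K j) h * c h"
        unfolding correlation_def sum_distrib_right by (rule sum.cong) auto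
    qed
    also have "\<dots> \<le> (\<Sum>h\<in>H. \<bar>correlation T (K i) (K j) h\<bar> * (n i * n j))"
    proof (rule sum_mono)
      fix h
      let ?k = "correlation T (K i) (K j) h"
      have "?k * c h \<le> \<bar>?k\<bar> * \<bar>c h\<bar>"
        unfolding abs_mult[symmetric] by (rule abs_ge_self)
      also have "\<dots> \<le> \<bar>?k\<bar> * (n i * n j)" using bound[OF ij(2)] by (intro mult_left_mono) (auto simp: c_def)
      finally show "?k * c h \<le> \<bar>?k\<bar> * (n i * n j)" .
    qed
    also have "\<dots> \<le> e i j * (n i * n j)"
      unfolding sum_distrib_right[symmetric] H_def
      by (intro mult_right_mono corr ij) (simp add: n_def)
    finally show "(\<Sum>m\<in>T. \<Sum>m'\<in>T. (K i m * K j m') * (\<Sum>z\<in>S'. g i z * g j (z + (m' - m)))) \<le> e i j * (n i * n j)"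
      by (simp add: c_def)
  qed
  also have "\<dots> \<le> (\<Sum>i\<in>I. \<Sum>j\<in>I. e i j * ((n i)\<^sup>2 / 2 + (n j)\<^sup>2 / 2))"
  proof (intro sum_mono mult_left_mono)
    fix i j assume "i \<in> I" "j \<in> I"
    show "n i * n j \<le> (n i)\<^sup>2 / 2 + (n j)\<^sup>2 / 2"
      using sum_squares_bound[of "n i" "n j"] by simp
    show "e i j \<ge> 0" by (rule order_trans[OF _ corr[OF \<open>i \<in> I\<close> \<open>j \<in> I\<close>]]) (simp add: sum_nonneg)
  qed
  also have "\<dots> = (\<Sum>i\<in>I. (\<Sum>j\<in>I. e i j) * ((n i)\<^sup>2 / 2)) + (\<Sum>j\<in>I. (\<Sum>i\<in>I. e i j) * ((n j)\<^sup>2 / 2))"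
    unfolding distrib_left sum.distrib sum_distrib_right
    by (intro arg_cong2[of _ _ _ _ "(+)"] refl sum.swap)
  also have "\<dots> \<le> (\<Sum>i\<in>I. \<kappa> * ((n i)\<^sup>2 / 2)) + (\<Sum>j\<in>I. \<kappa> * ((n j)\<^sup>2 / 2))"
    by (intro add_mono sum_mono mult_right_mono row col) auto
  also have "\<dots> = \<kappa> * A" by (simp add: A_def sum_distrib_left flip: sum.distrib)
  finally have u2: "(L2_set u S)\<^sup>2 \<le> \<kappa> * A" .
  have "A\<^sup>2 \<le> (L2_set f S * L2_set u S)\<^sup>2" using A0 A1 by (intro power_mono)
  also have "\<dots> = (L2_set f S)\<^sup>2 * (L2_set u S)\<^sup>2" by (simp add: power_mult_distrib)
  also have "\<dots> \<le> (L2_set f S)\<^sup>2 * (\<kappa> * A)" by (intro mult_left_mono u2) simp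
  finally have "A * A \<le> (\<kappa> * (L2_set f S)\<^sup>2) * A" by (simp add: power2_eq_square mult_ac)
  moreover have "\<kappa> * (L2_set f S)\<^sup>2 \<ge> 0" using \<open>\<kappa> \<ge> 0\<close> by simp
  ultimately have "A \<le> \<kappa> * (L2_set f S)\<^sup>2"
    using A0 by (cases "A = 0") auto
  moreover have "g i = (\<lambda>x. \<Sum>m\<in>T. K i m * f (x - m))" for i
    by (simp add: fun_eq_iff g_def)
  ultimately show ?thesis by (simp add: A_def n_def)
qed

section \<open>Ramanujan sums\<close>

text \<open>
  The Ramanujan sum \<open>c_p(n)\<close> of a prime \<open>p\<close>.
\<close>

definition rho :: "nat \<Rightarrow> int \<Rightarrow> real" where
  "rho p n = (if int p dvd n then real p - 1 else - 1)"

text \<open>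
  The Ramanujan sum \<open>c_q(n)\<close> of a squarefree \<open>q\<close>. Squarefree numbers are represented throughout by
  their sets \<open>D\<close> of prime factors, so that \<open>q = \<Prod>D\<close>.
\<close>

definition ramanujan :: "nat set \<Rightarrow> int \<Rightarrow> real" where
  "ramanujan D n = (\<Prod>p\<in>D. rho p n)"

definition prime_set :: "nat set \<Rightarrow> bool" where
  "prime_set D \<longleftrightarrow> finite D \<and> (\<forall>p\<in>D. prime p)"

lemma prime_set_subset: "prime_set D \<Longrightarrow> A \<subseteq> D \<Longrightarrow> prime_set A"
  by (auto simp: prime_set_def intro: finite_subset)

lemma prime_set_Un: "prime_set A \<Longrightarrow> prime_set B \<Longrightarrow> prime_set (A \<union> B)"
  by (auto simp: prime_set_def)

lemma prod_prime_set_pos: "prime_set D \<Longrightarrow> \<Prod>D > 0"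
  by (auto simp: prime_set_def prime_gt_0_nat intro!: prod_pos)

lemma prime_dvd_prod_prime_set_iff:
  assumes "prime_set D" "prime p"
  shows "p dvd \<Prod>D \<longleftrightarrow> p \<in> D"
  using assms
  by (auto simp: prime_set_def prime_dvd_prod_iff dest: primes_dvd_imp_eq intro!: bexI[of _ p])

lemma coprime_prod_prime_set:
  assumes "prime_set (insert p D)" "p \<notin> D"
  shows "coprime p (\<Prod>D)"
proof -
  have "prime p" "prime_set D" using assms by (auto simp: prime_set_def)
  then have "\<not> p dvd \<Prod>D" using assms(2) prime_dvd_prod_prime_set_iff by blast
  with \<open>prime p\<close> show ?thesis by (simp add: prime_imp_coprime)
qed

lemma prod_prime_set_dvd_iff:
  fixes n :: int
  assumes "prime_set D"
  shows "int (\<Prod>D) dvd n \<longleftrightarrow> (\<forall>p\<in>D. int p dvd n)"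
proof -
  have "finite D" using assms by (simp add: prime_set_def)
  then show ?thesis using assms
  proof (induction D rule: finite_induct)
    case (insert p D)
    have "prime_set D" using insert.prems by (auto simp: prime_set_def)
    have "coprime (int p) (int (\<Prod>D))"
      using coprime_prod_prime_set[OF insert.prems insert.hyps(2)] by (simp del: of_nat_prod)
    then have "int (p * \<Prod>D) dvd n \<longleftrightarrow> int p dvd n \<and> int (\<Prod>D) dvd n"
      by (metis divides_mult dvd_mult_left dvd_mult_right of_nat_mult)
    with insert \<open>prime_set D\<close> show ?case by simp
  qed simp
qed

lemma inj_on_prod_prime_set:
  assumes "\<And>D. D \<in> I \<Longrightarrow> prime_set D"
  shows "inj_on (\<lambda>D. \<Prod>D) I"
proof (rule inj_onI)
  fix D E assume DE: "D \<in> I" "E \<in> I" "\<Prod>D = \<Prod>E"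
  then have "prime_set D" "prime_set E" using assms by auto
  then show "D = E" using DE(3)
    by (metis prime_dvd_prod_prime_set_iff prime_set_def subsetI subset_antisym)
qed

lemma periodic_int:
  fixes u :: "int \<Rightarrow> real"
  assumes "\<And>m. u (m + q) = u m"
  shows "u (m + k * q) = u m"
proof (induction k rule: int_induct[where k = 0])
  case (step1 i)
  then show ?case using assms[of "m + i * q"] by (simp add: algebra_simps)
next
  case (step2 i)
  then show ?case using assms[of "m + (i - 1) * q"] by (simp add: algebra_simps)
qed simp

lemma periodic_mod:
  fixes u :: "int \<Rightarrow> real"
  assumes "\<And>m. u (m + q) = u m"
  shows "u (m mod q) = u m"
  using periodic_int[of u q "m mod q" "m div q", OF assms] by (simp add: algebra_simps)

lemma sum_periodic_mult:
  fixes u v :: "int \<Rightarrow> real"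
  assumes "a > 0" "b > 0" "coprime a b"
    and "\<And>m. u (m + a) = u m" "\<And>m. v (m + b) = v m"
  shows "(\<Sum>m\<in>{0..<a * b}. u m * v m) = (\<Sum>m\<in>{0..<a}. u m) * (\<Sum>m\<in>{0..<b}. v m)"
proof -
  define \<phi> where "\<phi> m = (m mod a, m mod b)" for m
  have inj: "inj_on \<phi> {0..<a * b}"
  proof (rule inj_onI)
    fix x y assume xy: "x \<in> {0..<a * b}" "y \<in> {0..<a * b}" "\<phi> x = \<phi> y"
    then have "[x = y] (mod a)" "[x = y] (mod b)" by (auto simp: \<phi>_def cong_def)
    then have "[x = y] (mod (a * b))" using assms(3) by (rule coprime_cong_mult)
    then show "x = y" using xy by (simp add: cong_def)
  qed
  have "\<phi> ` {0..<a * b} = {0..<a} \<times> {0..<b}"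
  proof (rule card_subset_eq)
    show "\<phi> ` {0..<a * b} \<subseteq> {0..<a} \<times> {0..<b}" using assms by (auto simp: \<phi>_def)
    show "card (\<phi> ` {0..<a * b}) = card ({0..<a} \<times> {0..<b})"
      using inj assms by (simp add: card_image card_cartesian_product nat_mult_distrib)
  qed auto
  then have bij: "bij_betw \<phi> {0..<a * b} ({0..<a} \<times> {0..<b})" using inj by (simp add: bij_betw_def)
  have "(\<Sum>m\<in>{0..<a * b}. u m * v m) = (\<Sum>m\<in>{0..<a * b}. (\<lambda>(x, y). u x * v y) (\<phi> m))"
    using periodic_mod[of u a, OF assms(4)] periodic_mod[of v b, OF assms(5)] by (simp add: \<phi>_def)
  also have "\<dots> = (\<Sum>(x, y)\<in>{0..<a} \<times> {0..<b}. u x * v y)"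
    by (rule sum.reindex_bij_betw[OF bij])
  also have "\<dots> = (\<Sum>m\<in>{0..<a}. u m) * (\<Sum>m\<in>{0..<b}. v m)"
    by (simp add: sum_product sum.cartesian_product)
  finally show ?thesis .
qed

text \<open>
  The Chinese remainder theorem. All exact identities for Ramanujan sums below reduce through it to
  the case of a single prime.
\<close>

lemma sum_prod_periodic:
  fixes u :: "nat \<Rightarrow> int \<Rightarrow> real"
  assumes "prime_set D" "\<And>p m. p \<in> D \<Longrightarrow> u p (m + int p) = u p m"
  shows "(\<Sum>m\<in>{0..<int (\<Prod>D)}. \<Prod>p\<in>D. u p m) = (\<Prod>p\<in>D. \<Sum>m\<in>{0..<int p}. u p m)"
proof -
  have "finite D" using assms by (simp add: prime_set_def)
  then show ?thesis using assms
  proof (induction D rule: finite_induct)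
    case empty
    then show ?case by simp
  next
    case (insert p D)
    have D: "prime_set D" "prime p" using insert.prems by (auto simp: prime_set_def)
    have per: "(\<Prod>p\<in>D. u p (m + int (\<Prod>D))) = (\<Prod>p\<in>D. u p m)" for m
    proof (rule prod.cong[OF refl])
      fix r assume r: "r \<in> D"
      then obtain k where k: "\<Prod>D = r * k"
        using insert.hyps(1) by (meson dvd_prodI dvdE)
      show "u r (m + int (\<Prod>D)) = u r m"
        using periodic_int[of "u r" "int r" m "int k"] insert.prems(2) r k
        by (simp add: mult.commute)
    qed
    have "(\<Sum>m\<in>{0..<int (\<Prod>(insert p D))}. \<Prod>p\<in>insert p D. u p m)
        = (\<Sum>m\<in>{0..<int p * int (\<Prod>D)}. u p m * (\<Prod>p\<in>D. u p m))"
      using insert.hyps by simp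
    also have "\<dots> = (\<Sum>m\<in>{0..<int p}. u p m) * (\<Sum>m\<in>{0..<int (\<Prod>D)}. \<Prod>p\<in>D. u p m)"
      using coprime_prod_prime_set[OF insert.prems(1) insert.hyps(2)] prod_prime_set_pos[OF D(1)]
        prime_gt_0_nat[OF D(2)] insert.prems(2) per
      by (intro sum_periodic_mult) (auto simp del: of_nat_prod)
    also have "\<dots> = (\<Prod>p\<in>insert p D. \<Sum>m\<in>{0..<int p}. u p m)"
      using insert D by simp
    finally show ?case .
  qed
qed

lemma sum_periodic_window:
  fixes g :: "int \<Rightarrow> real"
  assumes "q > 0" "\<And>m. g (m + q) = g m"
  shows "(\<Sum>m\<in>{a..<a + q}. g m) = (\<Sum>m\<in>{0..<q}. g m)"
proof -
  have inj: "inj_on (\<lambda>m. m mod q) {a..<a + q}"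
  proof (rule inj_onI)
    fix x y assume xy: "x \<in> {a..<a + q}" "y \<in> {a..<a + q}" "x mod q = y mod q"
    then have "q dvd (x - y)" by (simp add: mod_eq_dvd_iff)
    then have "q dvd (y - x)" by (simp add: dvd_diff_commute)
    have "\<not> y < x" using zdvd_imp_le[OF \<open>q dvd (x - y)\<close>] xy by auto
    moreover have "\<not> x < y" using zdvd_imp_le[OF \<open>q dvd (y - x)\<close>] xy by auto
    ultimately show "x = y" by simp
  qed
  have "(\<lambda>m. m mod q) ` {a..<a + q} = {0..<q}"
    by (rule card_subset_eq) (use assms inj in \<open>auto simp: card_image\<close>)
  then have bij: "bij_betw (\<lambda>m. m mod q) {a..<a + q} {0..<q}" using inj by (simp add: bij_betw_def)
  have "(\<Sum>m\<in>{a..<a + q}. g m) = (\<Sum>m\<in>{a..<a + q}. g (m mod q))"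
    using periodic_mod[of g q, OF assms(2)] by simp
  also have "\<dots> = (\<Sum>m\<in>{0..<q}. g m)" by (rule sum.reindex_bij_betw[OF bij])
  finally show ?thesis .
qed

lemma sum_periodic_windows:
  fixes g :: "int \<Rightarrow> real"
  assumes "q > 0" "\<And>m. g (m + q) = g m"
  shows "(\<Sum>m\<in>{a..<a + int k * q}. g m) = real k * (\<Sum>m\<in>{0..<q}. g m)"
proof (induction k)
  case (Suc k)
  have "{a..<a + int (Suc k) * q} = {a..<a + int k * q} \<union> {a + int k * q..<(a + int k * q) + q}"
  proof -
    have B: "a + int (Suc k) * q = (a + int k * q) + q" by (simp add: algebra_simps)
    show ?thesis unfolding B using assms(1) by (intro ivl_disj_un_two(3)[symmetric]) auto
  qed
  moreover have "{a..<a + int k * q} \<inter> {a + int k * q..<(a + int k * q) + q} = {}" by auto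
  ultimately have "(\<Sum>m\<in>{a..<a + int (Suc k) * q}. g m)
     = (\<Sum>m\<in>{a..<a + int k * q}. g m) + (\<Sum>m\<in>{a + int k * q..<(a + int k * q) + q}. g m)"
    by (simp only:) (rule sum.union_disjoint, auto)
  with Suc sum_periodic_window[of q g "a + int k * q", OF assms] show ?case
    by (simp only: of_nat_Suc) (simp add: algebra_simps)
qed simp

text \<open>
  Full periods cancel, and fewer than \<open>q\<close> terms are left over.
\<close>

lemma abs_sum_periodic_interval_le:
  fixes g :: "int \<Rightarrow> real"
  assumes "q > 0" "\<And>m. g (m + q) = g m" "(\<Sum>m\<in>{0..<q}. g m) = 0" "\<And>m. \<bar>g m\<bar> \<le> B"
  shows "\<bar>\<Sum>m\<in>{a..<b}. g m\<bar> \<le> q * B"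
proof (cases "a \<le> b")
  case True
  define k where "k = nat ((b - a) div q)"
  define c where "c = a + int k * q"
  have k: "int k * q = (b - a) - (b - a) mod q"
    using True assms(1) by (simp add: k_def pos_imp_zdiv_nonneg_iff minus_mod_eq_div_mult)
  have c: "a \<le> c" "c \<le> b" "b - c < q"
    using k True pos_mod_sign[OF assms(1), of "b - a"] pos_mod_bound[OF assms(1), of "b - a"]
      zmod_le_nonneg_dividend[of "b - a" q] unfolding c_def by linarith+
  have "{a..<b} = {a..<c} \<union> {c..<b}" "{a..<c} \<inter> {c..<b} = {}" using c by auto
  then have "(\<Sum>m\<in>{a..<b}. g m) = (\<Sum>m\<in>{a..<c}. g m) + (\<Sum>m\<in>{c..<b}. g m)"
    by (simp only:) (rule sum.union_disjoint, auto)
  also have "(\<Sum>m\<in>{a..<c}. g m) = 0"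
    unfolding c_def using sum_periodic_windows[of q g a k, OF assms(1,2)] assms(3) by simp
  finally have "\<bar>\<Sum>m\<in>{a..<b}. g m\<bar> \<le> (\<Sum>m\<in>{c..<b}. \<bar>g m\<bar>)" by (simp add: sum_abs)
  also have "\<dots> \<le> (\<Sum>m\<in>{c..<b}. B)" by (intro sum_mono assms(4))
  also have "\<dots> = real_of_int (b - c) * B" using c by simp
  also have "\<dots> \<le> q * B" using c assms(4)[of 0] by (intro mult_right_mono) linarith+
  finally show ?thesis .
next
  case False
  have "B \<ge> 0" using assms(4)[of 0] by linarith
  with False assms(1) show ?thesis by simp
qed

lemma rho_periodic: "rho p (m + int p) = rho p m"
  by (simp add: rho_def)

lemma rho_reflect: "rho p (s - (m + int p)) = rho p (s - m)"
  using rho_periodic[of p "s - (m + int p)"] by simp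

lemma ramanujan_periodic:
  assumes "finite D" "int (\<Prod>D) dvd q"
  shows "ramanujan D (m + q) = ramanujan D m"
  unfolding ramanujan_def
proof (rule prod.cong[OF refl])
  fix p assume "p \<in> D"
  then have "int p dvd int (\<Prod>D)" using assms(1) by (meson dvd_prodI int_dvd_int_iff)
  then have "int p dvd q" using assms(2) by (rule dvd_trans)
  then show "rho p (m + q) = rho p m" by (simp add: rho_def dvd_add_left_iff)
qed

lemma abs_ramanujan_le:
  assumes "prime_set D"
  shows "\<bar>ramanujan D n\<bar> \<le> real (\<Prod>D)"
proof -
  have "\<bar>ramanujan D n\<bar> = (\<Prod>p\<in>D. \<bar>rho p n\<bar>)" by (simp add: ramanujan_def abs_prod)
  also have "\<dots> \<le> (\<Prod>p\<in>D. real p)"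
  proof (rule prod_mono)
    fix p assume "p \<in> D"
    then have "p \<ge> 1" using assms prime_ge_1_nat by (auto simp: prime_set_def)
    then show "0 \<le> \<bar>rho p n\<bar> \<and> \<bar>rho p n\<bar> \<le> real p" by (auto simp: rho_def)
  qed
  finally show ?thesis by simp
qed

lemma dvd_window_iff:
  "p > 0 \<Longrightarrow> m \<in> {0..<int p} \<Longrightarrow> int p dvd m \<longleftrightarrow> m = 0"
  "p > 0 \<Longrightarrow> m \<in> {0..<int p} \<Longrightarrow> int p dvd s - m \<longleftrightarrow> m = s mod int p"
proof -
  assume m: "p > 0" "m \<in> {0..<int p}"
  then have mm: "m mod int p = m" by simp
  then show "int p dvd m \<longleftrightarrow> m = 0" by (simp add: dvd_eq_mod_eq_0)
  show "int p dvd s - m \<longleftrightarrow> m = s mod int p"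
    unfolding mod_eq_dvd_iff[symmetric] mm by (rule eq_commute)
qed

lemma sum_rho:
  assumes "p > 0"
  shows "(\<Sum>m\<in>{0..<int p}. rho p m) = 0"
proof -
  have "(\<Sum>m\<in>{0..<int p}. rho p m) = (\<Sum>m\<in>{0..<int p}. (if m = 0 then real p else 0) - 1)"
    by (rule sum.cong) (use dvd_window_iff(1)[OF assms] in \<open>auto simp: rho_def\<close>)
  also have "\<dots> = 0" using assms by (simp add: sum_subtractf)
  finally show ?thesis .
qed

lemma sum_rho_shift:
  assumes "p > 0"
  shows "(\<Sum>m\<in>{0..<int p}. rho p (m + h)) = 0"
proof -
  have "(\<Sum>m\<in>{0..<int p}. rho p (m + h)) = (\<Sum>m\<in>{h..<h + int p}. rho p m)"
    by (rule sum.reindex_bij_witness[of _ "\<lambda>m. m - h" "\<lambda>m. m + h"]) auto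
  also have "\<dots> = 0" using sum_periodic_window[of "int p" "rho p" h] rho_periodic sum_rho[OF assms] assms
    by simp
  finally show ?thesis .
qed

lemma sum_abs_rho_le:
  assumes "p > 0"
  shows "(\<Sum>m\<in>{0..<int p}. \<bar>rho p m\<bar>) \<le> 2 * real p"
proof -
  have "(\<Sum>m\<in>{0..<int p}. \<bar>rho p m\<bar>) \<le> (\<Sum>m\<in>{0..<int p}. (if m = 0 then real p else 0) + 1)"
    by (rule sum_mono) (use dvd_window_iff(1)[OF assms] assms in \<open>auto simp: rho_def\<close>)
  also have "\<dots> = 2 * real p" using assms by (simp add: sum.distrib)
  finally show ?thesis .
qed

lemma rho_convolution:
  assumes "p > 0"
  shows "(\<Sum>m\<in>{0..<int p}. rho p (s - m) * rho p m) = real p * rho p s"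
proof -
  have "(\<Sum>m\<in>{0..<int p}. rho p (s - m) * rho p m)
     = (\<Sum>m\<in>{0..<int p}. (if m = 0 then (if int p dvd s then real p * real p else 0) else 0)
         - (if m = 0 then real p else 0) - (if m = s mod int p then real p else 0) + 1)"
  proof (rule sum.cong[OF refl])
    fix m assume m: "m \<in> {0..<int p}"
    have "s mod int p = 0 \<longleftrightarrow> int p dvd s" by (simp add: dvd_eq_mod_eq_0)
    then show "rho p (s - m) * rho p m = (if m = 0 then (if int p dvd s then real p * real p else 0) else 0)
         - (if m = 0 then real p else 0) - (if m = s mod int p then real p else 0) + 1"
      using dvd_window_iff[OF assms m] by (auto simp: rho_def algebra_simps)
  qed
  also have "\<dots> = (if int p dvd s then real p * real p else 0) - real p - real p + real p"
    using assms by (simp add: sum.distrib sum_subtractf)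
  also have "\<dots> = real p * rho p s" by (simp add: rho_def algebra_simps)
  finally show ?thesis .
qed

lemma sum_abs_ramanujan_le:
  assumes "prime_set D"
  shows "(\<Sum>m\<in>{0..<int (\<Prod>D)}. \<bar>ramanujan D m\<bar>) \<le> 2 ^ card D * real (\<Prod>D)"
proof -
  have "(\<Sum>m\<in>{0..<int (\<Prod>D)}. \<bar>ramanujan D m\<bar>) = (\<Sum>m\<in>{0..<int (\<Prod>D)}. \<Prod>p\<in>D. \<bar>rho p m\<bar>)"
    by (simp add: ramanujan_def abs_prod)
  also have "\<dots> = (\<Prod>p\<in>D. \<Sum>m\<in>{0..<int p}. \<bar>rho p m\<bar>)"
    by (rule sum_prod_periodic[OF assms]) (simp add: rho_periodic)
  also have "\<dots> \<le> (\<Prod>p\<in>D. 2 * real p)"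
    using assms by (intro prod_mono conjI sum_nonneg sum_abs_rho_le) (auto simp: prime_set_def prime_gt_0_nat)
  also have "\<dots> = 2 ^ card D * real (\<Prod>D)" by (simp add: prod.distrib)
  finally show ?thesis .
qed

text \<open>
  Over a full period, \<open>c_q / q\<close> acts under convolution as a projection.
\<close>

lemma ramanujan_convolution:
  assumes "prime_set D"
  shows "(\<Sum>m\<in>{0..<int (\<Prod>D)}. ramanujan D (s - m) * ramanujan D m) = real (\<Prod>D) * ramanujan D s"
proof -
  have "(\<Sum>m\<in>{0..<int (\<Prod>D)}. ramanujan D (s - m) * ramanujan D m)
     = (\<Sum>m\<in>{0..<int (\<Prod>D)}. \<Prod>p\<in>D. rho p (s - m) * rho p m)"
    by (simp add: ramanujan_def prod.distrib)
  also have "\<dots> = (\<Prod>p\<in>D. \<Sum>m\<in>{0..<int p}. rho p (s - m) * rho p m)"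
    by (rule sum_prod_periodic[OF assms]) (simp add: rho_periodic rho_reflect)
  also have "\<dots> = (\<Prod>p\<in>D. real p * rho p s)"
    using assms by (intro prod.cong refl rho_convolution) (auto simp: prime_set_def prime_gt_0_nat)
  finally show ?thesis by (simp add: ramanujan_def prod.distrib)
qed

text \<open>
  A prime in exactly one of \<open>D\<close> and \<open>E\<close> contributes the factor \<open>sum_rho\<close>, which vanishes.
\<close>

lemma ramanujan_orthogonal:
  assumes "prime_set D" "prime_set E" "D \<noteq> E"
  shows "(\<Sum>m\<in>{0..<int (\<Prod>(D \<union> E))}. ramanujan D m * ramanujan E (m + h)) = 0"
proof -
  have DE: "prime_set (D \<union> E)" using assms by (intro prime_set_Un)
  then have fin: "finite (D \<union> E)" by (simp add: prime_set_def)
  define u where "u p m = (if p \<in> D then rho p m else 1) * (if p \<in> E then rho p (m + h) else 1)" for p m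
  have "ramanujan D m * ramanujan E (m + h) = (\<Prod>p\<in>D \<union> E. u p m)" for m
  proof -
    have "(\<Prod>p\<in>D \<union> E. if p \<in> D then rho p m else 1) = ramanujan D m"
      unfolding ramanujan_def using fin by (intro prod.mono_neutral_cong_right) auto
    moreover have "(\<Prod>p\<in>D \<union> E. if p \<in> E then rho p (m + h) else 1) = ramanujan E (m + h)"
      unfolding ramanujan_def using fin by (intro prod.mono_neutral_cong_right) auto
    ultimately show ?thesis by (simp add: u_def prod.distrib)
  qed
  then have "(\<Sum>m\<in>{0..<int (\<Prod>(D \<union> E))}. ramanujan D m * ramanujan E (m + h))
      = (\<Sum>m\<in>{0..<int (\<Prod>(D \<union> E))}. \<Prod>p\<in>D \<union> E. u p m)" by simp
  also have "\<dots> = (\<Prod>p\<in>D \<union> E. \<Sum>m\<in>{0..<int p}. u p m)"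
  proof (rule sum_prod_periodic[OF DE])
    fix p m
    have "rho p (m + int p + h) = rho p (m + h)"
      using rho_periodic[of p "m + h"] by (simp add: algebra_simps)
    then show "u p (m + int p) = u p m" by (simp add: u_def rho_periodic)
  qed
  also have "\<dots> = 0"
  proof -
    obtain p where p: "p \<in> D \<union> E" "p \<in> D \<longleftrightarrow> p \<notin> E" using assms(3) by blast
    then have "p > 0" using DE by (auto simp: prime_set_def prime_gt_0_nat)
    then have "(\<Sum>m\<in>{0..<int p}. u p m) = 0"
      using p sum_rho[of p] sum_rho_shift[of p h] by (cases "p \<in> D") (auto simp: u_def)
    then show ?thesis using p(1) fin by (auto simp: prod_zero_iff)
  qed
  finally show ?thesis .
qed

text \<open>
  The expansion \<open>c_q(n) = \<Sum> \<mu>(q/d) d\<close> over the common divisors \<open>d\<close> of \<open>q\<close> and \<open>n\<close>, for squarefree \<open>q\<close>.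
\<close>

lemma ramanujan_eq_sum_divisors:
  assumes "prime_set D"
  shows "ramanujan D n = (\<Sum>A\<in>Pow D. (-1) ^ card (D - A) * (if int (\<Prod>A) dvd n then real (\<Prod>A) else 0))"
proof -
  have fin: "finite D" using assms by (simp add: prime_set_def)
  have "ramanujan D n = (\<Prod>p\<in>D. (if int p dvd n then real p else 0) + (- 1))"
    unfolding ramanujan_def by (rule prod.cong) (auto simp: rho_def)
  also have "\<dots> = (\<Sum>A\<in>Pow D. (\<Prod>p\<in>A. if int p dvd n then real p else 0) * (\<Prod>p\<in>D - A. - 1))"
    by (rule prod_add[OF fin])
  also have "\<dots> = (\<Sum>A\<in>Pow D. (-1) ^ card (D - A) * (if int (\<Prod>A) dvd n then real (\<Prod>A) else 0))"
  proof (rule sum.cong[OF refl])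
    fix A assume "A \<in> Pow D"
    then have A: "prime_set A" "finite A" using assms fin by (auto intro: prime_set_subset finite_subset)
    have "(\<Prod>p\<in>A. if int p dvd n then real p else 0) = (if int (\<Prod>A) dvd n then real (\<Prod>A) else 0)"
    proof (cases "int (\<Prod>A) dvd n")
      case True
      then have "(\<Prod>p\<in>A. if int p dvd n then real p else 0) = (\<Prod>p\<in>A. real p)"
        using prod_prime_set_dvd_iff[OF A(1)] by (intro prod.cong) auto
      with True show ?thesis by (simp only: if_True of_nat_prod)
    next
      case False
      then obtain p where "p \<in> A" "\<not> int p dvd n" using prod_prime_set_dvd_iff[OF A(1)] by blast
      then show ?thesis using False A(2) by (auto simp: prod_zero_iff)
    qed
    then show "(\<Prod>p\<in>A. if int p dvd n then real p else 0) * (\<Prod>p\<in>D - A. - 1)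
      = (-1) ^ card (D - A) * (if int (\<Prod>A) dvd n then real (\<Prod>A) else 0)" by simp
  qed
  finally show ?thesis .
qed

section \<open>Averages against Ramanujan sums\<close>

definition ram_avg :: "nat set \<Rightarrow> nat \<Rightarrow> (int \<Rightarrow> real) \<Rightarrow> int \<Rightarrow> real" where
  "ram_avg D N f x = (\<Sum>n\<in>{1..int N}. ramanujan D n * f (x - n)) / real N"

definition ram_max :: "nat set \<Rightarrow> nat set \<Rightarrow> (int \<Rightarrow> real) \<Rightarrow> int \<Rightarrow> real" where
  "ram_max D K f x = Max (insert 0 ((\<lambda>k. \<bar>ram_avg D (2 ^ k) f x\<bar>) ` K))"

text \<open>
  If \<open>L\<close> is a multiple of \<open>q = \<Prod>D\<close> much larger than \<open>q\<close>, this is up to boundary effects the projection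
  onto frequencies near the reduced fractions with denominator \<open>q\<close>.
\<close>

definition ram_proj :: "nat set \<Rightarrow> int \<Rightarrow> (int \<Rightarrow> real) \<Rightarrow> int \<Rightarrow> real" where
  "ram_proj D L f x = (\<Sum>m\<in>{0..<L}. ramanujan D m * f (x - m)) / real_of_int L"

lemma ram_max_nonneg: "finite K \<Longrightarrow> ram_max D K f x \<ge> 0"
  by (simp add: ram_max_def)

lemma ram_avg_le_ram_max: "finite K \<Longrightarrow> k \<in> K \<Longrightarrow> \<bar>ram_avg D (2 ^ k) f x\<bar> \<le> ram_max D K f x"
  by (simp add: ram_max_def)

lemma ram_max_le:
  "finite K \<Longrightarrow> b \<ge> 0 \<Longrightarrow> (\<And>k. k \<in> K \<Longrightarrow> \<bar>ram_avg D (2 ^ k) f x\<bar> \<le> b) \<Longrightarrow> ram_max D K f x \<le> b"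
  by (simp add: ram_max_def)

text \<open>
  By \<open>ramanujan_eq_sum_divisors\<close> an average against \<open>c_q\<close> is a signed sum, over the divisors \<open>d\<close> of \<open>q\<close>,
  of averages along the multiples of \<open>d\<close>, and each of these has a maximal function bounded
  uniformly in \<open>d\<close>.
\<close>

lemma l2_bounded_ram_max:
  assumes D: "prime_set D" and f: "l2_bounded f B" and K: "finite K"
  shows "l2_bounded (ram_max D K f) (2 ^ card D * (8 * B))"
proof -
  have finD: "finite D" using D by (simp add: prime_set_def)
  define M where "M = (\<Sum>k\<in>K. 2 ^ k :: nat)"
  define avg where "avg A N x = (\<Sum>j=1..N. \<bar>f (x - int (\<Prod>A) * int j)\<bar>) / real N" for A N x
  define m where "m A x = Max (insert 0 ((\<lambda>N. avg A N x) ` {1..M}))" for A x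
  have m0: "m A x \<ge> 0" for A x by (simp add: m_def)
  have mge: "avg A N x \<le> m A x" if "N \<in> {1..M}" for A N x
    unfolding m_def using that by (intro Max_ge) auto
  have "l2_bounded (m A) (8 * B)" if A: "A \<subseteq> D" for A
  proof (rule l2_bounded_one_sided_maximal[of "int (\<Prod>A)" "\<lambda>x. \<bar>f x\<bar>"])
    show "int (\<Prod>A) > 0" using prod_prime_set_pos[OF prime_set_subset[OF D A]]
      by (simp del: of_nat_prod)
    show "l2_bounded (\<lambda>x. \<bar>f x\<bar>) B" by (rule l2_bounded_mono[OF f]) simp
    fix x assume pos: "m A x > 0"
    have "m A x \<in> insert 0 ((\<lambda>N. avg A N x) ` {1..M})" unfolding m_def by (rule Max_in) auto
    then obtain N where "N \<ge> 1" "m A x = avg A N x" using pos by auto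
    then show "\<exists>N\<ge>1. m A x * real N \<le> (\<Sum>n=1..N. \<bar>f (x - int (\<Prod>A) * int n)\<bar>)"
      by (intro exI[of _ N]) (simp add: avg_def)
  qed (use m0 in auto)
  then have "l2_bounded (\<lambda>x. \<Sum>A\<in>Pow D. m A x) (\<Sum>A\<in>Pow D. 8 * B)"
    using finD by (intro l2_bounded_sum) auto
  then have bound: "l2_bounded (\<lambda>x. \<Sum>A\<in>Pow D. m A x) (2 ^ card D * (8 * B))"
    using finD by (simp add: card_Pow)
  show ?thesis
  proof (rule l2_bounded_mono[OF bound])
    fix x
    have sum0: "(\<Sum>A\<in>Pow D. m A x) \<ge> 0" using m0 by (simp add: sum_nonneg)
    have "\<bar>ram_avg D (2 ^ k) f x\<bar> \<le> (\<Sum>A\<in>Pow D. m A x)" if k: "k \<in> K" for k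
    proof -
      define N where "N = (2::nat) ^ k"
      have N: "N > 0" by (simp add: N_def)
      have NM: "N \<le> M" unfolding N_def M_def by (rule member_le_sum) (use k K in auto)
      have "\<bar>\<Sum>n\<in>{1..int N}. ramanujan D n * f (x - n)\<bar> \<le> (\<Sum>n\<in>{1..int N}. \<bar>ramanujan D n\<bar> * \<bar>f (x - n)\<bar>)"
        by (rule order_trans[OF sum_abs]) (simp add: abs_mult)
      also have "\<dots> \<le> (\<Sum>n\<in>{1..int N}. \<Sum>A\<in>Pow D. (if int (\<Prod>A) dvd n then real (\<Prod>A) * \<bar>f (x - n)\<bar> else 0))"
      proof (rule sum_mono)
        fix n
        have "\<bar>ramanujan D n\<bar> \<le> (\<Sum>A\<in>Pow D. \<bar>(-1) ^ card (D - A) * (if int (\<Prod>A) dvd n then real (\<Prod>A) else 0)\<bar>)"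
          unfolding ramanujan_eq_sum_divisors[OF D] by (rule sum_abs)
        also have "\<dots> = (\<Sum>A\<in>Pow D. (if int (\<Prod>A) dvd n then real (\<Prod>A) else 0))"
          by (intro sum.cong refl) (auto simp: abs_mult power_abs simp del: of_nat_prod)
        finally have "\<bar>ramanujan D n\<bar> * \<bar>f (x - n)\<bar>
            \<le> (\<Sum>A\<in>Pow D. (if int (\<Prod>A) dvd n then real (\<Prod>A) else 0)) * \<bar>f (x - n)\<bar>"
          by (intro mult_right_mono) auto
        also have "\<dots> = (\<Sum>A\<in>Pow D. (if int (\<Prod>A) dvd n then real (\<Prod>A) * \<bar>f (x - n)\<bar> else 0))"
          unfolding sum_distrib_right by (intro sum.cong refl) (simp del: of_nat_prod)
        finally show "\<bar>ramanujan D n\<bar> * \<bar>f (x - n)\<bar>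
            \<le> (\<Sum>A\<in>Pow D. (if int (\<Prod>A) dvd n then real (\<Prod>A) * \<bar>f (x - n)\<bar> else 0))" .
      qed
      also have "\<dots> = (\<Sum>A\<in>Pow D. \<Sum>n\<in>{1..int N}. (if int (\<Prod>A) dvd n then real (\<Prod>A) * \<bar>f (x - n)\<bar> else 0))"
        by (rule sum.swap)
      also have "\<dots> \<le> (\<Sum>A\<in>Pow D. real N * m A x)"
      proof (rule sum_mono)
        fix A assume "A \<in> Pow D"
        then have "prime_set A" using D by (auto intro: prime_set_subset)
        define q where "q = \<Prod>A"
        have q: "q > 0" using prod_prime_set_pos[OF \<open>prime_set A\<close>] by (simp add: q_def)
        define J where "J = N div q"
        have "(\<Sum>n\<in>{1..int N}. (if int q dvd n then real q * \<bar>f (x - n)\<bar> else 0))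
            = (\<Sum>n | n \<in> {1..int N} \<and> int q dvd n. real q * \<bar>f (x - n)\<bar>)"
          by (rule sum.inter_filter[symmetric]) simp
        also have "\<dots> = (\<Sum>j=1..J. real q * \<bar>f (x - int q * int j)\<bar>)"
        proof (rule sum.reindex_bij_witness[of _ "\<lambda>j. int q * int j" "\<lambda>n. nat (n div int q)"])
          fix n assume n: "n \<in> {n. n \<in> {1..int N} \<and> int q dvd n}"
          then obtain c where c: "n = int q * c" by (auto elim: dvdE)
          with n q have "c > 0" by (auto simp: zero_less_mult_iff dest: order_less_le_trans[OF zero_less_one])
          then obtain j where j: "c = int j" "j > 0" using pos_int_cases by blast
          have "int q * int j \<le> int N" using n c j by simp
          then have "q * j \<le> N" by (metis of_nat_le_iff of_nat_mult)
          then have "j \<le> J" using q by (simp add: J_def less_eq_div_iff_mult_less_eq mult.commute)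
          then show "nat (n div int q) \<in> {1..J}" using c j q by simp
          show "int q * int (nat (n div int q)) = n" using c j q by simp
          show "real q * \<bar>f (x - int q * int (nat (n div int q)))\<bar> = real q * \<bar>f (x - n)\<bar>"
            using c j q by simp
        next
          fix j assume j: "j \<in> {1..J}"
          then have "q * j \<le> N" using q by (simp add: J_def less_eq_div_iff_mult_less_eq mult.commute)
          then have "int q * int j \<le> int N" by (metis of_nat_le_iff of_nat_mult)
          moreover have "1 \<le> int q * int j" using j q
            by (metis One_nat_def Suc_leI atLeastAtMost_iff mult_pos_pos of_nat_1 of_nat_le_iff of_nat_mult less_le_trans zero_less_Suc)
          ultimately show "int q * int j \<in> {n. n \<in> {1..int N} \<and> int q dvd n}" by simp
          show "nat (int q * int j div int q) = j" using q by simp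
        qed
        also have "\<dots> \<le> real N * m A x"
        proof (cases "J = 0")
          case True
          then show ?thesis using m0[of A x] by simp
        next
          case False
          have "J \<le> M" using NM by (simp add: J_def) (meson div_le_dividend le_trans)
          then have 1: "avg A J x \<le> m A x" using False by (intro mge) auto
          have "q * J \<le> N" by (simp add: J_def)
          then have 2: "real q * real J \<le> real N" by (metis of_nat_le_iff of_nat_mult)
          have "(\<Sum>j=1..J. real q * \<bar>f (x - int q * int j)\<bar>) = (real q * real J) * avg A J x"
            using False unfolding avg_def q_def[symmetric] sum_distrib_left[symmetric] by simp
          also have "\<dots> \<le> real N * m A x"
            using 1 2 by (intro mult_mono) (auto simp: avg_def sum_nonneg)
          finally show ?thesis .
        qed
        finally show "(\<Sum>n\<in>{1..int N}. (if int (\<Prod>A) dvd n then real (\<Prod>A) * \<bar>f (x - n)\<bar> else 0)) \<le> real N * m A x"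
          by (simp only: q_def)
      qed
      finally have "\<bar>\<Sum>n\<in>{1..int N}. ramanujan D n * f (x - n)\<bar> \<le> real N * (\<Sum>A\<in>Pow D. m A x)"
        by (simp add: sum_distrib_left)
      then show ?thesis using N by (simp add: ram_avg_def N_def[symmetric] field_simps)
    qed
    then have "ram_max D K f x \<le> (\<Sum>A\<in>Pow D. m A x)" using K sum0 by (intro ram_max_le) auto
    then show "\<bar>ram_max D K f x\<bar> \<le> \<bar>\<Sum>A\<in>Pow D. m A x\<bar>"
      using ram_max_nonneg[OF K, of D f x] sum0 by simp
  qed
qed

text \<open>
  An average against \<open>c_q\<close> hardly changes if \<open>f\<close> is replaced by its projection: by
  \<open>ramanujan_convolution\<close> the two kernels agree exactly except within distance \<open>L\<close> of the ends of
  \<open>[1, N]\<close>.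
\<close>

lemma ram_avg_ram_proj_error:
  assumes D: "prime_set D" and f: "l2_bounded f B" and N: "N > 0"
    and L: "L = int k * int (\<Prod>D)" "L > 0"
  shows "l2_bounded (\<lambda>x. ram_avg D N f x - ram_avg D N (ram_proj D L f) x)
    (4 * real_of_int L * (real (\<Prod>D))\<^sup>2 / real N * B)"
proof -
  define q where "q = real (\<Prod>D)"
  define c where "c = ramanujan D"
  have finD: "finite D" using D by (simp add: prime_set_def)
  have q1: "q \<ge> 1" using prod_prime_set_pos[OF D] by (simp add: q_def Suc_le_eq del: of_nat_prod)
  have cq: "\<bar>c n\<bar> \<le> q" for n unfolding c_def q_def by (rule abs_ramanujan_le[OF D])
  (* The difference of the two kernels at the point s, times N. *)
  define E where "E s = (if s \<le> int N then c s else 0)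
     - (\<Sum>n\<in>{1..int N}. if n \<le> s \<and> s < n + L then c n * c (s - n) else 0) / real_of_int L" for s
  define T where "T = {1..<L} \<union> {int N<..<int N + L}"
  have E0: "E s = 0" if s: "L \<le> s" "s \<le> int N" for s
  proof -
    have "(\<Sum>n\<in>{1..int N}. if n \<le> s \<and> s < n + L then c n * c (s - n) else 0)
       = (\<Sum>n | n \<in> {1..int N} \<and> n \<le> s \<and> s < n + L. c n * c (s - n))"
      by (rule sum.inter_filter[symmetric]) simp
    also have "\<dots> = (\<Sum>m\<in>{0..<L}. c (s - m) * c m)"
      by (rule sum.reindex_bij_witness[of _ "\<lambda>m. s - m" "\<lambda>n. s - n"]) (use s in auto)
    also have "\<dots> = real k * (\<Sum>m\<in>{0..<int (\<Prod>D)}. c (s - m) * c m)"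
    proof -
      have "c (s - (m + int (\<Prod>D))) * c (m + int (\<Prod>D)) = c (s - m) * c m" for m
        using ramanujan_periodic[OF finD, of "int (\<Prod>D)" m]
          ramanujan_periodic[OF finD, of "int (\<Prod>D)" "s - (m + int (\<Prod>D))"]
        by (simp add: c_def algebra_simps del: of_nat_prod)
      then show ?thesis
        using sum_periodic_windows[of "int (\<Prod>D)" "\<lambda>m. c (s - m) * c m" 0 k] prod_prime_set_pos[OF D]
        by (simp add: L(1) del: of_nat_prod)
    qed
    also have "\<dots> = real k * (q * c s)"
      unfolding c_def q_def by (simp only: ramanujan_convolution[OF D])
    also have "\<dots> = real_of_int L * c s" by (simp add: L(1) q_def del: of_nat_prod)
    finally show ?thesis using L(2) s by (simp add: E_def)
  qed
  have Eb: "\<bar>E s\<bar> \<le> 2 * q\<^sup>2" for s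
  proof -
    have "\<bar>\<Sum>n\<in>{1..int N}. if n \<le> s \<and> s < n + L then c n * c (s - n) else 0\<bar>
       \<le> (\<Sum>n\<in>{1..int N}. if n \<le> s \<and> s < n + L then q\<^sup>2 else 0)"
    proof (rule order_trans[OF sum_abs], rule sum_mono)
      fix n
      have "\<bar>c n * c (s - n)\<bar> \<le> q\<^sup>2"
        unfolding abs_mult power2_eq_square using cq q1 by (intro mult_mono) auto
      then show "\<bar>if n \<le> s \<and> s < n + L then c n * c (s - n) else 0\<bar> \<le> (if n \<le> s \<and> s < n + L then q\<^sup>2 else 0)"
        by simp
    qed
    also have "\<dots> = (\<Sum>n | n \<in> {1..int N} \<and> n \<le> s \<and> s < n + L. q\<^sup>2)"
      by (rule sum.inter_filter[symmetric]) simp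
    also have "\<dots> \<le> (\<Sum>n\<in>{s - L<..s}. q\<^sup>2)"
      by (rule sum_mono2) auto
    also have "\<dots> = real_of_int L * q\<^sup>2" using L(2) by simp
    finally have "\<bar>(\<Sum>n\<in>{1..int N}. if n \<le> s \<and> s < n + L then c n * c (s - n) else 0) / real_of_int L\<bar> \<le> q\<^sup>2"
      using L(2) by (simp add: abs_divide field_simps)
    moreover have "\<bar>if s \<le> int N then c s else 0\<bar> \<le> q\<^sup>2"
    proof -
      have "q * 1 \<le> q * q" using q1 by (intro mult_left_mono) auto
      then show ?thesis using cq[of s] q1 by (auto simp: power2_eq_square intro: order_trans)
    qed
    ultimately show ?thesis unfolding E_def by linarith
  qed
  have eq: "ram_avg D N f x - ram_avg D N (ram_proj D L f) x = (\<Sum>s\<in>T. (E s / real N) * f (x - s))" for x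
  proof -
    have "(\<Sum>n\<in>{1..int N}. c n * (\<Sum>m\<in>{0..<L}. c m * f (x - n - m)))
      = (\<Sum>n\<in>{1..int N}. \<Sum>s\<in>{1..<int N + L}. (if n \<le> s \<and> s < n + L then c n * c (s - n) else 0) * f (x - s))"
    proof (rule sum.cong[OF refl])
      fix n assume n: "n \<in> {1..int N}"
      have "(\<Sum>s\<in>{1..<int N + L}. (if n \<le> s \<and> s < n + L then c n * c (s - n) else 0) * f (x - s))
         = (\<Sum>s\<in>{n..<n + L}. c n * c (s - n) * f (x - s))"
        by (rule sum.mono_neutral_cong_right) (use n in auto)
      also have "\<dots> = (\<Sum>m\<in>{0..<L}. c n * c m * f (x - n - m))"
        by (rule sum.reindex_bij_witness[of _ "\<lambda>m. m + n" "\<lambda>s. s - n"]) (auto simp: algebra_simps)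
      finally show "c n * (\<Sum>m\<in>{0..<L}. c m * f (x - n - m))
         = (\<Sum>s\<in>{1..<int N + L}. (if n \<le> s \<and> s < n + L then c n * c (s - n) else 0) * f (x - s))"
        by (simp add: sum_distrib_left mult_ac)
    qed
    also have "\<dots> = (\<Sum>s\<in>{1..<int N + L}. (\<Sum>n\<in>{1..int N}. if n \<le> s \<and> s < n + L then c n * c (s - n) else 0) * f (x - s))"
      unfolding sum_distrib_right by (rule sum.swap)
    finally have 1: "ram_avg D N (ram_proj D L f) x
       = (\<Sum>s\<in>{1..<int N + L}. (\<Sum>n\<in>{1..int N}. if n \<le> s \<and> s < n + L then c n * c (s - n) else 0) * f (x - s)) / real_of_int L / real N"
      by (simp add: ram_avg_def ram_proj_def c_def[symmetric] flip: sum_divide_distrib)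
    have "(\<Sum>n\<in>{1..int N}. c n * f (x - n)) = (\<Sum>s\<in>{1..<int N + L}. (if s \<le> int N then c s else 0) * f (x - s))"
      by (rule sum.mono_neutral_cong_left) (use L(2) in auto)
    then have 2: "ram_avg D N f x = (\<Sum>s\<in>{1..<int N + L}. (if s \<le> int N then c s else 0) * f (x - s)) / real N"
      by (simp add: ram_avg_def c_def)
    have "(\<Sum>s\<in>{1..<int N + L}. E s * f (x - s))
      = (\<Sum>s\<in>{1..<int N + L}. (if s \<le> int N then c s else 0) * f (x - s))
        - (\<Sum>s\<in>{1..<int N + L}. (\<Sum>n\<in>{1..int N}. if n \<le> s \<and> s < n + L then c n * c (s - n) else 0) * f (x - s)) / real_of_int L"
      unfolding sum_divide_distrib[of "\<lambda>s. _ s * f (x - s)"] sum_subtractf[symmetric]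
      by (intro sum.cong refl) (simp only: E_def left_diff_distrib times_divide_eq_left)
    then have "ram_avg D N f x - ram_avg D N (ram_proj D L f) x = (\<Sum>s\<in>{1..<int N + L}. E s * f (x - s)) / real N"
      unfolding 1 2 by (simp only: diff_divide_distrib)
    also have "(\<Sum>s\<in>{1..<int N + L}. E s * f (x - s)) = (\<Sum>s\<in>T. E s * f (x - s))"
      by (rule sum.mono_neutral_right) (use E0 L(2) in \<open>auto simp: T_def\<close>)
    finally show ?thesis by (simp add: sum_divide_distrib)
  qed
  have T: "finite T" "real (card T) \<le> 2 * real_of_int L"
  proof -
    show "finite T" by (simp add: T_def)
    have "card T \<le> card {1..<L} + card {int N<..<int N + L}" unfolding T_def by (rule card_Un_le)
    also have "\<dots> \<le> nat L + nat L" by simp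
    finally show "real (card T) \<le> 2 * real_of_int L" using L(2) by linarith
  qed
  have "(\<Sum>s\<in>T. \<bar>E s / real N\<bar>) \<le> (\<Sum>s\<in>T. 2 * q\<^sup>2 / real N)"
    using Eb by (intro sum_mono) (simp add: abs_divide divide_right_mono)
  also have "\<dots> = real (card T) * (2 * q\<^sup>2 / real N)" by simp
  also have "\<dots> \<le> (2 * real_of_int L) * (2 * q\<^sup>2 / real N)" by (intro mult_right_mono T) auto
  finally have "(\<Sum>s\<in>T. \<bar>E s / real N\<bar>) \<le> 4 * real_of_int L * q\<^sup>2 / real N" by simp
  then have "(\<Sum>s\<in>T. \<bar>E s / real N\<bar>) * B \<le> 4 * real_of_int L * q\<^sup>2 / real N * B"
    by (intro mult_right_mono l2_bounded_nonneg[OF f])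
  then show ?thesis
    unfolding eq using l2_bounded_conv[OF f T(1), of "\<lambda>s. E s / real N" "\<lambda>s. s"]
    by (auto intro: l2_bounded_le simp: q_def)
qed

text \<open>
  For \<open>D \<noteq> E\<close> full periods of length \<open>\<Prod>(D \<union> E)\<close> cancel, so only a bounded number of terms remains,
  however long the interval is.
\<close>

lemma ram_proj_correlation_le:
  assumes D: "prime_set D" and E: "prime_set E" and "D \<noteq> E"
  shows "\<bar>\<Sum>m\<in>{a..<b}. ramanujan D m * ramanujan E (m + h)\<bar> \<le> (real (\<Prod>D) * real (\<Prod>E))\<^sup>2"
proof -
  have fin: "finite D" "finite E" using D E by (auto simp: prime_set_def)
  have DE: "prime_set (D \<union> E)" using D E by (rule prime_set_Un)
  define q where "q = \<Prod>(D \<union> E)"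
  have q0: "q > 0" unfolding q_def by (rule prod_prime_set_pos[OF DE])
  have div: "\<Prod>D dvd q" "\<Prod>E dvd q" unfolding q_def
    using fin by (auto intro!: prod_dvd_prod_subset)
  have "q * \<Prod>(D \<inter> E) = \<Prod>D * \<Prod>E"
    unfolding q_def by (rule prod.union_inter[OF fin])
  moreover have "\<Prod>(D \<inter> E) \<ge> 1"
    using prod_prime_set_pos[OF prime_set_subset[OF D, of "D \<inter> E"]] by simp
  ultimately have qle: "q \<le> \<Prod>D * \<Prod>E" by (metis mult.right_neutral mult_le_mono2)
  have "\<bar>\<Sum>m\<in>{a..<b}. ramanujan D m * ramanujan E (m + h)\<bar> \<le> real_of_int (int q) * (real (\<Prod>D) * real (\<Prod>E))"
  proof (rule abs_sum_periodic_interval_le)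
    show "int q > 0" using q0 by simp
    show "ramanujan D (m + int q) * ramanujan E (m + int q + h) = ramanujan D m * ramanujan E (m + h)" for m
      using ramanujan_periodic[OF fin(1), of "int q" m] ramanujan_periodic[OF fin(2), of "int q" "m + h"] div
      by (simp add: algebra_simps flip: int_dvd_int_iff)
    show "(\<Sum>m\<in>{0..<int q}. ramanujan D m * ramanujan E (m + h)) = 0"
      unfolding q_def by (rule ramanujan_orthogonal[OF assms])
    show "\<bar>ramanujan D m * ramanujan E (m + h)\<bar> \<le> real (\<Prod>D) * real (\<Prod>E)" for m
      unfolding abs_mult by (intro mult_mono abs_ramanujan_le D E) (auto simp del: of_nat_prod)
  qed
  also have "\<dots> \<le> (real (\<Prod>D) * real (\<Prod>E)) * (real (\<Prod>D) * real (\<Prod>E))"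
  proof (rule mult_right_mono)
    have "real q \<le> real (\<Prod>D * \<Prod>E)" using qle by (rule of_nat_mono)
    then show "real_of_int (int q) \<le> real (\<Prod>D) * real (\<Prod>E)" by (simp only: of_nat_mult of_int_of_nat_eq)
  qed (simp del: of_nat_prod)
  finally show ?thesis by (simp add: power2_eq_square)
qed

lemma card_prime_sets_le:
  assumes "\<And>D. D \<in> I \<Longrightarrow> prime_set D" "\<And>D. D \<in> I \<Longrightarrow> \<Prod>D < Y"
  shows "card I \<le> Y"
proof -
  have "card I = card ((\<lambda>D. \<Prod>D) ` I)"
    using inj_on_prod_prime_set[of I] assms(1) by (simp add: card_image)
  also have "\<dots> \<le> card {..<Y}" using assms(2) by (intro card_mono) auto
  finally show ?thesis by simp
qed

text \<open>
  The projections for moduli \<open>q \<in> [X, 2X)\<close> are almost orthogonal. A window of length about \<open>X^6\<close> makes each of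
  the at most \<open>2X\<close> off-diagonal correlations of a projection smaller than \<open>64 / X\<^sup>2\<close>; the diagonal
  ones cost the mean value \<open>2^\<omega>(q)\<close> of \<open>\<bar>c_q\<bar>\<close>, squared.
\<close>

lemma ram_proj_bessel:
  fixes f :: "int \<Rightarrow> real"
  assumes I: "finite I" "\<And>D. D \<in> I \<Longrightarrow> prime_set D" "\<And>D. D \<in> I \<Longrightarrow> X \<le> \<Prod>D"
      "\<And>D. D \<in> I \<Longrightarrow> \<Prod>D < 2 * X" "\<And>D. D \<in> I \<Longrightarrow> card D \<le> w"
    and X: "X \<ge> 128"
    and S: "finite S" "\<And>x. x \<notin> S \<Longrightarrow> f x = 0"
  shows "\<exists>n. (\<forall>D\<in>I. n D \<ge> 0 \<and> l2_bounded (ram_proj D (int (X ^ 5) * int (\<Prod>D)) f) (n D))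
    \<and> (\<Sum>D\<in>I. (n D)\<^sup>2) \<le> (4 ^ w + 1) * (L2_set f S)\<^sup>2"
proof -
  define L where "L D = int (X ^ 5) * int (\<Prod>D)" for D :: "nat set"
  define M where "M = 2 * int X ^ 6"
  define T where "T = {0..<M}"
  (* All windows are cut from one common index set T, as the length L D varies slightly with
     D. *)
  define K where "K D m = (if m < L D then ramanujan D m / real_of_int (L D) else 0)" for D m
  define S' where "S' = (\<Union>m\<in>T. (\<lambda>x. x + m) ` S)"
  have x0: "real X \<ge> 128" "real X > 0" using X by auto
  have X6: "int X ^ 6 = int X ^ 5 * int X" by (simp add: eval_nat_numeral)
  have Lpos: "L D > 0" and LM: "L D \<le> M" and Lge: "L D \<ge> int X ^ 6" if "D \<in> I" for D
  proof -
    have D: "X \<le> \<Prod>D" "\<Prod>D < 2 * X" using I that by auto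
    have "int X ^ 5 * int X \<le> int X ^ 5 * int (\<Prod>D)"
      using D(1) by (intro mult_left_mono of_nat_mono) auto
    then show 1: "L D \<ge> int X ^ 6" by (simp add: L_def X6 del: of_nat_prod)
    have "int (\<Prod>D) \<le> int (2 * X)" using D(2) by (intro of_nat_mono) simp
    then have "int X ^ 5 * int (\<Prod>D) \<le> int X ^ 5 * int (2 * X)" by (intro mult_left_mono) auto
    then show "L D \<le> M" by (simp add: L_def M_def X6 del: of_nat_prod)
    show "L D > 0" using 1 x0 by (smt (verit) of_nat_0_less_iff zero_less_power of_nat_0_le_iff)
  qed
  have proj: "ram_proj D (L D) f x = (\<Sum>m\<in>T. K D m * f (x - m))" if "D \<in> I" for D x
  proof -
    have "(\<Sum>m\<in>T. K D m * f (x - m)) = (\<Sum>m\<in>{0..<L D}. ramanujan D m / real_of_int (L D) * f (x - m))"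
      by (rule sum.mono_neutral_cong_right) (use LM[OF that] in \<open>auto simp: T_def K_def\<close>)
    then show ?thesis by (simp add: ram_proj_def sum_divide_distrib)
  qed
  have finT: "finite T" by (simp add: T_def)
  have finS': "finite S'" using finT S by (auto simp: S'_def)
  have vanish: "(\<Sum>m\<in>T. K D m * f (x - m)) = 0" if "x \<notin> S'" for D x
  proof (rule sum.neutral, rule ballI)
    fix m assume m: "m \<in> T"
    have "x - m \<notin> S"
    proof
      assume "x - m \<in> S"
      then have "x \<in> (\<lambda>x. x + m) ` S" by (intro image_eqI[of _ _ "x - m"]) auto
      then show False using m that by (auto simp: S'_def)
    qed
    then show "K D m * f (x - m) = 0" using S(2) by simp
  qed
  (* The bounds for the correlations; X is at least 128, so each row sums to at most 4^w + 1. *)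
  define e where "e D E = (if D = E then 4 ^ w else 64 / (real X)\<^sup>2)" for D E :: "nat set"
  have cardI: "card I \<le> 2 * X" by (rule card_prime_sets_le) (use I in auto)
  have rows: "(\<Sum>E\<in>I. e D E) \<le> 4 ^ w + 1" if "D \<in> I" for D
  proof -
    have "(\<Sum>E\<in>I. e D E) = e D D + (\<Sum>E\<in>I - {D}. e D E)"
      using I(1) that by (rule sum.remove)
    also have "(\<Sum>E\<in>I - {D}. e D E) \<le> (\<Sum>E\<in>I. 64 / (real X)\<^sup>2)"
      using I(1) by (intro order_trans[OF eq_refl sum_mono2[of I "I - {D}"]] sum.cong) (auto simp: e_def)
    also have "\<dots> = real (card I) * (64 / (real X)\<^sup>2)" by simp
    also have "\<dots> \<le> real (2 * X) * (64 / (real X)\<^sup>2)"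
      using cardI by (intro mult_right_mono of_nat_mono) auto
    also have "\<dots> = 128 / real X" using x0 by (simp add: power2_eq_square field_simps)
    also have "\<dots> \<le> 1" using x0 by simp
    finally show ?thesis by (simp add: e_def)
  qed
  have e_sym: "e D E = e E D" for D E by (simp add: e_def)
  have corr: "(\<Sum>h\<in>differences T.
      \<bar>correlation T (K D) (K E) h\<bar>) \<le> e D E"
    if DE: "D \<in> I" "E \<in> I" for D E
  proof (cases "D = E")
    case True
    have "(\<Sum>h\<in>differences T. \<bar>correlation T (K D) (K E) h\<bar>)
      \<le> (\<Sum>h\<in>differences T.
          \<Sum>p\<in>{p\<in>T \<times> T. (case p of (m, m') \<Rightarrow> m' - m) = h}. case p of (m, m') \<Rightarrow> \<bar>K D m\<bar> * \<bar>K E m'\<bar>)"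
    proof (rule sum_mono)
      fix h
      have "\<bar>correlation T (K D) (K E) h\<bar>
        \<le> (\<Sum>(m, m') | m \<in> T \<and> m' \<in> T \<and> m' - m = h. \<bar>K D m\<bar> * \<bar>K E m'\<bar>)"
        unfolding correlation_def by (rule order_trans[OF sum_abs]) (auto simp: abs_mult intro!: sum_mono)
      also have "\<dots> = (\<Sum>p\<in>{p\<in>T \<times> T. (case p of (m, m') \<Rightarrow> m' - m) = h}. case p of (m, m') \<Rightarrow> \<bar>K D m\<bar> * \<bar>K E m'\<bar>)"
        by (rule sum.cong) auto
      finally show "\<bar>correlation T (K D) (K E) h\<bar> \<le> \<dots>" .
    qed
    also have "\<dots> = (\<Sum>(m, m')\<in>T \<times> T. \<bar>K D m\<bar> * \<bar>K E m'\<bar>)"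
      unfolding differences_def by (rule sum.image_gen[symmetric]) (use finT in auto)
    also have "\<dots> = (\<Sum>m\<in>T. \<bar>K D m\<bar>) * (\<Sum>m\<in>T. \<bar>K D m\<bar>)"
      by (simp add: True sum_product sum.cartesian_product)
    also have "\<dots> \<le> 2 ^ w * 2 ^ w"
    proof -
      have D: "prime_set D" "card D \<le> w" using I DE by auto
      have "(\<Sum>m\<in>T. \<bar>K D m\<bar>) = (\<Sum>m\<in>{0..<L D}. \<bar>ramanujan D m\<bar> / real_of_int (L D))"
        by (rule sum.mono_neutral_cong_right)
           (use LM[OF DE(1)] Lpos[OF DE(1)] in \<open>auto simp: T_def K_def abs_divide\<close>)
      also have "\<dots> = (\<Sum>m\<in>{0..<0 + int (X ^ 5) * int (\<Prod>D)}. \<bar>ramanujan D m\<bar>) / real_of_int (L D)"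
        by (simp add: sum_divide_distrib L_def)
      also have "(\<Sum>m\<in>{0..<0 + int (X ^ 5) * int (\<Prod>D)}. \<bar>ramanujan D m\<bar>)
         = real (X ^ 5) * (\<Sum>m\<in>{0..<int (\<Prod>D)}. \<bar>ramanujan D m\<bar>)"
        using prod_prime_set_pos[OF D(1)] ramanujan_periodic[of D "int (\<Prod>D)"] D(1)
        by (intro sum_periodic_windows) (auto simp: prime_set_def simp del: of_nat_prod)
      also have "\<dots> / real_of_int (L D) \<le> (real (X ^ 5) * (2 ^ card D * real (\<Prod>D))) / real_of_int (L D)"
        using Lpos[OF DE(1)] by (intro divide_right_mono mult_left_mono sum_abs_ramanujan_le D) auto
      also have "\<dots> = 2 ^ card D"
      proof -
        have "real_of_int (L D) = real (X ^ 5) * real (\<Prod>D)" by (simp add: L_def del: of_nat_prod)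
        moreover have "real_of_int (L D) \<noteq> 0" using Lpos[OF DE(1)] by simp
        ultimately show ?thesis by (simp del: of_nat_prod)
      qed
      also have "\<dots> \<le> 2 ^ w" using D(2) by (intro power_increasing) auto
      finally have "(\<Sum>m\<in>T. \<bar>K D m\<bar>) \<le> 2 ^ w" .
      then show ?thesis by (intro mult_mono) (auto simp: sum_nonneg)
    qed
    also have "\<dots> = e D E" by (simp add: True e_def flip: power_mult_distrib)
    finally show ?thesis .
  next
    case False
    have D: "prime_set D" "prime_set E" using I DE by auto
    have qD: "real (\<Prod>D) \<le> 2 * real X" "real (\<Prod>E) \<le> 2 * real X"
      using of_nat_mono[of "\<Prod>D" "2 * X"] of_nat_mono[of "\<Prod>E" "2 * X"] I(4) DE
      by (auto simp: less_imp_le simp del: of_nat_prod)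
    have Lr: "real_of_int (L D) \<ge> real X ^ 6" "real_of_int (L E) \<ge> real X ^ 6"
      using Lge[OF DE(1)] Lge[OF DE(2)] by (metis of_int_le_iff of_int_of_nat_eq of_int_power)+
    have each: "\<bar>correlation T (K D) (K E) h\<bar> \<le> 16 * real X ^ 4 / (real X ^ 6 * real X ^ 6)" for h
    proof -
      define a where "a = max 0 (- h)"
      define b where "b = min (L D) (L E - h)"
      have "correlation T (K D) (K E) h
         = (\<Sum>m | m \<in> T \<and> m + h \<in> T. K D m * K E (m + h))"
        unfolding correlation_def by (rule sum.reindex_bij_witness[of _ "\<lambda>m. (m, m + h)" fst]) auto
      also have "\<dots> = (\<Sum>m\<in>{a..<b}. ramanujan D m / real_of_int (L D) * (ramanujan E (m + h) / real_of_int (L E)))"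
      proof (rule sum.mono_neutral_cong_right)
        show "finite {m. m \<in> T \<and> m + h \<in> T}" by (rule finite_subset[OF _ finT]) auto
      qed (use LM[OF DE(1)] LM[OF DE(2)] in \<open>auto simp: T_def K_def a_def b_def\<close>)
      also have "\<dots> = (\<Sum>m\<in>{a..<b}. ramanujan D m * ramanujan E (m + h)) / (real_of_int (L D) * real_of_int (L E))"
        by (simp add: sum_divide_distrib)
      finally have "\<bar>correlation T (K D) (K E) h\<bar>
         = \<bar>\<Sum>m\<in>{a..<b}. ramanujan D m * ramanujan E (m + h)\<bar> / (real_of_int (L D) * real_of_int (L E))"
        using Lpos[OF DE(1)] Lpos[OF DE(2)] by (simp add: abs_divide abs_mult)
      also have "\<dots> \<le> (real (\<Prod>D) * real (\<Prod>E))\<^sup>2 / (real_of_int (L D) * real_of_int (L E))"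
        using Lpos[OF DE(1)] Lpos[OF DE(2)]
        by (intro divide_right_mono ram_proj_correlation_le D False) auto
      also have "\<dots> \<le> ((2 * real X) * (2 * real X))\<^sup>2 / (real X ^ 6 * real X ^ 6)"
        using qD Lr x0 Lpos[OF DE(1)] Lpos[OF DE(2)]
        by (intro frac_le power_mono mult_mono) (auto simp del: of_nat_prod)
      also have "\<dots> = 16 * real X ^ 4 / (real X ^ 6 * real X ^ 6)"
        by (simp add: power2_eq_square power4_eq_xxxx)
      finally show ?thesis .
    qed
    have "differences T \<subseteq> {- M<..<M}" by (auto simp: T_def differences_def)
    then have "card (differences T) \<le> card {- M<..<M}" by (rule card_mono[rotated]) simp
    also have "\<dots> \<le> nat (2 * M)" by simp
    finally have "real (card (differences T)) \<le> real (nat (2 * M))" by (rule of_nat_mono)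
    also have "\<dots> = 4 * real X ^ 6" by (simp add: M_def)
    finally have cardH: "real (card (differences T)) \<le> 4 * real X ^ 6" .
    have "(\<Sum>h\<in>differences T. \<bar>correlation T (K D) (K E) h\<bar>)
       \<le> real (card (differences T)) * (16 * real X ^ 4 / (real X ^ 6 * real X ^ 6))"
      by (rule sum_bounded_above) (rule each)
    also have "\<dots> \<le> (4 * real X ^ 6) * (16 * real X ^ 4 / (real X ^ 6 * real X ^ 6))"
      by (intro mult_right_mono cardH) auto
    also have "\<dots> = 64 / (real X)\<^sup>2" using x0 by (simp add: eval_nat_numeral field_simps)
    finally show ?thesis using False by (simp add: e_def)
  qed
  have "(\<Sum>D\<in>I. (L2_set (\<lambda>x. \<Sum>m\<in>T. K D m * f (x - m)) S')\<^sup>2) \<le> (4 ^ w + 1) * (L2_set f S)\<^sup>2"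
  proof (rule bessel_almost_orthogonal[where e = e])
    show "(\<Sum>i\<in>I. e i j) \<le> 4 ^ w + 1" if "j \<in> I" for j
      using rows[OF that] by (simp add: e_sym[of _ j])
  qed (use I(1) finT S finS' corr rows vanish in auto)
  moreover have "l2_bounded (ram_proj D (L D) f) (L2_set (\<lambda>x. \<Sum>m\<in>T. K D m * f (x - m)) S')" if "D \<in> I" for D
  proof -
    have "ram_proj D (L D) f = (\<lambda>x. \<Sum>m\<in>T. K D m * f (x - m))" using proj[OF that] by (simp add: fun_eq_iff)
    then show ?thesis using finS' vanish by (simp only:) (rule l2_bounded_finite_support, auto)
  qed
  ultimately show ?thesis
    by (intro exI[of _ "\<lambda>D. L2_set (\<lambda>x. \<Sum>m\<in>T. K D m * f (x - m)) S'"]) (auto simp: L_def)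
qed

lemma sum_inverse_power_two_le:
  assumes "finite K" "\<And>k. k \<in> K \<Longrightarrow> k \<ge> (m::nat)"
  shows "(\<Sum>k\<in>K. 1 / 2 ^ k :: real) \<le> 2 / 2 ^ m"
proof -
  define M where "M = Suc (Max (insert m K))"
  have "(\<Sum>k\<in>K. 1 / 2 ^ k :: real) \<le> (\<Sum>k\<in>{m..<M}. 1 / 2 ^ k)"
    using assms by (intro sum_mono2) (auto simp: M_def less_Suc_eq_le intro!: Max_ge)
  also have "\<dots> = 2 / 2 ^ m - 2 / 2 ^ M"
  proof -
    have "m \<le> M" using assms(1) by (simp add: M_def le_SucI)
    then show ?thesis
    proof (induction M rule: dec_induct)
      case (step n)
      have "2 / 2 ^ n - 1 / 2 ^ n = (2 :: real) / 2 ^ Suc n" by (simp add: field_simps)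
      moreover have "(\<Sum>k\<in>{m..<Suc n}. 1 / 2 ^ k :: real) = (\<Sum>k\<in>{m..<n}. 1 / 2 ^ k) + 1 / 2 ^ n"
        using step.hyps by simp
      ultimately show ?case using step.IH by linarith
    qed simp
  qed
  also have "\<dots> \<le> 2 / 2 ^ m" by simp
  finally show ?thesis .
qed

text \<open>
  Replacing \<open>f\<close> by its projection for each modulus separately makes the \<open>\<ell>\<^sup>2\<close> norms square-summable over
  the block, so Cauchy-Schwarz over the at most \<open>2 \<cdot> 2^j\<close> moduli loses only the square root of their
  number. The scales must satisfy \<open>k \<ge> 10 j\<close> for the errors of the projections to be negligible.
\<close>

lemma l2_bounded_block_max:
  fixes f :: "int \<Rightarrow> real"
  assumes I: "finite I" "\<And>D. D \<in> I \<Longrightarrow> prime_set D" "\<And>D. D \<in> I \<Longrightarrow> 2 ^ j \<le> \<Prod>D"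
      "\<And>D. D \<in> I \<Longrightarrow> \<Prod>D < 2 * 2 ^ j" "\<And>D. D \<in> I \<Longrightarrow> card D \<le> w"
    and j: "j \<ge> 7" and K: "finite K" "\<And>k. k \<in> K \<Longrightarrow> k \<ge> 10 * j"
    and S: "finite S" "\<And>x. x \<notin> S \<Longrightarrow> f x = 0"
  shows "l2_bounded (\<lambda>x. \<Sum>D\<in>I. ram_max D K f x) (17 * 4 ^ w * sqrt (2 ^ j) * L2_set f S)"
proof -
  define X where "X = (2::nat) ^ j"
  define B where "B = L2_set f S"
  have B0: "B \<ge> 0" by (simp add: B_def)
  have fB: "l2_bounded f B" unfolding B_def using S by (rule l2_bounded_finite_support)
  have X128: "X \<ge> 128"
  proof -
    have "(2::nat) ^ 7 \<le> 2 ^ j" using j by (intro power_increasing) auto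
    then show ?thesis by (simp add: X_def)
  qed
  then have x0: "real X \<ge> 128" by simp
  have Xr: "real X = 2 ^ j" by (simp add: X_def)
  have "\<exists>n. (\<forall>D\<in>I. n D \<ge> 0 \<and> l2_bounded (ram_proj D (int (X ^ 5) * int (\<Prod>D)) f) (n D))
    \<and> (\<Sum>D\<in>I. (n D)\<^sup>2) \<le> (4 ^ w + 1) * (L2_set f S)\<^sup>2"
    by (rule ram_proj_bessel) (use I X128 S in \<open>auto simp: X_def\<close>)
  then obtain n where n': "\<forall>D\<in>I. n D \<ge> 0 \<and> l2_bounded (ram_proj D (int (X ^ 5) * int (\<Prod>D)) f) (n D)"
      "(\<Sum>D\<in>I. (n D)\<^sup>2) \<le> (4 ^ w + 1) * B\<^sup>2"
    unfolding B_def by blast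
  have n: "n D \<ge> 0" "l2_bounded (ram_proj D (int (X ^ 5) * int (\<Prod>D)) f) (n D)" if "D \<in> I" for D
    using n'(1) that by blast+
  define P where "P D = ram_proj D (int (X ^ 5) * int (\<Prod>D)) f" for D
  have each: "l2_bounded (ram_max D K f) (2 ^ w * (8 * n D) + 64 / (real X)\<^sup>2 * B)" if D: "D \<in> I" for D
  proof -
    have D': "prime_set D" "X \<le> \<Prod>D" "\<Prod>D < 2 * X" "card D \<le> w" using I D by (auto simp: X_def)
    have qr: "real (\<Prod>D) \<le> 2 * real X" using of_nat_mono[of "\<Prod>D" "2 * X"] D'(3) by (simp del: of_nat_prod)
    (* The error at scale k is summable over the scales, so the supremum over k is harmless. *)
    define er where "er k x = ram_avg D (2 ^ k) f x - ram_avg D (2 ^ k) (P D) x" for k x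
    have er: "l2_bounded (er k) (32 * real X ^ 8 * B * (1 / 2 ^ k))" for k
    proof -
      have "l2_bounded (er k) (4 * real_of_int (int (X ^ 5) * int (\<Prod>D)) * (real (\<Prod>D))\<^sup>2 / real (2 ^ k) * B)"
        unfolding er_def P_def
        using D' fB prod_prime_set_pos[OF D'(1)] X128
        by (intro ram_avg_ram_proj_error[where k = "X ^ 5"]) (auto simp del: of_nat_prod)
      moreover have "4 * real_of_int (int (X ^ 5) * int (\<Prod>D)) * (real (\<Prod>D))\<^sup>2 / real (2 ^ k) * B
        \<le> 32 * real X ^ 8 * B * (1 / 2 ^ k)"
      proof -
        have "real_of_int (int (X ^ 5) * int (\<Prod>D)) = real X ^ 5 * real (\<Prod>D)" by (simp del: of_nat_prod)
        also have "\<dots> \<le> real X ^ 5 * (2 * real X)" using qr by (rule mult_left_mono) simp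
        finally have a: "4 * real_of_int (int (X ^ 5) * int (\<Prod>D)) \<le> 4 * (real X ^ 5 * (2 * real X))"
          by linarith
        have "4 * real_of_int (int (X ^ 5) * int (\<Prod>D)) * (real (\<Prod>D))\<^sup>2 / real (2 ^ k) * B
          \<le> 4 * (real X ^ 5 * (2 * real X)) * (2 * real X)\<^sup>2 / real (2 ^ k) * B"
          using qr B0
          by (intro mult_right_mono divide_right_mono mult_mono[OF a] power_mono) (auto simp del: of_nat_prod)
        also have "\<dots> = 32 * real X ^ 8 * B * (1 / 2 ^ k)"
          by (simp add: eval_nat_numeral)
        finally show ?thesis .
      qed
      ultimately show ?thesis by (rule l2_bounded_le)
    qed
    have "l2_bounded (\<lambda>x. ram_max D K (P D) x + (\<Sum>k\<in>K. \<bar>er k x\<bar>))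
       (2 ^ card D * (8 * n D) + (\<Sum>k\<in>K. 32 * real X ^ 8 * B * (1 / 2 ^ k)))"
    proof (intro l2_bounded_add l2_bounded_sum K(1))
      show "l2_bounded (ram_max D K (P D)) (2 ^ card D * (8 * n D))"
        unfolding P_def by (intro l2_bounded_ram_max D' n D K)
      show "l2_bounded (\<lambda>x. \<bar>er k x\<bar>) (32 * real X ^ 8 * B * (1 / 2 ^ k))" for k
        by (rule l2_bounded_mono[OF er]) simp
    qed
    moreover have "2 ^ card D * (8 * n D) \<le> 2 ^ w * (8 * n D)"
      using D'(4) n(1)[OF D] by (intro mult_right_mono power_increasing) auto
    moreover have "(\<Sum>k\<in>K. 32 * real X ^ 8 * B * (1 / 2 ^ k)) \<le> 64 / (real X)\<^sup>2 * B"
    proof -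
      have "(\<Sum>k\<in>K. 32 * real X ^ 8 * B * (1 / 2 ^ k)) = 32 * real X ^ 8 * B * (\<Sum>k\<in>K. 1 / 2 ^ k)"
        by (rule sum_distrib_left[symmetric])
      also have "\<dots> \<le> 32 * real X ^ 8 * B * (2 / 2 ^ (10 * j))"
        using K B0 by (intro mult_left_mono sum_inverse_power_two_le) auto
      also have "(2::real) ^ (10 * j) = real X ^ 10" by (simp add: X_def mult.commute flip: power_mult)
      also have "32 * real X ^ 8 * B * (2 / real X ^ 10) = 64 / (real X)\<^sup>2 * B"
        using x0 by (simp add: eval_nat_numeral field_simps)
      finally show ?thesis .
    qed
    ultimately have bd: "l2_bounded (\<lambda>x. ram_max D K (P D) x + (\<Sum>k\<in>K. \<bar>er k x\<bar>)) (2 ^ w * (8 * n D) + 64 / (real X)\<^sup>2 * B)"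
      by (meson add_mono l2_bounded_le)
    show ?thesis
    proof (rule l2_bounded_mono[OF bd])
      fix x
      have r0: "ram_max D K (P D) x \<ge> 0" "(\<Sum>k\<in>K. \<bar>er k x\<bar>) \<ge> 0"
        using ram_max_nonneg[OF K(1)] by (auto simp: sum_nonneg)
      have "ram_max D K f x \<le> ram_max D K (P D) x + (\<Sum>k\<in>K. \<bar>er k x\<bar>)"
      proof (rule ram_max_le[OF K(1)])
        fix k assume k: "k \<in> K"
        have "\<bar>er k x\<bar> \<le> (\<Sum>k\<in>K. \<bar>er k x\<bar>)" by (rule member_le_sum) (use k K in auto)
        moreover have "\<bar>ram_avg D (2 ^ k) f x\<bar> \<le> \<bar>ram_avg D (2 ^ k) (P D) x\<bar> + \<bar>er k x\<bar>"
          unfolding er_def by linarith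
        ultimately show "\<bar>ram_avg D (2 ^ k) f x\<bar> \<le> ram_max D K (P D) x + (\<Sum>k\<in>K. \<bar>er k x\<bar>)"
          using ram_avg_le_ram_max[OF K(1) k, of D "P D" x] by linarith
      qed (use r0 in auto)
      then show "\<bar>ram_max D K f x\<bar> \<le> \<bar>ram_max D K (P D) x + (\<Sum>k\<in>K. \<bar>er k x\<bar>)\<bar>"
        using r0 ram_max_nonneg[OF K(1), of D f x] by simp
    qed
  qed
  have "l2_bounded (\<lambda>x. \<Sum>D\<in>I. ram_max D K f x) (\<Sum>D\<in>I. 2 ^ w * (8 * n D) + 64 / (real X)\<^sup>2 * B)"
    by (intro l2_bounded_sum I each)
  moreover have "(\<Sum>D\<in>I. 2 ^ w * (8 * n D) + 64 / (real X)\<^sup>2 * B) \<le> 17 * 4 ^ w * sqrt (2 ^ j) * B"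
  proof -
    have cardI: "real (card I) \<le> 2 * real X"
      using card_prime_sets_le[of I "2 * X"] I(2,4) of_nat_mono[of "card I" "2 * X"] by (simp add: X_def)
    have "(\<Sum>D\<in>I. n D) = (\<Sum>D\<in>I. \<bar>1\<bar> * \<bar>n D\<bar>)" using n(1) by simp
    also have "\<dots> \<le> L2_set (\<lambda>_. 1) I * L2_set n I" by (rule L2_set_mult_ineq)
    also have "L2_set (\<lambda>_. 1) I = sqrt (real (card I))" by (simp add: L2_set_def)
    also have "sqrt (real (card I)) * L2_set n I \<le> sqrt (2 * real X) * sqrt (2 * 4 ^ w * B\<^sup>2)"
    proof (rule mult_mono)
      have "(\<Sum>D\<in>I. (n D)\<^sup>2) \<le> 2 * 4 ^ w * B\<^sup>2"
      proof -
        have "(4::real) ^ w + 1 \<le> 2 * 4 ^ w" by simp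
        then have "((4::real) ^ w + 1) * B\<^sup>2 \<le> 2 * 4 ^ w * B\<^sup>2" by (rule mult_right_mono) simp
        with n'(2) show ?thesis by linarith
      qed
      then show "L2_set n I \<le> sqrt (2 * 4 ^ w * B\<^sup>2)" by (simp add: L2_set_def)
    qed (use cardI in auto)
    also have "\<dots> = 2 * 2 ^ w * sqrt (real X) * B"
    proof -
      have "sqrt (2 * real X) * sqrt (2 * 4 ^ w * B\<^sup>2) = sqrt (2 * 2 * (4 ^ w) * real X * B\<^sup>2)"
        by (simp add: mult_ac flip: real_sqrt_mult)
      also have "\<dots> = sqrt ((2 * 2 ^ w)\<^sup>2 * real X * B\<^sup>2)"
        by (simp add: power_mult_distrib power2_eq_square flip: power_mult_distrib)
      also have "\<dots> = 2 * 2 ^ w * sqrt (real X) * B" using B0 by (simp add: real_sqrt_mult)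
      finally show ?thesis .
    qed
    finally have sumn: "(\<Sum>D\<in>I. n D) \<le> 2 * 2 ^ w * sqrt (real X) * B" .
    have "(\<Sum>D\<in>I. 2 ^ w * (8 * n D) + 64 / (real X)\<^sup>2 * B) = 8 * 2 ^ w * (\<Sum>D\<in>I. n D) + real (card I) * (64 / (real X)\<^sup>2 * B)"
      by (simp add: sum.distrib sum_distrib_left sum_distrib_right mult_ac)
    also have "\<dots> \<le> 8 * 2 ^ w * (2 * 2 ^ w * sqrt (real X) * B) + (2 * real X) * (64 / (real X)\<^sup>2 * B)"
      using sumn cardI B0 by (intro add_mono mult_left_mono mult_right_mono) auto
    also have "8 * 2 ^ w * (2 * 2 ^ w * sqrt (real X) * B) = 16 * 4 ^ w * sqrt (real X) * B"
    proof -
      have "(2::real) ^ w * 2 ^ w = 4 ^ w" by (simp flip: power_mult_distrib)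
      then show ?thesis by (simp add: mult_ac)
    qed
    also have "(2 * real X) * (64 / (real X)\<^sup>2 * B) = (128 / real X) * B"
      using x0 by (simp add: power2_eq_square field_simps)
    also have "\<dots> \<le> (4 ^ w * sqrt (real X)) * B"
    proof (rule mult_right_mono[OF _ B0])
      have "128 / real X \<le> 1" using x0 by simp
      also have "1 \<le> 4 ^ w * sqrt (real X)" using x0 mult_mono[of 1 "4 ^ w" 1 "sqrt (real X)"] by simp
      finally show "128 / real X \<le> 4 ^ w * sqrt (real X)" .
    qed
    finally show ?thesis by (simp add: Xr algebra_simps)
  qed
  ultimately show ?thesis unfolding B_def by (rule l2_bounded_le)
qed

section \<open>The high frequencies\<close>

text \<open>
  Half of the gain \<open>2^(-j/2)\<close> in a block of moduli of size \<open>2^j\<close>. The other half pays for the factors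
  that are exponential in the number of prime factors.
\<close>

definition decay :: real where "decay = 2 powr (- 1 / 4)"

lemma decay_bounds: "0 < decay" "decay \<le> 7 / 8" "decay < 1"
proof -
  show pos: "0 < decay" by (simp add: decay_def)
  have "decay ^ 4 = decay powr (real 4)" by (rule powr_realpow[symmetric]) (rule pos)
  also have "\<dots> = 2 powr (- 1 / 4 * real 4)" by (simp only: decay_def powr_powr)
  also have "\<dots> = 1 / 2" by (simp add: powr_minus)
  also have "\<dots> \<le> (7 / 8) ^ 4" by (simp add: eval_nat_numeral)
  finally show "decay \<le> 7 / 8" by (rule power_le_imp_le_base[of _ 3, simplified]) simp
  then show "decay < 1" by simp
qed

lemma decay_power: "decay ^ n = 2 powr (- real n / 4)"
  by (simp add: decay_def powr_realpow[symmetric] powr_powr)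

lemma sum_decay_power_le:
  assumes "finite J" "\<And>j. j \<in> J \<Longrightarrow> j \<ge> s"
  shows "(\<Sum>j\<in>J. decay ^ j) \<le> 8 * decay ^ s"
proof -
  define M where "M = Suc (Max (insert s J))"
  have "(\<Sum>j\<in>J. decay ^ j) \<le> (\<Sum>j\<in>{s..<M}. decay ^ j)"
    using assms decay_bounds by (intro sum_mono2) (auto simp: M_def less_Suc_eq_le intro!: Max_ge)
  also have "\<dots> \<le> 8 * (decay ^ s - decay ^ M)"
  proof -
    have "s \<le> M" using assms(1) by (simp add: M_def le_SucI)
    then show ?thesis
    proof (induction M rule: dec_induct)
      case (step n)
      have "decay ^ n * (8 * (1 - decay)) \<ge> decay ^ n * 1"
        using decay_bounds by (intro mult_left_mono) auto
      with step show ?case by (simp add: algebra_simps)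
    qed simp
  qed
  also have "\<dots> \<le> 8 * decay ^ s" using decay_bounds by simp
  finally show ?thesis .
qed

lemma ex_power_of_two_interval:
  assumes "q \<ge> (1::nat)"
  shows "\<exists>j. 2 ^ j \<le> q \<and> q < 2 * 2 ^ j"
  using ex_power_ivl1[of 2 q] assms by auto

lemma ram_max_mono:
  assumes "finite K'" "K \<subseteq> K'"
  shows "ram_max D K f x \<le> ram_max D K' f x"
  using assms
  by (intro ram_max_le ram_max_nonneg ram_avg_le_ram_max) (auto intro: finite_subset)

text \<open>
  The bound for the contribution of \<open>q = \<Prod>D\<close> to the sieve majorant: the factor \<open>8^\<omega>(q) / q\<close>
  collects \<open>4^\<omega>(q)\<close> from the coefficients and \<open>1 / \<phi>(q) \<le> 2^\<omega>(q) / q\<close>. The modulus enters only at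
  scales at which \<open>q\<close> is at most the tenth root of the length.
\<close>

definition high_term :: "nat set \<Rightarrow> nat set \<Rightarrow> (int \<Rightarrow> real) \<Rightarrow> int \<Rightarrow> real" where
  "high_term K D f x = 8 ^ card D / real (\<Prod>D) * ram_max D {k\<in>K. (\<Prod>D) ^ 10 \<le> 2 ^ k} f x"

lemma high_term_nonneg: "finite K \<Longrightarrow> high_term K D f x \<ge> 0"
  by (simp add: high_term_def ram_max_nonneg prod_nonneg)

text \<open>
  For \<open>q\<close> of size \<open>2^j\<close> with all prime factors above \<open>2^s\<close> there are at most \<open>j / s\<close> of these, so that
  the factors \<open>C^\<omega>(q)\<close> are tiny powers of \<open>2^j\<close> and cannot spoil the gain \<open>2^(-j) \<surd>(2^j)\<close> of the
  block. No \<open>q\<close> below \<open>2^s\<close> occurs.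
\<close>

lemma l2_bounded_high_frequencies:
  fixes f :: "int \<Rightarrow> real"
  assumes s: "s \<ge> 100" and I: "finite I" "\<And>D. D \<in> I \<Longrightarrow> prime_set D" "\<And>D. D \<in> I \<Longrightarrow> D \<noteq> {}"
      "\<And>D p. D \<in> I \<Longrightarrow> p \<in> D \<Longrightarrow> p > 2 ^ s"
    and K: "finite K" and S: "finite S" "\<And>x. x \<notin> S \<Longrightarrow> f x = 0"
  shows "l2_bounded (\<lambda>x. \<Sum>D\<in>I. high_term K D f x)
    (136 * decay ^ s * L2_set f S)"
proof -
  define B where "B = L2_set f S"
  have B0: "B \<ge> 0" by (simp add: B_def)
  have "\<exists>j. 2 ^ j \<le> \<Prod>D \<and> \<Prod>D < 2 * 2 ^ j" if "D \<in> I" for D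
    using prod_prime_set_pos[OF I(2)[OF that]] by (intro ex_power_of_two_interval) simp
  then obtain lg where lg: "\<And>D. D \<in> I \<Longrightarrow> 2 ^ lg D \<le> \<Prod>D" "\<And>D. D \<in> I \<Longrightarrow> \<Prod>D < 2 * 2 ^ lg D"
    by metis
  define F where "F D x = high_term K D f x" for D x
  have F0: "F D x \<ge> 0" for D x using K by (simp add: F_def high_term_nonneg)
  have lgs: "lg D \<ge> s" "s * card D \<le> lg D" if D: "D \<in> I" for D
  proof -
    have finD: "finite D" using I(2)[OF D] by (simp add: prime_set_def)
    have "(\<Prod>p\<in>D. 2 ^ s) \<le> \<Prod>D" using I(4)[OF D] by (intro prod_mono) (auto intro: less_imp_le)
    then have "2 ^ (s * card D) \<le> \<Prod>D" by (simp add: power_mult)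
    with lg(2)[OF D] have "(2::nat) ^ (s * card D) < 2 ^ Suc (lg D)" by simp
    then show le: "s * card D \<le> lg D" by (simp only: power_strict_increasing_iff less_Suc_eq_le)
    have "card D \<ge> 1" using I(3)[OF D] finD by (simp add: card_gt_0_iff Suc_le_eq)
    then have "s * 1 \<le> s * card D" by (rule mult_le_mono2)
    with le show "lg D \<ge> s" by linarith
  qed
  have block: "l2_bounded (\<lambda>x. \<Sum>D\<in>{D\<in>I. lg D = j}. F D x) (17 * decay ^ j * B)" if j: "j \<in> lg ` I" for j
  proof -
    have js: "j \<ge> s" using j lgs by auto
    (* Every prime factor exceeds 2^s, so w bounds the number of prime factors in this block. *)
    define w where "w = j div s"
    define K' where "K' = {k\<in>K. k \<ge> 10 * j}"
    have cardD: "card D \<le> w" if "D \<in> {D\<in>I. lg D = j}" for D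
      using lgs(2)[of D] that s by (auto simp: w_def less_eq_div_iff_mult_less_eq mult.commute)
    have bm: "l2_bounded (\<lambda>x. \<Sum>D\<in>{D\<in>I. lg D = j}. ram_max D K' f x) (17 * 4 ^ w * sqrt (2 ^ j) * B)"
      unfolding B_def
    proof (rule l2_bounded_block_max)
      show "finite S" "\<And>x. x \<notin> S \<Longrightarrow> f x = 0" using S by auto
    qed (use I lg cardD js s K in \<open>auto simp: K'_def\<close>)
    have "l2_bounded (\<lambda>x. 8 ^ w / 2 ^ j * (\<Sum>D\<in>{D\<in>I. lg D = j}. ram_max D K' f x))
       (\<bar>8 ^ w / 2 ^ j\<bar> * (17 * 4 ^ w * sqrt (2 ^ j) * B))"
      by (rule l2_bounded_cmult[OF bm])
    then have "l2_bounded (\<lambda>x. \<Sum>D\<in>{D\<in>I. lg D = j}. F D x) (\<bar>8 ^ w / 2 ^ j\<bar> * (17 * 4 ^ w * sqrt (2 ^ j) * B))"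
    proof (rule l2_bounded_mono)
      fix x
      have "(\<Sum>D\<in>{D\<in>I. lg D = j}. F D x) \<le> (\<Sum>D\<in>{D\<in>I. lg D = j}. 8 ^ w / 2 ^ j * ram_max D K' f x)"
      proof (rule sum_mono)
        fix D assume D: "D \<in> {D\<in>I. lg D = j}"
        have q: "2 ^ j \<le> \<Prod>D" using lg(1) D by auto
        then have qr: "2 ^ j \<le> real (\<Prod>D)" by (metis of_nat_le_iff of_nat_numeral of_nat_power)
        have sub: "{k\<in>K. (\<Prod>D) ^ 10 \<le> 2 ^ k} \<subseteq> K'"
        proof
          fix k assume k: "k \<in> {k\<in>K. (\<Prod>D) ^ 10 \<le> 2 ^ k}"
          have "(2 ^ j) ^ 10 \<le> (\<Prod>D) ^ 10" using q by (intro power_mono) auto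
          also have "\<dots> \<le> 2 ^ k" using k by simp
          finally have "(2::nat) ^ (10 * j) \<le> 2 ^ k" by (simp add: mult.commute flip: power_mult)
          then show "k \<in> K'" using k by (simp add: K'_def)
        qed
        have "finite K'" using K by (simp add: K'_def)
        then show "F D x \<le> 8 ^ w / 2 ^ j * ram_max D K' f x"
          unfolding F_def high_term_def using cardD[OF D] qr sub K
          by (intro mult_mono frac_le power_increasing ram_max_mono ram_max_nonneg) (auto simp del: of_nat_prod)
      qed
      also have "\<dots> = 8 ^ w / 2 ^ j * (\<Sum>D\<in>{D\<in>I. lg D = j}. ram_max D K' f x)"
        by (rule sum_distrib_left[symmetric])
      finally show "\<bar>\<Sum>D\<in>{D\<in>I. lg D = j}. F D x\<bar> \<le> \<bar>8 ^ w / 2 ^ j * (\<Sum>D\<in>{D\<in>I. lg D = j}. ram_max D K' f x)\<bar>"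
        using F0 by (simp only: abs_of_nonneg[OF sum_nonneg])
    qed
    moreover have "\<bar>8 ^ w / 2 ^ j\<bar> * (17 * 4 ^ w * sqrt (2 ^ j) * B) \<le> 17 * decay ^ j * B"
    proof -
      have "w * s \<le> j" by (simp add: w_def)
      moreover have "w * 100 \<le> w * s" using s by (rule mult_le_mono2)
      ultimately have "100 * w \<le> j" by linarith
      then have w: "5 * real w \<le> real j / 20" by simp
      have "8 ^ w * 4 ^ w * sqrt (2 ^ j) / 2 ^ j = 2 powr (5 * real w) * 2 powr (real j / 2) / 2 powr (real j)"
      proof -
        have "(8::real) ^ w * 4 ^ w = 32 ^ w" by (simp flip: power_mult_distrib)
        also have "\<dots> = (2 ^ 5) ^ w" by simp
        also have "\<dots> = 2 ^ (5 * w)" by (rule power_mult[symmetric])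
        also have "\<dots> = 2 powr (real (5 * w))" by (rule powr_realpow[symmetric]) simp
        finally have "(8::real) ^ w * 4 ^ w = 2 powr (5 * real w)" by simp
        moreover have "sqrt (2 ^ j) = 2 powr (real j / 2)"
          by (simp add: powr_half_sqrt[symmetric] powr_realpow[symmetric] powr_powr)
        ultimately show ?thesis by (simp add: powr_realpow)
      qed
      also have "\<dots> = 2 powr (5 * real w + real j / 2 - real j)" by (simp only: powr_add powr_diff)
      also have "\<dots> \<le> 2 powr (- real j / 4)" using w by (intro powr_mono) auto
      also have "\<dots> = decay ^ j" by (rule decay_power[symmetric])
      finally have "17 * (8 ^ w * 4 ^ w * sqrt (2 ^ j) / 2 ^ j) * B \<le> 17 * decay ^ j * B"
        using B0 by (intro mult_right_mono mult_left_mono) auto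
      then show ?thesis by (simp add: mult_ac)
    qed
    ultimately show ?thesis by (rule l2_bounded_le)
  qed
  have "l2_bounded (\<lambda>x. \<Sum>j\<in>lg ` I. \<Sum>D\<in>{D\<in>I. lg D = j}. F D x) (\<Sum>j\<in>lg ` I. 17 * decay ^ j * B)"
    by (intro l2_bounded_sum block) (use I in auto)
  moreover have "(\<Sum>j\<in>lg ` I. \<Sum>D\<in>{D\<in>I. lg D = j}. F D x) = (\<Sum>D\<in>I. F D x)" for x
    by (rule sum.image_gen[symmetric, OF I(1)])
  moreover have "(\<Sum>j\<in>lg ` I. 17 * decay ^ j * B) \<le> 136 * decay ^ s * B"
  proof -
    have "(\<Sum>j\<in>lg ` I. 17 * decay ^ j * B) = 17 * (\<Sum>j\<in>lg ` I. decay ^ j) * B"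
      by (simp add: sum_distrib_left sum_distrib_right)
    also have "\<dots> \<le> 17 * (8 * decay ^ s) * B"
      using B0 I lgs by (intro mult_right_mono mult_left_mono sum_decay_power_le) auto
    finally show ?thesis by simp
  qed
  ultimately show ?thesis unfolding F_def B_def by (simp add: l2_bounded_le)
qed

section \<open>Selberg's sieve in Ramanujan sums\<close>

text \<open>
  Euler's function at the squarefree number \<open>\<Prod>A\<close>, as a real number.
\<close>

definition tot :: "nat set \<Rightarrow> real" where
  "tot A = (\<Prod>p\<in>A. real p - 1)"

text \<open>
  The function \<open>\<mu>(q) c_q(n) / \<phi>(q)\<close> for \<open>q = \<Prod>A\<close>. Its value is \<open>1 / \<phi>(q)\<close> whenever \<open>n\<close> is coprime to \<open>q\<close>, which is
  why Selberg's optimal weights have a simple form in terms of it.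
\<close>

definition sieve_fun :: "nat set \<Rightarrow> int \<Rightarrow> real" where
  "sieve_fun A n = (\<Prod>p\<in>A. - rho p n / (real p - 1))"

lemma tot_pos:
  assumes "prime_set A"
  shows "tot A > 0"
  unfolding tot_def using assms by (intro prod_pos) (auto simp: prime_set_def prime_gt_Suc_0_nat)

lemma sieve_fun_eq:
  assumes "prime_set A"
  shows "sieve_fun A n = (-1) ^ card A * ramanujan A n / tot A"
proof -
  have "sieve_fun A n = (\<Prod>p\<in>A. (-1) * (rho p n / (real p - 1)))"
    unfolding sieve_fun_def by (intro prod.cong refl) simp
  also have "\<dots> = (-1) ^ card A * ramanujan A n / tot A"
    by (simp only: prod.distrib prod_dividef ramanujan_def tot_def prod_constant times_divide_eq_right)
  finally show ?thesis .
qed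

lemma tot_ge:
  assumes "prime_set A"
  shows "1 / tot A \<le> 2 ^ card A / real (\<Prod>A)"
proof -
  have "1 / tot A = (\<Prod>p\<in>A. 1 / (real p - 1))" by (simp add: tot_def prod_dividef)
  also have "\<dots> \<le> (\<Prod>p\<in>A. 2 / real p)"
  proof (rule prod_mono)
    fix p assume "p \<in> A"
    then have "p \<ge> 2" using assms prime_ge_2_nat by (auto simp: prime_set_def)
    then show "0 \<le> 1 / (real p - 1) \<and> 1 / (real p - 1) \<le> 2 / real p" by (simp add: field_simps)
  qed
  also have "\<dots> = 2 ^ card A / real (\<Prod>A)" by (simp add: prod_dividef)
  finally show ?thesis .
qed

text \<open>
  The local factor \<open>e\<close> at a prime takes only the two values \<open>-1\<close> and \<open>1 / (p - 1)\<close>, so its square is an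
  affine function of \<open>e\<close>. Primes in just one of \<open>A\<close> and \<open>B\<close> stay, and those in both either stay (\<open>H\<close>) or
  drop out.
\<close>

lemma sieve_fun_mult:
  assumes A: "prime_set A" and B: "prime_set B"
  shows "sieve_fun A n * sieve_fun B n
    = (\<Sum>H\<in>Pow (A \<inter> B). (\<Prod>p\<in>H. - (real p - 2) / (real p - 1)) / tot (A \<inter> B - H)
        * sieve_fun ((A - B) \<union> (B - A) \<union> H) n)"
proof -
  have fin: "finite A" "finite B" using A B by (auto simp: prime_set_def)
  define e where "e p = - rho p n / (real p - 1)" for p
  have e2: "e p * e p = (- (real p - 2) / (real p - 1)) * e p + 1 / (real p - 1)" if "p \<in> A \<inter> B" for p
  proof -
    have "real p - 1 > 0" using that A by (auto simp: prime_set_def prime_gt_Suc_0_nat)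
    then show ?thesis by (auto simp: e_def rho_def divide_simps) (auto simp: algebra_simps)
  qed
  have "sieve_fun A n = (\<Prod>p\<in>A - B. e p) * (\<Prod>p\<in>A \<inter> B. e p)"
    unfolding sieve_fun_def e_def[symmetric]
    using fin by (subst prod.union_disjoint[symmetric]) (auto simp: Un_commute Int_Diff_Un intro!: prod.cong)
  moreover have "sieve_fun B n = (\<Prod>p\<in>B - A. e p) * (\<Prod>p\<in>A \<inter> B. e p)"
    unfolding sieve_fun_def e_def[symmetric]
    using fin by (subst prod.union_disjoint[symmetric]) (auto simp: Un_commute Int_Diff_Un intro!: prod.cong)
  ultimately have "sieve_fun A n * sieve_fun B n = (\<Prod>p\<in>A - B. e p) * (\<Prod>p\<in>B - A. e p) * (\<Prod>p\<in>A \<inter> B. e p * e p)"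
    by (simp add: prod.distrib mult_ac)
  also have "(\<Prod>p\<in>A \<inter> B. e p * e p) = (\<Prod>p\<in>A \<inter> B. (- (real p - 2) / (real p - 1)) * e p + 1 / (real p - 1))"
    by (intro prod.cong refl e2)
  also have "\<dots> = (\<Sum>H\<in>Pow (A \<inter> B). (\<Prod>p\<in>H. (- (real p - 2) / (real p - 1)) * e p) * (\<Prod>p\<in>A \<inter> B - H. 1 / (real p - 1)))"
    by (rule prod_add) (use fin in auto)
  also have "(\<Prod>p\<in>A - B. e p) * (\<Prod>p\<in>B - A. e p) * \<dots>
    = (\<Sum>H\<in>Pow (A \<inter> B). (\<Prod>p\<in>H. - (real p - 2) / (real p - 1)) / tot (A \<inter> B - H)
        * sieve_fun ((A - B) \<union> (B - A) \<union> H) n)"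
    unfolding sum_distrib_left
  proof (rule sum.cong[OF refl])
    fix H assume H: "H \<in> Pow (A \<inter> B)"
    then have finH: "finite H" using fin by (auto intro: finite_subset)
    have "sieve_fun ((A - B) \<union> (B - A) \<union> H) n = (\<Prod>p\<in>(A - B) \<union> (B - A). e p) * (\<Prod>p\<in>H. e p)"
      unfolding sieve_fun_def e_def[symmetric] using fin finH H by (intro prod.union_disjoint) auto
    also have "(\<Prod>p\<in>(A - B) \<union> (B - A). e p) = (\<Prod>p\<in>A - B. e p) * (\<Prod>p\<in>B - A. e p)"
      using fin by (intro prod.union_disjoint) auto
    finally show "(\<Prod>p\<in>A - B. e p) * (\<Prod>p\<in>B - A. e p) * ((\<Prod>p\<in>H. (- (real p - 2) / (real p - 1)) * e p) * (\<Prod>p\<in>A \<inter> B - H. 1 / (real p - 1)))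
      = (\<Prod>p\<in>H. - (real p - 2) / (real p - 1)) / tot (A \<inter> B - H) * sieve_fun ((A - B) \<union> (B - A) \<union> H) n"
      by (simp add: prod.distrib tot_def prod_dividef mult_ac)
  qed
  finally show ?thesis .
qed

text \<open>
  A product of \<open>sieve_fun A\<close> and \<open>sieve_fun B\<close> contributes to \<open>D\<close> through \<open>A - B\<close>, \<open>B - A\<close> and the part \<open>H\<close> of
  \<open>A \<inter> B\<close> that stays; these three sets partition \<open>D\<close>, which leaves at most \<open>4^\<omega>(D)\<close> choices. The part
  of \<open>A \<inter> B\<close> that drops out is again a member of the family, and summing \<open>1 / \<phi>\<close> over it costs at most
  \<open>G\<close>. The empty \<open>D\<close> comes from \<open>A = B\<close> with nothing staying.
\<close>

lemma sieve_square_expansion: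
  assumes fin: "finite \<A>" and prm: "\<And>A. A \<in> \<A> \<Longrightarrow> prime_set A"
    and down: "\<And>A B. A \<in> \<A> \<Longrightarrow> B \<subseteq> A \<Longrightarrow> B \<in> \<A>"
  defines "G \<equiv> \<Sum>A\<in>\<A>. 1 / tot A"
  shows "\<exists>W \<D>. finite \<D> \<and> (\<forall>D\<in>\<D>. \<exists>A\<in>\<A>. \<exists>B\<in>\<A>. D \<subseteq> A \<union> B)
     \<and> (\<forall>n. (\<Sum>A\<in>\<A>. sieve_fun A n)\<^sup>2 = (\<Sum>D\<in>\<D>. W D * sieve_fun D n))
     \<and> W {} = G \<and> (\<forall>D\<in>\<D>. \<bar>W D\<bar> \<le> 4 ^ card D * G)"
proof -
  define Tr where "Tr = (SIGMA AB:\<A> \<times> \<A>. Pow (fst AB \<inter> snd AB))"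
  define dm where "dm t = (case t of ((A, B), H) \<Rightarrow> (A - B) \<union> (B - A) \<union> H)" for t :: "(nat set \<times> nat set) \<times> nat set"
  define cf where "cf t = (case t of ((A, B), H) \<Rightarrow> (\<Prod>p\<in>H. - (real p - 2) / (real p - 1)) / tot (A \<inter> B - H))"
    for t :: "(nat set \<times> nat set) \<times> nat set"
  define W where "W D = (\<Sum>t | t \<in> Tr \<and> dm t = D. cf t)" for D
  have finA: "finite A" if "A \<in> \<A>" for A using prm[OF that] by (simp add: prime_set_def)
  have finTr: "finite Tr" unfolding Tr_def using fin finA by (intro finite_SigmaI) auto
  have G0: "G \<ge> 0" unfolding G_def by (intro sum_nonneg) (use tot_pos prm in force)
  have sq: "(\<Sum>A\<in>\<A>. sieve_fun A n)\<^sup>2 = (\<Sum>D\<in>dm ` Tr. W D * sieve_fun D n)" for n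
  proof -
    have "(\<Sum>A\<in>\<A>. sieve_fun A n)\<^sup>2 = (\<Sum>AB\<in>\<A> \<times> \<A>. sieve_fun (fst AB) n * sieve_fun (snd AB) n)"
      by (simp add: power2_eq_square sum_product sum.cartesian_product case_prod_beta)
    also have "\<dots> = (\<Sum>AB\<in>\<A> \<times> \<A>. \<Sum>H\<in>Pow (fst AB \<inter> snd AB). cf (AB, H) * sieve_fun (dm (AB, H)) n)"
      by (intro sum.cong refl) (auto simp: sieve_fun_mult prm cf_def dm_def)
    also have "\<dots> = (\<Sum>t\<in>Tr. cf t * sieve_fun (dm t) n)"
      unfolding Tr_def using fin finA by (subst sum.Sigma) auto
    also have "\<dots> = (\<Sum>D\<in>dm ` Tr. \<Sum>t | t \<in> Tr \<and> dm t = D. cf t * sieve_fun (dm t) n)"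
      by (rule sum.image_gen[OF finTr])
    also have "\<dots> = (\<Sum>D\<in>dm ` Tr. W D * sieve_fun D n)"
      unfolding W_def sum_distrib_right by (intro sum.cong refl) auto
    finally show ?thesis .
  qed
  have W0: "W {} = G"
  proof -
    have "{t. t \<in> Tr \<and> dm t = {}} = (\<lambda>A. ((A, A), {})) ` \<A>"
      by (auto simp: Tr_def dm_def)
    then have "W {} = (\<Sum>t\<in>(\<lambda>A. ((A, A), {})) ` \<A>. cf t)" by (simp add: W_def)
    also have "\<dots> = (\<Sum>A\<in>\<A>. cf ((A, A), {}))" by (subst sum.reindex) (auto simp: inj_on_def)
    also have "\<dots> = G" by (simp add: G_def cf_def)
    finally show ?thesis .
  qed
  have Wb: "\<bar>W D\<bar> \<le> 4 ^ card D * G" if D: "D \<in> dm ` Tr" for D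
  proof -
    have finD: "finite D" using D finA by (auto simp: dm_def Tr_def intro: finite_subset)
    (* For fixed D the triple is determined by A - B, B - A and the part of the intersection
       that drops out. *)
    define \<psi> where "\<psi> t = (case t of ((A, B), H) \<Rightarrow> ((A - B, B - A), A \<inter> B - H))" for t :: "(nat set \<times> nat set) \<times> nat set"
    have inj: "inj_on \<psi> {t. t \<in> Tr \<and> dm t = D}"
    proof (rule inj_onI)
      fix t t' assume t: "t \<in> {t. t \<in> Tr \<and> dm t = D}" "t' \<in> {t. t \<in> Tr \<and> dm t = D}" "\<psi> t = \<psi> t'"
      obtain A B H A' B' H' where e: "t = ((A, B), H)" "t' = ((A', B'), H')" by (metis prod.collapse)
      have H: "H \<subseteq> A \<inter> B" "H' \<subseteq> A' \<inter> B'" and d: "(A - B) \<union> (B - A) \<union> H = D" "(A' - B') \<union> (B' - A') \<union> H' = D"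
        and ps: "A - B = A' - B'" "B - A = B' - A'" "A \<inter> B - H = A' \<inter> B' - H'"
        using t by (auto simp: e Tr_def dm_def \<psi>_def)
      have "H = D - (A - B) - (B - A)" "H' = D - (A' - B') - (B' - A')" using H d by blast+
      then have HH: "H = H'" using ps by simp
      have "A = (A - B) \<union> (A \<inter> B - H) \<union> H" "A' = (A' - B') \<union> (A' \<inter> B' - H') \<union> H'"
           "B = (B - A) \<union> (A \<inter> B - H) \<union> H" "B' = (B' - A') \<union> (A' \<inter> B' - H') \<union> H'" using H by blast+
      then show "t = t'" using ps HH e by metis
    qed
    have "\<bar>W D\<bar> \<le> (\<Sum>t | t \<in> Tr \<and> dm t = D. \<bar>cf t\<bar>)" unfolding W_def by (rule sum_abs)
    also have "\<dots> \<le> (\<Sum>t | t \<in> Tr \<and> dm t = D. 1 / tot (snd (\<psi> t)))"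
    proof (rule sum_mono)
      fix t assume t: "t \<in> {t. t \<in> Tr \<and> dm t = D}"
      obtain A B H where e: "t = ((A, B), H)" by (metis prod.collapse)
      have AB: "A \<in> \<A>" "B \<in> \<A>" "H \<subseteq> A \<inter> B" using t by (auto simp: e Tr_def)
      have pos: "tot (A \<inter> B - H) > 0" by (intro tot_pos prime_set_subset[OF prm[OF AB(1)]]) auto
      have "\<bar>\<Prod>p\<in>H. - (real p - 2) / (real p - 1)\<bar> = (\<Prod>p\<in>H. \<bar>- (real p - 2) / (real p - 1)\<bar>)" by (rule abs_prod)
      also have "\<dots> \<le> (\<Prod>p\<in>H. 1)"
      proof (rule prod_mono)
        fix p assume "p \<in> H"
        then have "p \<ge> 2" using AB prm[OF AB(1)] by (auto simp: prime_set_def prime_ge_2_nat)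
        then show "0 \<le> \<bar>- (real p - 2) / (real p - 1)\<bar> \<and> \<bar>- (real p - 2) / (real p - 1)\<bar> \<le> 1"
          by (auto simp: abs_divide field_simps)
      qed
      finally have "\<bar>\<Prod>p\<in>H. - (real p - 2) / (real p - 1)\<bar> \<le> 1" by simp
      then show "\<bar>cf t\<bar> \<le> 1 / tot (snd (\<psi> t))"
        using pos by (simp add: e cf_def \<psi>_def abs_divide divide_right_mono)
    qed
    also have "\<dots> = (\<Sum>u\<in>\<psi> ` {t. t \<in> Tr \<and> dm t = D}. 1 / tot (snd u))"
      by (simp add: sum.reindex[OF inj])
    also have "\<dots> \<le> (\<Sum>u\<in>(Pow D \<times> Pow D) \<times> \<A>. 1 / tot (snd u))"
    proof (rule sum_mono2)
      show "finite ((Pow D \<times> Pow D) \<times> \<A>)" using finD fin by simp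
      show "\<psi> ` {t. t \<in> Tr \<and> dm t = D} \<subseteq> (Pow D \<times> Pow D) \<times> \<A>"
        by (auto simp: \<psi>_def Tr_def dm_def intro: down)
      show "0 \<le> 1 / tot (snd u)" if "u \<in> (Pow D \<times> Pow D) \<times> \<A> - \<psi> ` {t. t \<in> Tr \<and> dm t = D}" for u
        using that tot_pos[OF prm] by (auto intro: less_imp_le)
    qed
    also have "\<dots> = (\<Sum>u\<in>Pow D \<times> Pow D. G)"
      using sum.cartesian_product[of "\<lambda>_ A. 1 / tot A" \<A> "Pow D \<times> Pow D"]
      by (simp add: G_def case_prod_beta)
    also have "\<dots> = 4 ^ card D * G"
      using finD by (simp add: card_cartesian_product card_Pow flip: power_mult_distrib)
    finally show ?thesis .
  qed
  have sub: "\<exists>A\<in>\<A>. \<exists>B\<in>\<A>. D \<subseteq> A \<union> B" if "D \<in> dm ` Tr" for D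
  proof -
    from that obtain t where t: "t \<in> Tr" "D = dm t" by auto
    obtain A B H where e: "t = ((A, B), H)" by (metis prod.collapse)
    show ?thesis by (intro bexI[of _ A] bexI[of _ B]) (use t in \<open>auto simp: e Tr_def dm_def\<close>)
  qed
  show ?thesis
    by (intro exI[of _ W] exI[of _ "dm ` Tr"] conjI) (use finTr sub sq W0 Wb in auto)
qed

text \<open>
  The finite form of the Euler product.
\<close>

lemma sum_inverse_smooth_le:
  assumes "prime_set P" "finite T" "\<And>n. n \<in> T \<Longrightarrow> n > 0"
    and "\<And>n p. n \<in> T \<Longrightarrow> prime p \<Longrightarrow> p dvd n \<Longrightarrow> p \<in> P"
  shows "(\<Sum>n\<in>T. 1 / real n) \<le> (\<Prod>p\<in>P. 1 / (1 - 1 / real p))"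
proof -
  have "finite P" using assms(1) by (simp add: prime_set_def)
  then show ?thesis using assms
  proof (induction P arbitrary: T rule: finite_induct)
    case empty
    have "n = 1" if "n \<in> T" for n
    proof (rule ccontr)
      assume "n \<noteq> 1"
      then obtain p where "prime p" "p dvd n" using prime_factor_nat by blast
      then show False using empty.prems(4)[OF that] by simp
    qed
    then have "T \<subseteq> {1}" by auto
    then have "(\<Sum>n\<in>T. 1 / real n) \<le> (\<Sum>n\<in>{1}. 1 / real n)" by (intro sum_mono2) auto
    then show ?case by simp
  next
    case (insert p P)
    have p: "prime p" "prime_set P" using insert.prems(1) by (auto simp: prime_set_def)
    then have p2: "p \<ge> 2" by (simp add: prime_ge_2_nat)
    define T' where "T' = (\<lambda>n. n div p ^ multiplicity p n) ` T"
    define J where "J = Suc (Max (insert 0 (multiplicity p ` T)))"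
    have decomp: "n = p ^ multiplicity p n * (n div p ^ multiplicity p n)" for n
      by (simp add: multiplicity_dvd)
    have sub: "T \<subseteq> (\<lambda>(j, m). p ^ j * m) ` ({..<J} \<times> T')"
    proof
      fix n assume n: "n \<in> T"
      have "multiplicity p n < J" unfolding J_def less_Suc_eq_le using n insert.prems(2) by (intro Max_ge) auto
      then show "n \<in> (\<lambda>(j, m). p ^ j * m) ` ({..<J} \<times> T')"
        using n decomp[of n] by (intro image_eqI[of _ _ "(multiplicity p n, n div p ^ multiplicity p n)"]) (auto simp: T'_def)
    qed
    have finT': "finite T'" using insert.prems(2) by (simp add: T'_def)
    have IH: "(\<Sum>n\<in>T'. 1 / real n) \<le> (\<Prod>p\<in>P. 1 / (1 - 1 / real p))"
    proof (rule insert.IH[OF p(2) finT'])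
      fix m assume "m \<in> T'"
      then obtain n where n: "n \<in> T" "m = n div p ^ multiplicity p n" by (auto simp: T'_def)
      have "n > 0" using insert.prems(3) n by simp
      have nm: "n = p ^ multiplicity p n * m" using decomp[of n] n(2) by simp
      then show "m > 0" using \<open>n > 0\<close> by (cases m) auto
      fix r assume r: "prime r" "r dvd m"
      then have "r dvd n" using nm by (metis dvd_mult)
      then have "r \<in> insert p P" using insert.prems(4)[OF n(1) r(1)] by simp
      moreover have "r \<noteq> p"
      proof
        assume "r = p"
        then have "p ^ Suc (multiplicity p n) dvd n" using r(2) nm
          by (metis dvd_refl mult.commute mult_dvd_mono power_Suc)
        moreover have "\<not> p ^ Suc (multiplicity p n) dvd n"
          using \<open>n > 0\<close> p2 by (simp add: power_dvd_iff_le_multiplicity del: power_Suc)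
        ultimately show False by simp
      qed
      ultimately show "r \<in> P" by simp
    qed
    have "(\<Sum>n\<in>T. 1 / real n) \<le> (\<Sum>n\<in>(\<lambda>(j, m). p ^ j * m) ` ({..<J} \<times> T'). 1 / real n)"
      using sub finT' by (intro sum_mono2) auto
    also have "\<dots> \<le> (\<Sum>z\<in>{..<J} \<times> T'. 1 / real ((\<lambda>(j, m). p ^ j * m) z))"
      using finT' by (intro sum_image_le[where g = "\<lambda>n. 1 / real n", unfolded comp_def]) auto
    also have "\<dots> = (\<Sum>j<J. \<Sum>m\<in>T'. (1 / real p) ^ j * (1 / real m))"
      by (simp add: sum.cartesian_product case_prod_beta power_one_over field_simps)
    also have "\<dots> = (\<Sum>j<J. (1 / real p) ^ j) * (\<Sum>m\<in>T'. 1 / real m)"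
      by (rule sum_product[symmetric])
    also have "\<dots> \<le> (1 / (1 - 1 / real p)) * (\<Prod>p\<in>P. 1 / (1 - 1 / real p))"
    proof (rule mult_mono[OF _ IH])
      have "(\<Sum>j<J. (1 / real p) ^ j) = (1 - (1 / real p) ^ J) / (1 - 1 / real p)"
        using p2 by (subst geometric_sum) (auto simp: field_simps)
      also have "\<dots> \<le> 1 / (1 - 1 / real p)" using p2 by (intro divide_right_mono) auto
      finally show "(\<Sum>j<J. (1 / real p) ^ j) \<le> 1 / (1 - 1 / real p)" .
    qed (use p2 in \<open>auto intro: sum_nonneg\<close>)
    also have "\<dots> = (\<Prod>p\<in>insert p P. 1 / (1 - 1 / real p))" using insert.hyps by simp
    finally show ?case .
  qed
qed

section \<open>Domination of the von Mangoldt averages\<close>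

definition sieve_primes :: "nat \<Rightarrow> nat \<Rightarrow> nat set" where
  "sieve_primes s r = {p. prime p \<and> 2 ^ s < p \<and> p \<le> 2 ^ r}"

definition sieve_level :: "nat \<Rightarrow> nat \<Rightarrow> nat set set" where
  "sieve_level s r = {A. A \<subseteq> sieve_primes s r \<and> \<Prod>A \<le> 2 ^ r}"

lemma finite_sieve_primes [simp]: "finite (sieve_primes s r)"
  by (rule finite_subset[of _ "{..2 ^ r}"]) (auto simp: sieve_primes_def)

lemma prime_set_sieve_primes: "A \<subseteq> sieve_primes s r \<Longrightarrow> prime_set A"
  using finite_subset[OF _ finite_sieve_primes[of s r], of A]
  by (auto simp: prime_set_def sieve_primes_def)

lemma finite_sieve_level [simp]: "finite (sieve_level s r)"
  by (rule finite_subset[of _ "Pow (sieve_primes s r)"]) (auto simp: sieve_level_def)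

lemma prod_prime_set_mono:
  assumes "prime_set A" "B \<subseteq> A"
  shows "\<Prod>B \<le> \<Prod>A"
proof -
  have "\<Prod>B dvd \<Prod>A" using assms by (intro prod_dvd_prod_subset) (auto simp: prime_set_def)
  then show ?thesis using prod_prime_set_pos[OF assms(1)] by (intro dvd_imp_le)
qed

lemma sieve_level_down: "A \<in> sieve_level s r \<Longrightarrow> B \<subseteq> A \<Longrightarrow> B \<in> sieve_level s r"
  using prod_prime_set_mono[of A B] prime_set_sieve_primes[of A s r]
  by (auto simp: sieve_level_def)

text \<open>
  Group the integers up to \<open>2^r\<close> by the set of their prime factors in \<open>(2^s, 2^r]\<close>. Each group is bounded
  by an Euler product, and Mertens' bound for the primes up to \<open>2^s\<close> turns the harmonic sum into a
  lower bound for the sieve density.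
\<close>

lemma sieve_density:
  assumes s: "s \<ge> 1"
  shows "real r * ln 2 \<le> exp 21 * real s * (\<Sum>A\<in>sieve_level s r. 1 / tot A)"
proof -
  define R where "R = (2::nat) ^ r"
  define P where "P = sieve_primes s r"
  define P0 where "P0 = primes_upto (2 ^ s)"
  define Eul where "Eul = (\<Prod>p\<in>P0. 1 / (1 - 1 / real p))"
  (* The sieving primes that divide n; their product divides n, so it respects the level. *)
  define ker where "ker n = {p\<in>P. p dvd n}" for n :: nat
  have prm: "prime_set A" if "A \<in> sieve_level s r" for A
    using that by (auto simp: sieve_level_def intro: prime_set_sieve_primes)
  have ker: "ker n \<in> sieve_level s r" "\<Prod>(ker n) dvd n" if n: "n \<in> {1..R}" for n
  proof -
    have ks: "ker n \<subseteq> sieve_primes s r" by (auto simp: ker_def P_def)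
    then have ps: "prime_set (ker n)" by (rule prime_set_sieve_primes)
    have "int (\<Prod>(ker n)) dvd int n" unfolding prod_prime_set_dvd_iff[OF ps] by (auto simp: ker_def)
    then show dv: "\<Prod>(ker n) dvd n" by (simp only: int_dvd_int_iff)
    then have "\<Prod>(ker n) \<le> n" using n by (intro dvd_imp_le) auto
    then show "ker n \<in> sieve_level s r" using ks n by (simp add: sieve_level_def R_def)
  qed
  have inner: "(\<Sum>n | n \<in> {1..R} \<and> ker n = A. 1 / real n) \<le> Eul * (1 / tot A)" if A: "A \<in> sieve_level s r" for A
  proof -
    define q where "q = \<Prod>A"
    have psA: "prime_set A" by (rule prm[OF A])
    have q: "q > 0" unfolding q_def by (rule prod_prime_set_pos[OF psA])
    define T where "T = (\<lambda>n. n div q) ` {n. n \<in> {1..R} \<and> ker n = A}"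
    have dv: "q dvd n" if "n \<in> {1..R}" "ker n = A" for n using ker(2)[OF that(1)] that(2) by (simp add: q_def)
    have inj: "inj_on (\<lambda>n. n div q) {n. n \<in> {1..R} \<and> ker n = A}"
    proof (rule inj_onI)
      fix m n assume "m \<in> {n. n \<in> {1..R} \<and> ker n = A}" "n \<in> {n. n \<in> {1..R} \<and> ker n = A}" "m div q = n div q"
      then have "q dvd m" "q dvd n" "m div q = n div q" using dv by auto
      then show "m = n" by (metis dvd_mult_div_cancel)
    qed
    have "(\<Sum>n | n \<in> {1..R} \<and> ker n = A. 1 / real n) = (\<Sum>n | n \<in> {1..R} \<and> ker n = A. 1 / real q * (1 / real (n div q)))"
      by (intro sum.cong refl) (use dv q in \<open>auto simp: real_of_nat_div\<close>)
    also have "\<dots> = 1 / real q * (\<Sum>m\<in>T. 1 / real m)"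
      unfolding T_def sum.reindex[OF inj] sum_distrib_left by (simp add: comp_def)
    also have "\<dots> \<le> 1 / real q * (\<Prod>p\<in>P0 \<union> A. 1 / (1 - 1 / real p))"
    proof (intro mult_left_mono sum_inverse_smooth_le)
      show "prime_set (P0 \<union> A)" using psA by (intro prime_set_Un) (auto simp: P0_def prime_set_def primes_upto_def)
      show "finite T" by (simp add: T_def)
      fix m assume "m \<in> T"
      then obtain n where n: "n \<in> {1..R}" "ker n = A" "m = n div q" by (auto simp: T_def)
      have nm: "n = q * m" using dv[OF n(1,2)] n(3) by simp
      then show "m > 0" using n(1) by (cases m) auto
      fix p assume p: "prime p" "p dvd m"
      then have pn: "p dvd n" using nm by simp
      then have "p \<le> R" using n(1) dvd_imp_le[of p n] by auto
      show "p \<in> P0 \<union> A"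
      proof (cases "p \<le> 2 ^ s")
        case True
        then show ?thesis using p by (simp add: P0_def primes_upto_def)
      next
        case False
        then have "p \<in> ker n" using p pn \<open>p \<le> R\<close> by (simp add: ker_def P_def sieve_primes_def R_def)
        then show ?thesis using n(2) by simp
      qed
    qed simp
    also have "(\<Prod>p\<in>P0 \<union> A. 1 / (1 - 1 / real p)) = Eul * (\<Prod>p\<in>A. 1 / (1 - 1 / real p))"
      unfolding Eul_def using A psA
      by (intro prod.union_disjoint) (auto simp: P0_def primes_upto_def sieve_level_def sieve_primes_def prime_set_def)
    also have "1 / real q * (Eul * (\<Prod>p\<in>A. 1 / (1 - 1 / real p))) = Eul * ((\<Prod>p\<in>A. 1 / real p) * (\<Prod>p\<in>A. 1 / (1 - 1 / real p)))"
      by (simp add: q_def prod_dividef mult_ac)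
    also have "(\<Prod>p\<in>A. 1 / real p) * (\<Prod>p\<in>A. 1 / (1 - 1 / real p)) = (\<Prod>p\<in>A. 1 / (real p - 1))"
      unfolding prod.distrib[symmetric]
    proof (rule prod.cong[OF refl])
      fix p assume "p \<in> A"
      then have "p \<ge> 2" using psA prime_ge_2_nat by (auto simp: prime_set_def)
      then show "1 / real p * (1 / (1 - 1 / real p)) = 1 / (real p - 1)" by (simp add: field_simps)
    qed
    also have "\<dots> = 1 / tot A" by (simp add: tot_def prod_dividef)
    finally show ?thesis .
  qed
  have "real r * ln 2 = ln (real R)" by (simp add: R_def ln_realpow)
  also have "\<dots> \<le> ln (real R + 1)" by (simp add: R_def add_pos_pos)
  also have "\<dots> \<le> harm R" by (rule ln_le_harm)
  also have "\<dots> = (\<Sum>n\<in>{1..R}. 1 / real n)" by (simp add: harm_def inverse_eq_divide)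
  also have "\<dots> = (\<Sum>A\<in>ker ` {1..R}. \<Sum>n | n \<in> {1..R} \<and> ker n = A. 1 / real n)"
    by (rule sum.image_gen) simp
  also have "\<dots> \<le> (\<Sum>A\<in>sieve_level s r. \<Sum>n | n \<in> {1..R} \<and> ker n = A. 1 / real n)"
    using ker by (intro sum_mono2) (auto intro!: sum_nonneg)
  also have "\<dots> \<le> (\<Sum>A\<in>sieve_level s r. Eul * (1 / tot A))" by (intro sum_mono inner)
  also have "\<dots> = Eul * (\<Sum>A\<in>sieve_level s r. 1 / tot A)" by (rule sum_distrib_left[symmetric])
  also have "\<dots> \<le> (exp 21 * real s) * (\<Sum>A\<in>sieve_level s r. 1 / tot A)"
    unfolding Eul_def P0_def
    by (intro mult_right_mono prod_primes_le s sum_nonneg) (use tot_pos[OF prm] in \<open>auto intro: less_imp_le\<close>)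
  finally show ?thesis .
qed

lemma sum_nat_eq_sum_int: "(\<Sum>n=1..N. g (int n)) = (\<Sum>n\<in>{1..int N}. g n)"
  by (rule sum.reindex_bij_witness[of _ nat int]) auto

text \<open>
  A power of a prime above \<open>2^r\<close> is coprime to all sieving primes, so there the sieve sum attains its
  maximal value \<open>G\<close>. Powers of smaller primes go into the first term.
\<close>

lemma mangoldt_le_sieve:
  fixes n k s r :: nat
  assumes n: "n \<in> {1..2 ^ k}"
  defines "G \<equiv> \<Sum>A\<in>sieve_level s r. 1 / tot A"
  shows "mangoldt n * G\<^sup>2 \<le> (if primepow n \<and> aprimedivisor n \<le> 2 ^ r then mangoldt n * G\<^sup>2 else 0)
     + real k * (\<Sum>A\<in>sieve_level s r. sieve_fun A (int n))\<^sup>2"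
proof (cases "primepow n \<and> aprimedivisor n > 2 ^ r")
  case True
  then obtain p j where p: "prime p" "j \<in> {1..k}" "n = p ^ j" "aprimedivisor n = p" "mangoldt n = ln (real p)"
    using primepow_aprimedivisor_decomp[of n k] n by auto
  have "sieve_fun A (int n) = 1 / tot A" if A: "A \<in> sieve_level s r" for A
  proof -
    have "- rho q (int n) / (real q - 1) = 1 / (real q - 1)" if "q \<in> A" for q
    proof -
      have q: "prime q" "q \<le> 2 ^ r" using that A by (auto simp: sieve_level_def sieve_primes_def)
      have "\<not> q dvd n"
      proof
        assume "q dvd n"
        then have "q dvd p" using p(3) q(1) prime_dvd_power by blast
        then have "q = p" using q p primes_dvd_imp_eq by blast
        then show False using q True p(4) by simp
      qed
      then show ?thesis by (simp add: rho_def)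
    qed
    then show ?thesis by (simp add: sieve_fun_def tot_def prod_dividef cong: prod.cong)
  qed
  then have S: "(\<Sum>A\<in>sieve_level s r. sieve_fun A (int n)) = G" by (simp add: G_def)
  have "mangoldt n \<le> ln (real n)" using n by (intro mangoldt_le) auto
  also have "\<dots> \<le> ln (2 ^ k)"
  proof -
    have "real n \<le> 2 ^ k" using n by (metis atLeastAtMost_iff of_nat_le_iff of_nat_numeral of_nat_power)
    then show ?thesis using n by (subst ln_le_cancel_iff) auto
  qed
  also have "\<dots> = real k * ln 2" by (simp add: ln_realpow)
  also have "\<dots> \<le> real k * 1" using ln_2_less_1 by (intro mult_left_mono) auto
  finally have "mangoldt n * G\<^sup>2 \<le> real k * G\<^sup>2" by (intro mult_right_mono) auto
  with True S show ?thesis by auto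
next
  case False
  then have "mangoldt n * G\<^sup>2 = (if primepow n \<and> aprimedivisor n \<le> 2 ^ r then mangoldt n * G\<^sup>2 else 0)"
    by (auto simp: mangoldt_def)
  then show ?thesis by simp
qed

text \<open>
  The term \<open>D = {}\<close> of the expansion gives the plain average; the others have \<open>\<Prod>D \<le> 2^(2r)\<close>, hence
  \<open>(\<Prod>D)^10 \<le> 2^k\<close>, and are bounded by their maximal functions.
\<close>

lemma sieve_square_avg_le:
  fixes f :: "int \<Rightarrow> real" and s r k M :: nat
  assumes "20 * r \<le> k" "k \<le> M" and f0: "\<And>x. f x \<ge> 0"
  defines "G \<equiv> \<Sum>A\<in>sieve_level s r. 1 / tot A"
    and "\<I> \<equiv> {D. D \<noteq> {} \<and> D \<subseteq> sieve_primes s M}"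
  shows "(\<Sum>n\<in>{1..int (2 ^ k)}. (\<Sum>A\<in>sieve_level s r. sieve_fun A n)\<^sup>2 * f (x - n))
    \<le> G * ((\<Sum>n\<in>{1..int (2 ^ k)}. f (x - n))
        + 2 ^ k * (\<Sum>D\<in>\<I>. high_term {..M} D f x))"
proof -
  have prm: "prime_set A" if "A \<in> sieve_level s r" for A
    using that by (auto simp: sieve_level_def intro: prime_set_sieve_primes)
  have G0: "G \<ge> 0" unfolding G_def by (intro sum_nonneg) (use tot_pos[OF prm] in \<open>auto intro: less_imp_le\<close>)
  obtain W \<D> where W: "finite \<D>" "\<And>D. D \<in> \<D> \<Longrightarrow> \<exists>A\<in>sieve_level s r. \<exists>B\<in>sieve_level s r. D \<subseteq> A \<union> B"
     "\<And>n. (\<Sum>A\<in>sieve_level s r. sieve_fun A n)\<^sup>2 = (\<Sum>D\<in>\<D>. W D * sieve_fun D n)"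
     "W {} = G" "\<And>D. D \<in> \<D> \<Longrightarrow> \<bar>W D\<bar> \<le> 4 ^ card D * G"
  proof -
    have "\<exists>W \<D>. finite \<D> \<and> (\<forall>D\<in>\<D>. \<exists>A\<in>sieve_level s r. \<exists>B\<in>sieve_level s r. D \<subseteq> A \<union> B)
     \<and> (\<forall>n. (\<Sum>A\<in>sieve_level s r. sieve_fun A n)\<^sup>2 = (\<Sum>D\<in>\<D>. W D * sieve_fun D n))
     \<and> W {} = G \<and> (\<forall>D\<in>\<D>. \<bar>W D\<bar> \<le> 4 ^ card D * G)"
      unfolding G_def by (rule sieve_square_expansion) (auto intro: prm sieve_level_down)
    then obtain W \<D> where "finite \<D> \<and> (\<forall>D\<in>\<D>. \<exists>A\<in>sieve_level s r. \<exists>B\<in>sieve_level s r. D \<subseteq> A \<union> B)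
     \<and> (\<forall>n. (\<Sum>A\<in>sieve_level s r. sieve_fun A n)\<^sup>2 = (\<Sum>D\<in>\<D>. W D * sieve_fun D n))
     \<and> W {} = G \<and> (\<forall>D\<in>\<D>. \<bar>W D\<bar> \<le> 4 ^ card D * G)" by (elim exE)
    then show ?thesis by (intro that[of \<D> W]) simp_all
  qed
  have finI: "finite \<I>" by (rule finite_subset[of _ "Pow (sieve_primes s M)"]) (auto simp: \<I>_def)
  define V where "V D = high_term {..M} D f x" for D
  have V0: "V D \<ge> 0" for D by (simp add: V_def high_term_nonneg)
  have sub: "D \<in> \<I>" and summand: "W D * (\<Sum>n\<in>{1..int (2 ^ k)}. sieve_fun D n * f (x - n)) \<le> G * (2 ^ k * V D)"
    if D: "D \<in> \<D> - {{}}" for D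
  proof -
    obtain A B where AB: "A \<in> sieve_level s r" "B \<in> sieve_level s r" "D \<subseteq> A \<union> B" using W(2)[of D] D by blast
    have "sieve_primes s r \<subseteq> sieve_primes s M"
    proof -
      have "(2::nat) ^ r \<le> 2 ^ M" using assms by (intro power_increasing) auto
      then show ?thesis by (auto simp: sieve_primes_def intro: le_trans)
    qed
    then show DI: "D \<in> \<I>" using AB D by (auto simp: \<I>_def sieve_level_def)
    have psD: "prime_set D" using DI by (auto simp: \<I>_def intro: prime_set_sieve_primes)
    have psAB: "prime_set (A \<union> B)" using AB prm by (intro prime_set_Un) auto
    have "\<Prod>D \<le> \<Prod>(A \<union> B)" by (rule prod_prime_set_mono[OF psAB AB(3)])
    also have "\<dots> \<le> \<Prod>(A \<union> B) * \<Prod>(A \<inter> B)"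
    proof -
      have "prime_set (A \<inter> B)" by (rule prime_set_subset[OF psAB]) auto
      from prod_prime_set_pos[OF this] have "1 \<le> \<Prod>(A \<inter> B)" by simp
      from mult_le_mono2[OF this, of "\<Prod>(A \<union> B)"] show ?thesis by simp
    qed
    also have "\<dots> = \<Prod>A * \<Prod>B" using psAB by (intro prod.union_inter) (auto simp: prime_set_def)
    also have "\<dots> \<le> 2 ^ r * 2 ^ r" using AB by (intro mult_mono) (auto simp: sieve_level_def)
    finally have "(\<Prod>D) ^ 10 \<le> (2 ^ r * 2 ^ r) ^ 10" by (intro power_mono) auto
    also have "\<dots> = 2 ^ (20 * r)"
    proof -
      have "(2 ^ r * 2 ^ r) = (2::nat) ^ (2 * r)" by (simp add: mult_2 power_add)
      then have "(2 ^ r * 2 ^ r) ^ 10 = (2::nat) ^ ((2 * r) * 10)" by (simp only: power_mult)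
      then show ?thesis by (simp add: mult_ac)
    qed
    also have "\<dots> \<le> 2 ^ k" using assms(1) by (intro power_increasing) auto
    finally have kD: "k \<in> {j\<in>{..M}. (\<Prod>D) ^ 10 \<le> 2 ^ j}" using assms(2) by simp
    have "\<bar>W D * (\<Sum>n\<in>{1..int (2 ^ k)}. sieve_fun D n * f (x - n))\<bar>
       = \<bar>W D\<bar> * (1 / tot D) * (2 ^ k * \<bar>ram_avg D (2 ^ k) f x\<bar>)"
    proof -
      have "(\<Sum>n\<in>{1..int (2 ^ k)}. sieve_fun D n * f (x - n)) = (-1) ^ card D / tot D * (2 ^ k * ram_avg D (2 ^ k) f x)"
        by (simp add: sieve_fun_eq[OF psD] ram_avg_def sum_distrib_left mult_ac sum_divide_distrib)
      then show ?thesis using tot_pos[OF psD] by (simp add: abs_mult abs_divide power_abs)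
    qed
    also have "\<dots> \<le> (4 ^ card D * G) * (2 ^ card D / real (\<Prod>D)) * (2 ^ k * ram_max D {j\<in>{..M}. (\<Prod>D) ^ 10 \<le> 2 ^ j} f x)"
      using W(5) D tot_ge[OF psD] tot_pos[OF psD] kD G0
      by (intro mult_mono ram_avg_le_ram_max mult_nonneg_nonneg) (auto simp: prod_nonneg)
    also have "\<dots> = G * (2 ^ k * V D)"
    proof -
      have "(4::real) ^ card D * 2 ^ card D = 8 ^ card D" by (simp flip: power_mult_distrib)
      then show ?thesis unfolding V_def high_term_def by (simp add: mult_ac)
    qed
    finally show "W D * (\<Sum>n\<in>{1..int (2 ^ k)}. sieve_fun D n * f (x - n)) \<le> G * (2 ^ k * V D)" by linarith
  qed
  have "(\<Sum>n\<in>{1..int (2 ^ k)}. (\<Sum>A\<in>sieve_level s r. sieve_fun A n)\<^sup>2 * f (x - n))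
     = (\<Sum>n\<in>{1..int (2 ^ k)}. \<Sum>D\<in>\<D>. W D * (sieve_fun D n * f (x - n)))"
    by (simp add: W(3) sum_distrib_right sum_distrib_left mult_ac)
  also have "\<dots> = (\<Sum>D\<in>\<D>. W D * (\<Sum>n\<in>{1..int (2 ^ k)}. sieve_fun D n * f (x - n)))"
    unfolding sum_distrib_left by (rule sum.swap)
  also have "\<dots> \<le> (\<Sum>D\<in>insert {} \<D>. W D * (\<Sum>n\<in>{1..int (2 ^ k)}. sieve_fun D n * f (x - n)))"
    by (rule sum_mono2) (use W(1,4) G0 f0 in \<open>auto simp: sieve_fun_def sum_nonneg\<close>)
  also have "\<dots> = W {} * (\<Sum>n\<in>{1..int (2 ^ k)}. sieve_fun {} n * f (x - n)) + (\<Sum>D\<in>\<D> - {{}}. W D * (\<Sum>n\<in>{1..int (2 ^ k)}. sieve_fun D n * f (x - n)))"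
    using W(1) by (simp add: sum.insert_remove)
  also have "\<dots> \<le> G * (\<Sum>n\<in>{1..int (2 ^ k)}. f (x - n)) + (\<Sum>D\<in>\<D> - {{}}. G * (2 ^ k * V D))"
    using summand by (intro add_mono sum_mono) (auto simp: W(4) sieve_fun_def)
  also have "(\<Sum>D\<in>\<D> - {{}}. G * (2 ^ k * V D)) \<le> (\<Sum>D\<in>\<I>. G * (2 ^ k * V D))"
    using finI sub G0 V0 by (intro sum_mono2) auto
  finally show ?thesis by (simp add: V_def sum_distrib_left algebra_simps)
qed

text \<open>
  The first term on the right comes from the zero frequency of the sieve majorant. The function \<open>V\<close> takes
  the rest, mainly the high frequencies: hence the exponential decay of its norm in \<open>s\<close>.
\<close>

definition controls :: "real \<Rightarrow> nat \<Rightarrow> nat \<Rightarrow> (int \<Rightarrow> real) \<Rightarrow> int set \<Rightarrow> (int \<Rightarrow> real) \<Rightarrow> bool" where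
  "controls C s M f S V \<longleftrightarrow>
    l2_bounded V (C * real s * decay ^ s * L2_set f S) \<and> (\<forall>x. V x \<ge> 0) \<and>
    (\<forall>k\<le>M. \<forall>x. (\<Sum>n=1..2^k. mangoldt n * f (x - int n))
        \<le> C * real s * (\<Sum>n=1..2^k. f (x - int n)) + 2 ^ k * V x)"

text \<open>
  At scales \<open>k < 40 s\<close> the trivial bound \<open>mangoldt n \<le> k\<close> is good enough. At larger scales the sieve
  with limit \<open>2^(k div 20)\<close> applies, and its constant term \<open>k / G\<close> is \<open>O(s)\<close> by \<open>sieve_density\<close>.
\<close>

theorem mangoldt_avg_dominated:
  "\<exists>C>0. \<forall>s\<ge>100. \<forall>M f S. finite S \<longrightarrow> (\<forall>x. f x \<ge> 0) \<longrightarrow> (\<forall>x. x \<notin> S \<longrightarrow> f x = 0) \<longrightarrow>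
    (\<exists>V. controls C s M f S V)"
proof -
  define c where "c = (80 * exp 21 :: real)"
  have c1: "c \<ge> 80" by (simp add: c_def)
  have main: "\<exists>V. l2_bounded V ((c * 136 + 320) * real s * decay ^ s * L2_set f S) \<and> (\<forall>x. V x \<ge> 0) \<and>
      (\<forall>k\<le>M. \<forall>x. (\<Sum>n=1..2^k. mangoldt n * f (x - int n))
          \<le> c * real s * (\<Sum>n=1..2^k. f (x - int n)) + 2 ^ k * V x)"
    if s: "s \<ge> 100" and S: "finite S" and f0: "\<And>x. f x \<ge> 0" and fS: "\<And>x. x \<notin> S \<Longrightarrow> f x = 0"
    for s M :: nat and f :: "int \<Rightarrow> real" and S
  proof -
    define B where "B = L2_set f S"
    have B0: "B \<ge> 0" by (simp add: B_def)
    have fB: "l2_bounded f B" unfolding B_def using S fS by (rule l2_bounded_finite_support)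
    define \<I> where "\<I> = {D. D \<noteq> {} \<and> D \<subseteq> sieve_primes s M}"
    define H where "H x = (\<Sum>D\<in>\<I>. high_term {..M} D f x)" for x
    define Z where "Z k = {n. n \<in> {1..2^k} \<and> primepow n \<and> aprimedivisor n \<le> (2::nat)^(k div 20)}" for k
    define E where "E k x = (\<Sum>n\<in>Z k. mangoldt n / 2 ^ k * f (x - int n))" for k x
    define Ks where "Ks = {k. 40 * s \<le> k \<and> k \<le> M}"
    define V where "V x = c * real s * H x + (\<Sum>k\<in>Ks. E k x)" for x
    have finI: "finite \<I>" by (rule finite_subset[of _ "Pow (sieve_primes s M)"]) (auto simp: \<I>_def)
    have finKs: "finite Ks" by (simp add: Ks_def)
    have H0: "H x \<ge> 0" for x by (simp add: H_def sum_nonneg high_term_nonneg)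
    have E0: "E k x \<ge> 0" for k x by (simp add: E_def sum_nonneg mangoldt_nonneg f0)
    have finZ: "finite (Z k)" for k by (simp add: Z_def)
    have Hb: "l2_bounded H (136 * decay ^ s * B)"
      unfolding H_def B_def
    proof (rule l2_bounded_high_frequencies[OF s finI])
      show "finite S" "\<And>x. x \<notin> S \<Longrightarrow> f x = 0" using S fS by auto
      show "prime_set D" if "D \<in> \<I>" for D using that by (auto simp: \<I>_def intro: prime_set_sieve_primes)
    qed (auto simp: \<I>_def sieve_primes_def)
    have Eb: "l2_bounded (E k) (40 * decay ^ k * B)" if "k \<in> Ks" for k
    proof -
      define r where "r = k div 20"
      have r: "20 * r \<le> k" "k \<le> 40 * r" "r \<ge> 1" using that s by (auto simp: r_def Ks_def)
      have "l2_bounded (E k) ((\<Sum>n\<in>Z k. \<bar>mangoldt n / 2 ^ k\<bar>) * B)"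
        unfolding E_def by (rule l2_bounded_conv[OF fB finZ])
      moreover have "(\<Sum>n\<in>Z k. \<bar>mangoldt n / 2 ^ k\<bar>) \<le> 40 * decay ^ k"
      proof -
        have "(\<Sum>n\<in>Z k. \<bar>mangoldt n / 2 ^ k\<bar> :: real) = (\<Sum>n\<in>Z k. mangoldt n) / 2 ^ k"
          by (simp add: abs_divide sum_divide_distrib)
        also have "\<dots> \<le> (2 ^ r * real k * real r) / 2 ^ k"
          using sum_mangoldt_small_base_le[of k r] by (intro divide_right_mono) (auto simp: Z_def r_def)
        also have "\<dots> \<le> (2 ^ r * (40 * 2 ^ r) * 2 ^ r) / 2 ^ k"
        proof -
          have "r < 2 ^ r" by (rule less_exp)
          then have "real r < real (2 ^ r)" by (simp only: of_nat_less_iff)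
          then have rr: "real r \<le> 2 ^ r" by simp
          moreover have "real k \<le> 40 * 2 ^ r" using rr of_nat_mono[OF r(2), where ?'a = real] by (simp only: of_nat_mult of_nat_numeral)
          ultimately show ?thesis by (intro divide_right_mono mult_mono) auto
        qed
        also have "\<dots> = 40 * (2 powr (3 * real r) / 2 powr (real k))"
        proof -
          have "(2::real) ^ r * 2 ^ r * 2 ^ r = 2 powr (3 * real r)"
            by (simp add: powr_realpow[symmetric] powr_add[symmetric])
          then show ?thesis by (simp add: powr_realpow mult_ac)
        qed
        also have "\<dots> = 40 * 2 powr (3 * real r - real k)" by (simp add: powr_diff)
        also have "\<dots> \<le> 40 * 2 powr (- real k / 4)"
          using of_nat_mono[OF r(1), where ?'a = real] by (intro mult_left_mono powr_mono) auto
        also have "\<dots> = 40 * decay ^ k" by (simp add: decay_power)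
        finally show ?thesis .
      qed
      ultimately show ?thesis using B0 by (meson l2_bounded_le mult_right_mono)
    qed
    have "l2_bounded V (\<bar>c * real s\<bar> * (136 * decay ^ s * B) + (\<Sum>k\<in>Ks. 40 * decay ^ k * B))"
      unfolding V_def by (intro l2_bounded_add l2_bounded_cmult Hb l2_bounded_sum finKs Eb)
    moreover have "\<bar>c * real s\<bar> * (136 * decay ^ s * B) + (\<Sum>k\<in>Ks. 40 * decay ^ k * B) \<le> (c * 136 + 320) * real s * decay ^ s * B"
    proof -
      have "(\<Sum>k\<in>Ks. 40 * decay ^ k * B) = 40 * (\<Sum>k\<in>Ks. decay ^ k) * B" by (simp add: sum_distrib_left sum_distrib_right)
      also have "\<dots> \<le> 40 * (8 * decay ^ s) * B"
        using finKs B0 by (intro mult_right_mono mult_left_mono sum_decay_power_le) (auto simp: Ks_def)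
      also have "\<dots> = 1 * (320 * decay ^ s * B)" by simp
      also have "\<dots> \<le> real s * (320 * decay ^ s * B)"
        using s B0 decay_bounds by (intro mult_right_mono) auto
      finally show ?thesis using c1 by (simp add: algebra_simps)
    qed
    ultimately have Vb: "l2_bounded V ((c * 136 + 320) * real s * decay ^ s * L2_set f S)"
      unfolding B_def by (rule l2_bounded_le)
    have V0: "V x \<ge> 0" for x using c1 H0 E0 by (simp add: V_def sum_nonneg)
    have pt: "(\<Sum>n=1..2^k. mangoldt n * f (x - int n)) \<le> c * real s * (\<Sum>n=1..2^k. f (x - int n)) + 2 ^ k * V x"
      if k: "k \<le> M" for k x
    proof (cases "k < 40 * s")
      case True
      have "(\<Sum>n=1..2^k. mangoldt n * f (x - int n)) \<le> (\<Sum>n=1..2^k. c * real s * f (x - int n))"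
      proof (intro sum_mono mult_right_mono f0)
        fix n :: nat assume n: "n \<in> {1..2^k}"
        have "mangoldt n \<le> ln (real n)" using n by (intro mangoldt_le) auto
        also have "\<dots> \<le> ln (2 ^ k)"
        proof -
          have "real n \<le> 2 ^ k" using n by (metis atLeastAtMost_iff of_nat_le_iff of_nat_numeral of_nat_power)
          then show ?thesis using n by (subst ln_le_cancel_iff) auto
        qed
        also have "\<dots> = real k * ln 2" by (simp add: ln_realpow)
        also have "\<dots> \<le> real k * 1" using ln_2_less_1 by (intro mult_left_mono) auto
        also have "\<dots> \<le> 40 * real s" using True by simp
        also have "\<dots> \<le> c * real s" using c1 by (intro mult_right_mono) auto
        finally show "mangoldt n \<le> c * real s" .
      qed
      also have "\<dots> = c * real s * (\<Sum>n=1..2^k. f (x - int n))" by (rule sum_distrib_left[symmetric])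
      finally show ?thesis using V0[of x] by (smt (verit) mult_nonneg_nonneg zero_le_power)
    next
      case False
      define r where "r = k div 20"
      have r: "20 * r \<le> k" "k \<le> 40 * r" "r \<ge> 1" using False s by (auto simp: r_def)
      have kKs: "k \<in> Ks" using False k by (simp add: Ks_def)
      define G where "G = (\<Sum>A\<in>sieve_level s r. 1 / tot A)"
      have "real r * ln 2 \<le> exp 21 * real s * G" unfolding G_def using s by (intro sieve_density) simp
      moreover have "real r * ln 2 \<ge> real r * (1 / 2)" using half_le_ln_2 by (intro mult_left_mono) auto
      moreover have "real k \<le> 40 * real r" using of_nat_mono[OF r(2), where ?'a = real] by simp
      ultimately have kG: "real k \<le> c * real s * G" unfolding c_def by (simp add: mult_ac)
      have "0 < real k" using r by auto
      with kG have "c * real s * G > 0" by linarith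
      moreover have "c * real s > 0" using c1 s by simp
      ultimately have Gpos: "G > 0" by (rule zero_less_mult_pos)
      define Sf where "Sf n = (\<Sum>A\<in>sieve_level s r. sieve_fun A n)" for n
      have "G\<^sup>2 * (\<Sum>n=1..2^k. mangoldt n * f (x - int n)) = (\<Sum>n=1..2^k. (mangoldt n * G\<^sup>2) * f (x - int n))"
        by (simp add: sum_distrib_left mult_ac)
      also have "\<dots> \<le> (\<Sum>n=1..2^k. ((if primepow n \<and> aprimedivisor n \<le> 2 ^ r then mangoldt n * G\<^sup>2 else 0)
            + real k * (Sf (int n))\<^sup>2) * f (x - int n))"
        unfolding G_def Sf_def by (intro sum_mono mult_right_mono mangoldt_le_sieve f0) auto
      also have "\<dots> = (\<Sum>n=1..2^k. (if primepow n \<and> aprimedivisor n \<le> 2 ^ r then mangoldt n * G\<^sup>2 * f (x - int n) else 0))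
          + real k * (\<Sum>n=1..2^k. (Sf (int n))\<^sup>2 * f (x - int n))"
        unfolding sum_distrib_left sum.distrib[symmetric] by (intro sum.cong refl) (simp add: algebra_simps)
      also have "(\<Sum>n=1..2^k. (if primepow n \<and> aprimedivisor n \<le> 2 ^ r then mangoldt n * G\<^sup>2 * f (x - int n) else 0))
          = G\<^sup>2 * (2 ^ k * E k x)"
        unfolding E_def sum_distrib_left Z_def r_def[symmetric]
        by (subst sum.inter_filter[symmetric]) (auto intro!: sum.cong)
      also have "real k * (\<Sum>n=1..2^k. (Sf (int n))\<^sup>2 * f (x - int n))
         \<le> (c * real s * G) * (G * ((\<Sum>n=1..2^k. f (x - int n)) + 2 ^ k * H x))"
      proof (rule mult_mono[OF kG])
        have "(\<Sum>n\<in>{1..int (2 ^ k)}. (Sf n)\<^sup>2 * f (x - n)) \<le> G * ((\<Sum>n\<in>{1..int (2 ^ k)}. f (x - n)) + 2 ^ k * H x)"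
          unfolding G_def Sf_def H_def \<I>_def by (rule sieve_square_avg_le[OF r(1) k f0])
        then show "(\<Sum>n=1..2^k. (Sf (int n))\<^sup>2 * f (x - int n)) \<le> G * ((\<Sum>n=1..2^k. f (x - int n)) + 2 ^ k * H x)"
          by (simp only: sum_nat_eq_sum_int[of "\<lambda>n. (Sf n)\<^sup>2 * f (x - n)"] sum_nat_eq_sum_int[of "\<lambda>n. f (x - n)"])
      qed (use Gpos c1 f0 in \<open>auto simp: sum_nonneg\<close>)
      finally have "G\<^sup>2 * (\<Sum>n=1..2^k. mangoldt n * f (x - int n))
         \<le> G\<^sup>2 * (2 ^ k * E k x + c * real s * ((\<Sum>n=1..2^k. f (x - int n)) + 2 ^ k * H x))"
        by (simp add: power2_eq_square algebra_simps)
      then have "(\<Sum>n=1..2^k. mangoldt n * f (x - int n))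
         \<le> 2 ^ k * E k x + c * real s * ((\<Sum>n=1..2^k. f (x - int n)) + 2 ^ k * H x)"
        using Gpos by simp
      also have "\<dots> = c * real s * (\<Sum>n=1..2^k. f (x - int n)) + 2 ^ k * (c * real s * H x + E k x)"
        by (simp add: algebra_simps)
      also have "\<dots> \<le> c * real s * (\<Sum>n=1..2^k. f (x - int n)) + 2 ^ k * V x"
      proof -
        have "E k x \<le> (\<Sum>k\<in>Ks. E k x)" by (rule member_le_sum) (use kKs finKs E0 in auto)
        then show ?thesis by (simp add: V_def)
      qed
      finally show ?thesis .
    qed
    show ?thesis using Vb V0 pt by blast
  qed
  show ?thesis
  proof (intro exI[of _ "c * 136 + 320"] conjI allI impI)
    show "0 < c * 136 + 320" using c1 by simp
    fix s M f S assume s: "s \<ge> (100::nat)" and S: "finite (S :: int set)" and f: "\<forall>x. f x \<ge> (0::real)" "\<forall>x. x \<notin> S \<longrightarrow> f x = 0"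
    obtain V where V: "l2_bounded V ((c * 136 + 320) * real s * decay ^ s * L2_set f S)" "\<forall>x. V x \<ge> 0"
      "\<forall>k\<le>M. \<forall>x. (\<Sum>n=1..2^k. mangoldt n * f (x - int n)) \<le> c * real s * (\<Sum>n=1..2^k. f (x - int n)) + 2 ^ k * V x"
      using main[OF s S, of f M] f by blast
    have "c * real s * (\<Sum>n=1..2^k. f (x - int n)) \<le> (c * 136 + 320) * real s * (\<Sum>n=1..2^k. f (x - int n))" for k x
      using c1 f(1) by (intro mult_right_mono sum_nonneg) auto
    then have "\<forall>k\<le>M. \<forall>x. (\<Sum>n=1..2^k. mangoldt n * f (x - int n))
        \<le> (c * 136 + 320) * real s * (\<Sum>n=1..2^k. f (x - int n)) + 2 ^ k * V x"
      using V(3) by (smt (verit, best))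
    then show "\<exists>V. controls (c * 136 + 320) s M f S V" unfolding controls_def
      using V by blast
  qed
qed

section \<open>Restricted weak type\<close>

abbreviation (input) ind :: "int set \<Rightarrow> int \<Rightarrow> real" where
  "ind F \<equiv> indicator F"

definition mscale :: "(int \<Rightarrow> real) \<Rightarrow> nat \<Rightarrow> int \<Rightarrow> real" where
  "mscale f k x = (\<Sum>n=1..2^k. mangoldt n * f (x - int n)) / 2 ^ k"

lemma mscale_nonneg: "(\<And>x. f x \<ge> 0) \<Longrightarrow> mscale f k x \<ge> 0"
  by (simp add: mscale_def sum_nonneg mangoldt_nonneg)

text \<open>
  The sum over \<open>n\<close> grows with the length, so rounding the length up to a power of two costs at most the
  factor 2 from the normalization.
\<close>

lemma avg_N_le_mscale:
  fixes f :: "int \<Rightarrow> real"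
  assumes f0: "\<And>x. f x \<ge> 0" and N: "N \<ge> 1"
  obtains k where "N \<le> 2 ^ k" "2 ^ k < 2 * N" "norm (avg_N N f x) \<le> 2 * mscale f k x"
proof -
  obtain j where j: "2 ^ j \<le> N" "N < 2 * 2 ^ j" using ex_power_of_two_interval[OF N] by auto
  define k where "k = (if N = 2 ^ j then j else Suc j)"
  have k: "N \<le> 2 ^ k" "2 ^ k < 2 * N" using j N by (auto simp: k_def)
  have kr: "2 ^ k \<le> 2 * real N" using k(2) by (metis less_imp_le of_nat_le_iff of_nat_mult of_nat_numeral of_nat_power)
  have "norm (avg_N N f x) = (\<Sum>n=1..N. mangoldt n * f (x - int n)) / real N"
    using f0 by (simp add: avg_N_def sum_nonneg mangoldt_nonneg divide_inverse mult.commute)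
  also have "\<dots> \<le> (\<Sum>n=1..2^k. mangoldt n * f (x - int n)) / real N"
    using k(1) f0 by (intro divide_right_mono sum_mono2) (auto simp: mangoldt_nonneg)
  also have "\<dots> \<le> (\<Sum>n=1..2^k. mangoldt n * f (x - int n)) / (2 ^ k / 2)"
    using kr f0 N by (intro divide_left_mono sum_nonneg) (auto simp: mangoldt_nonneg)
  also have "\<dots> = 2 * mscale f k x" by (simp add: mscale_def)
  finally show ?thesis using k that by blast
qed

lemma A_star_gt_imp_mscale:
  fixes f :: "int \<Rightarrow> real"
  assumes f0: "\<And>x. f x \<ge> 0" and l: "0 \<le> l" "A_star f x > ennreal l"
  shows "\<exists>k. l < 2 * mscale f k x"
proof -
  obtain N where N: "N \<ge> 1" "ennreal l < ennreal (norm (avg_N N f x))"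
    using l(2) by (auto simp: A_star_def less_SUP_iff)
  then have "l < norm (avg_N N f x)" using l(1) by (simp add: ennreal_less_iff)
  then show ?thesis using avg_N_le_mscale[of f N x, OF f0 N(1)] by (meson less_le_trans)
qed

lemma counting_le:
  assumes "c \<ge> 0" "\<And>S. finite S \<Longrightarrow> S \<subseteq> X \<Longrightarrow> real (card S) \<le> c"
  shows "counting X \<le> ennreal c"
proof -
  have fin: "finite X"
  proof (rule ccontr)
    assume "infinite X"
    then obtain S where "finite S" "card S = Suc (nat \<lceil>c\<rceil>)" "S \<subseteq> X"
      using infinite_arbitrarily_large by blast
    then have "real (Suc (nat \<lceil>c\<rceil>)) \<le> c" using assms(2)[of S] by simp
    then show False by linarith
  qed
  then have "counting X = ennreal (real (card X))"
    by (simp add: counting_def emeasure_count_space_finite ennreal_of_nat_eq_real_of_nat)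
  also have "\<dots> \<le> ennreal c" using assms(2)[OF fin] by (intro ennreal_leI) simp
  finally show ?thesis .
qed

lemma Log_ge_1: "Log x \<ge> 1"
  by (simp add: Log_def)

lemma ex_level_for_decay:
  assumes "0 < l" "l \<le> (1::real)"
  shows "\<exists>s\<ge>100. real s \<le> 101 * Log l \<and> decay ^ s \<le> l"
proof -
  define s where "s = 100 + nat \<lceil>4 * log 2 (1 / l)\<rceil>"
  have lg: "log 2 (1 / l) \<ge> 0" using assms by (simp add: zero_le_log_cancel_iff)
  have lgL: "log 2 (1 / l) \<le> 2 * \<bar>ln l\<bar>"
  proof -
    have "log 2 (1 / l) = \<bar>ln l\<bar> / ln 2" using assms by (simp add: log_def ln_div)
    also have "\<dots> \<le> \<bar>ln l\<bar> / (1 / 2)" using half_le_ln_2 by (intro divide_left_mono) auto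
    finally show ?thesis by simp
  qed
  have "real s \<le> 101 + 4 * log 2 (1 / l)" using lg unfolding s_def by linarith
  also have "\<dots> \<le> 101 * Log l" using lgL by (simp add: Log_def)
  finally have 1: "real s \<le> 101 * Log l" .
  have "real s \<ge> 4 * log 2 (1 / l)" unfolding s_def by linarith
  then have "decay ^ s \<le> 2 powr (- log 2 (1 / l))" unfolding decay_power by (intro powr_mono) auto
  also have "\<dots> = l" using assms by (simp add: powr_minus)
  finally have 2: "decay ^ s \<le> l" .
  show ?thesis using 1 2 by (intro exI[of _ s]) (simp add: s_def)
qed

lemma square_mult_decay_le: "(real s)\<^sup>2 * decay ^ s \<le> 256"
proof -
  have "1 + real s / 8 * ln 2 \<le> exp (real s / 8 * ln 2)" by (rule exp_ge_add_one_self)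
  moreover have "real s / 8 * (1 / 2) \<le> real s / 8 * ln 2" using half_le_ln_2 by (intro mult_left_mono) auto
  moreover have "2 powr (real s / 8) = exp (real s / 8 * ln 2)" by (simp add: powr_def)
  ultimately have "real s \<le> 16 * 2 powr (real s / 8)" by linarith
  then have "(real s)\<^sup>2 \<le> (16 * 2 powr (real s / 8))\<^sup>2" by (intro power_mono) auto
  also have "\<dots> = 256 * 2 powr (real s / 4)"
    by (simp add: power_mult_distrib power2_eq_square flip: powr_add)
  finally have "(real s)\<^sup>2 * decay ^ s \<le> 256 * 2 powr (real s / 4) * decay ^ s"
    using decay_bounds by (intro mult_right_mono) auto
  also have "\<dots> = 256" by (simp add: decay_power flip: powr_add)
  finally show ?thesis .
qed

lemma L2_set_indicator: "finite F \<Longrightarrow> (L2_set (ind F) F)\<^sup>2 = real (card F)"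
  by (simp add: L2_set_def sum_nonneg indicator_def power2_eq_square)

text \<open>
  With \<open>decay ^ s \<le> l\<close> the set where \<open>V\<close> exceeds \<open>l / 4\<close> has size \<open>O(\<bar>F\<bar> / l)\<close> by Chebyshev's inequality, two
  factors of \<open>decay ^ s\<close> being available: one absorbs \<open>s\<^sup>2\<close>, the other one factor \<open>1 / l\<close>. The plain
  averages are large only on a set of size \<open>O(s \<bar>F\<bar> / l)\<close>.
\<close>

theorem restricted_weak_type:
  "\<exists>C>0. \<forall>F l. finite F \<longrightarrow> 0 < l \<longrightarrow> l < 1 \<longrightarrow>
    counting {x. A_star (ind F) x > ennreal l} \<le> ennreal (C * Log l / l * real (card F))"
proof -
  from mangoldt_avg_dominated obtain C where C': "C > 0 \<and> (\<forall>s\<ge>100. \<forall>M f S. finite S \<longrightarrow>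
      (\<forall>x. f x \<ge> 0) \<longrightarrow> (\<forall>x. x \<notin> S \<longrightarrow> f x = 0) \<longrightarrow> (\<exists>V. controls C s M f S V))"
    by (elim exE)
  note C = C'[THEN conjunct1] and dom = C'[THEN conjunct2, rule_format]
  have "counting {x. A_star (ind F) x > ennreal l} \<le> ennreal ((808 * C + 4096 * C\<^sup>2) * Log l / l * real (card F))"
    if F: "finite F" and l: "0 < l" "l < 1" for F l
  proof (rule counting_le)
    show "0 \<le> (808 * C + 4096 * C\<^sup>2) * Log l / l * real (card F)" using C l Log_ge_1[of l] by simp
    fix S :: "int set" assume S: "finite S" "S \<subseteq> {x. A_star (ind F) x > ennreal l}"
    define f where "f = (ind F)"
    have f0: "f x \<ge> 0" and fF: "x \<notin> F \<Longrightarrow> f x = 0" for x by (auto simp: f_def)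
    have "\<exists>k. l < 2 * mscale f k x" if "x \<in> S" for x
      using A_star_gt_imp_mscale[of f l x] f0 S(2) that l by (auto simp: f_def)
    then obtain kk where kk: "\<And>x. x \<in> S \<Longrightarrow> l < 2 * mscale f (kk x) x" by metis
    define M where "M = Max (insert 0 (kk ` S))"
    have kM: "kk x \<le> M" if "x \<in> S" for x using S(1) that by (simp add: M_def)
    obtain s where s: "s \<ge> 100" "real s \<le> 101 * Log l" "decay ^ s \<le> l" using ex_level_for_decay[of l] l by auto
    obtain V where V: "l2_bounded V (C * real s * decay ^ s * L2_set f F)" "\<forall>x. V x \<ge> 0"
      "\<forall>k\<le>M. \<forall>x. (\<Sum>n=1..2^k. mangoldt n * f (x - int n)) \<le> C * real s * (\<Sum>n=1..2^k. f (x - int n)) + 2 ^ k * V x"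
      using dom[where f = f and S = F and s = s and M = M, OF s(1) F f0 fF] unfolding controls_def by blast
    define \<mu> where "\<mu> = l / (4 * C * real s)"
    have \<mu>: "\<mu> > 0" using l C s by (simp add: \<mu>_def)
    (* Either the plain average or the high frequency part is responsible for a large value. *)
    define S1 where "S1 = {x\<in>S. \<exists>N\<ge>1. \<mu> * real N < (\<Sum>n=1..N. f (x - 1 * int n))}"
    define S2 where "S2 = {x\<in>S. l / 4 \<le> V x}"
    have "S \<subseteq> S1 \<union> S2"
    proof
      fix x assume x: "x \<in> S"
      define k where "k = kk x"
      have "l / 2 * 2 ^ k < (\<Sum>n=1..2^k. mangoldt n * f (x - int n))"
        using kk[OF x] by (simp add: mscale_def k_def field_simps)
      also have "\<dots> \<le> C * real s * (\<Sum>n=1..2^k. f (x - int n)) + 2 ^ k * V x"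
        using V(3) kM[OF x] by (simp add: k_def)
      finally have *: "l / 2 * 2 ^ k < C * real s * (\<Sum>n=1..2^k. f (x - int n)) + 2 ^ k * V x" .
      show "x \<in> S1 \<union> S2"
      proof (cases "l / 4 \<le> V x")
        case False
        then have "2 ^ k * V x < 2 ^ k * (l / 4)" by simp
        moreover have "2 ^ k * (l / 4) = l / 4 * 2 ^ k" "l / 2 * 2 ^ k = l / 4 * 2 ^ k + l / 4 * 2 ^ k" by simp_all
        ultimately have "l / 4 * 2 ^ k < C * real s * (\<Sum>n=1..2^k. f (x - int n))" using * by linarith
        moreover have "l / 4 * 2 ^ k = C * real s * (\<mu> * real (2 ^ k))" using C s by (simp add: \<mu>_def)
        moreover have "C * real s > 0" using C s by simp
        ultimately have "\<mu> * real (2 ^ k) < (\<Sum>n=1..2^k. f (x - int n))"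
          by (metis mult_less_cancel_left_pos)
        then show ?thesis using x unfolding S1_def by (auto intro!: exI[of _ "2 ^ k"])
      qed (use x in \<open>simp add: S2_def\<close>)
    qed
    then have "card S \<le> card (S1 \<union> S2)" using S(1) by (intro card_mono) (auto simp: S1_def S2_def)
    also have "\<dots> \<le> card S1 + card S2" by (rule card_Un_le)
    finally have card: "real (card S) \<le> real (card S1) + real (card S2)" by (metis of_nat_add of_nat_le_iff)
    have "\<exists>W. finite W \<and> W \<subseteq> {z. \<exists>y\<in>S1. z < y \<and> 1 dvd (y - z)} \<and> \<mu> * real (card S1) \<le> 2 * (\<Sum>z\<in>W. f z)"
      by (rule card_one_sided_maximal_le) (use S(1) \<mu> f0 in \<open>auto simp: S1_def\<close>)
    then obtain W where W: "finite W" "\<mu> * real (card S1) \<le> 2 * (\<Sum>z\<in>W. f z)" by blast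
    have "(\<Sum>z\<in>W. f z) = real (card (W \<inter> F))" using W(1) by (simp add: f_def indicator_def sum.If_cases Int_def)
    also have "\<dots> \<le> real (card F)" using F by (intro of_nat_mono card_mono) auto
    finally have "\<mu> * real (card S1) \<le> 2 * real (card F)" using W(2) by linarith
    then have "real (card S1) \<le> 8 * C * real s / l * real (card F)"
      using l C s by (simp add: \<mu>_def field_simps)
    also have "\<dots> \<le> 8 * C * (101 * Log l) / l * real (card F)"
      using s(2) C l by (intro mult_right_mono divide_right_mono mult_left_mono) auto
    finally have c1: "real (card S1) \<le> 808 * C * Log l / l * real (card F)" by simp
    have "(l / 4)\<^sup>2 * real (card S2) \<le> (C * real s * decay ^ s * L2_set f F)\<^sup>2"
      by (rule l2_bounded_card_le[OF V(1)]) (use S(1) l in \<open>auto simp: S2_def\<close>)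
    also have "\<dots> = C\<^sup>2 * (((real s)\<^sup>2 * decay ^ s) * decay ^ s) * real (card F)"
      unfolding L2_set_indicator[OF F, symmetric] f_def[symmetric] by (simp add: power_mult_distrib power2_eq_square mult_ac)
    also have "\<dots> \<le> C\<^sup>2 * (256 * l) * real (card F)"
      using square_mult_decay_le[of s] s(3) decay_bounds l by (intro mult_right_mono mult_left_mono mult_mono) auto
    finally have "real (card S2) \<le> 4096 * C\<^sup>2 * 1 / l * real (card F)"
      using l by (simp add: power2_eq_square field_simps)
    also have "\<dots> \<le> 4096 * C\<^sup>2 * Log l / l * real (card F)"
      using Log_ge_1[of l] l by (intro mult_right_mono divide_right_mono mult_left_mono) auto
    finally have c2: "real (card S2) \<le> 4096 * C\<^sup>2 * Log l / l * real (card F)" .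
    have "real (card S) \<le> 808 * C * Log l / l * real (card F) + 4096 * C\<^sup>2 * Log l / l * real (card F)"
      using card c1 c2 by linarith
    also have "\<dots> = (808 * C + 4096 * C\<^sup>2) * Log l / l * real (card F)"
      by (simp add: add_divide_distrib distrib_right)
    finally show "real (card S) \<le> (808 * C + 4096 * C\<^sup>2) * Log l / l * real (card F)" .
  qed
  moreover have "808 * C + 4096 * C\<^sup>2 > 0" using C by (simp add: add_pos_pos)
  ultimately show ?thesis by blast
qed

section \<open>Stopping cells\<close>

abbreviation (input) dyadic_cell :: "int \<Rightarrow> nat \<Rightarrow> int set" where
  "dyadic_cell b j \<equiv> {b..<b + 2 ^ j}"

abbreviation (input) double_cell :: "int \<Rightarrow> nat \<Rightarrow> int set" where
  "double_cell b j \<equiv> {b - 2 ^ j..<b + 2 ^ j}"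

text \<open>
  The density of \<open>F\<close> in the double of a cell: averages of length up to \<open>2^j\<close> taken at points of the cell
  see precisely this set.
\<close>

definition cell_density :: "int set \<Rightarrow> int \<Rightarrow> nat \<Rightarrow> real" where
  "cell_density F b j = real (card (F \<inter> double_cell b j)) / 2 ^ Suc j"

text \<open>
  This is \<open>u Log u\<close> times the length of the doubled cell, continued to \<open>u = 0\<close> by its limit.
\<close>

definition cell_weight :: "int set \<Rightarrow> int set \<Rightarrow> int \<Rightarrow> nat \<Rightarrow> real" where
  "cell_weight F G b j = (let u = cell_density F b j * cell_density G b j in
     if u = 0 then 0 else 2 ^ Suc j * (u * Log u))"

definition mscale_max :: "(int \<Rightarrow> real) \<Rightarrow> nat \<Rightarrow> int \<Rightarrow> real" where
  "mscale_max f m x = Max ((\<lambda>k. mscale f k x) ` {..m})"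

lemma cell_density_bounds: "0 \<le> cell_density F b j" "cell_density F b j \<le> 1"
proof -
  show "0 \<le> cell_density F b j" by (simp add: cell_density_def)
  have "card (F \<inter> double_cell b j) \<le> card (double_cell b j)" by (rule card_mono) auto
  also have "\<dots> = nat (2 * 2 ^ j)" by simp
  finally have "real (card (F \<inter> double_cell b j)) \<le> real (nat (2 * 2 ^ j))" by (rule of_nat_mono)
  also have "\<dots> = 2 ^ Suc j" by (simp add: nat_mult_distrib nat_power_eq)
  finally show "cell_density F b j \<le> 1" by (simp add: cell_density_def)
qed

lemma mscale_le_max: "k \<le> m \<Longrightarrow> mscale f k x \<le> mscale_max f m x"
  by (simp add: mscale_max_def)

lemma mscale_max_le: "(\<And>k. k \<le> m \<Longrightarrow> mscale f k x \<le> b) \<Longrightarrow> mscale_max f m x \<le> b"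
  by (simp add: mscale_max_def)

lemma sum_indicator_window:
  "(\<Sum>n=1..N. indicator F (x - int n) :: real) = real (card (F \<inter> {x - int N..<x}))"
proof -
  have "(\<Sum>n=1..N. indicator F (x - int n) :: real) = (\<Sum>y\<in>{x - int N..<x}. indicator F y)"
    by (rule sum.reindex_bij_witness[of _ "\<lambda>y. nat (x - y)" "\<lambda>n. x - int n"]) auto
  also have "\<dots> = real (card (F \<inter> {x - int N..<x}))"
    by (simp add: indicator_def sum.If_cases Int_def conj_commute)
  finally show ?thesis .
qed

text \<open>
  Both directions are needed because the parent of a stopping cell contains a good point that may lie
  on either side. The averages to the right start at \<open>x\<close> itself, so that \<open>x\<close> is never left out.
\<close>

lemma card_two_sided_maximal_le:
  assumes I: "finite I" and F: "finite F" and l: "l > (0::real)"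
  defines "B \<equiv> {x\<in>I. (\<exists>N\<ge>1. l * real N < real (card (F \<inter> {x - int N..<x})))
      \<or> (\<exists>N\<ge>1. l * real N < real (card (F \<inter> {x..<x + int N})))}"
  shows "l * real (card B) \<le> 4 * real (card F)"
proof -
  define B1 where "B1 = {x\<in>I. \<exists>N\<ge>1. l * real N < real (card (F \<inter> {x - int N..<x}))}"
  define B2 where "B2 = {x\<in>I. \<exists>N\<ge>1. l * real N < real (card (F \<inter> {x..<x + int N}))}"
  have sum_le: "(\<Sum>z\<in>W. indicator F z :: real) \<le> real (card F)" if "finite W" for W
  proof -
    have "(\<Sum>z\<in>W. indicator F z :: real) = real (card (W \<inter> F))"
      using that by (simp add: indicator_def sum.If_cases Int_def)
    also have "\<dots> \<le> real (card F)" using F by (intro of_nat_mono card_mono) auto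
    finally show ?thesis .
  qed
  have "\<exists>W. finite W \<and> W \<subseteq> {z. \<exists>y\<in>B1. z < y \<and> 1 dvd (y - z)} \<and> l * real (card B1) \<le> 2 * (\<Sum>z\<in>W. indicator F z)"
  proof (rule card_one_sided_maximal_le)
    fix x assume "x \<in> B1"
    then show "\<exists>N\<ge>1. l * real N < (\<Sum>n=1..N. indicator F (x - 1 * int n))"
      using sum_indicator_window[of F x] by (auto simp: B1_def)
  qed (use I l in \<open>auto simp: B1_def\<close>)
  then have b1: "l * real (card B1) \<le> 2 * real (card F)" using sum_le by fastforce
  define E where "E = (\<lambda>x. 1 - x) ` B2"
  have "\<exists>W. finite W \<and> W \<subseteq> {z. \<exists>y\<in>E. z < y \<and> 1 dvd (y - z)} \<and> l * real (card E) \<le> 2 * (\<Sum>z\<in>W. indicator F (- z))"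
  proof (rule card_one_sided_maximal_le)
    fix z assume "z \<in> E"
    then obtain x where x: "x \<in> B2" "z = 1 - x" by (auto simp: E_def)
    have "(\<Sum>n=1..N. indicator F (- (z - 1 * int n)) :: real) = real (card (F \<inter> {x..<x + int N}))" for N
    proof -
      have "(\<Sum>n=1..N. indicator F (- (z - 1 * int n)) :: real) = (\<Sum>y\<in>{x..<x + int N}. indicator F y)"
        by (rule sum.reindex_bij_witness[of _ "\<lambda>y. nat (y - x + 1)" "\<lambda>n. x - 1 + int n"]) (auto simp: x(2) algebra_simps)
      also have "\<dots> = real (card (F \<inter> {x..<x + int N}))"
        by (simp add: indicator_def sum.If_cases Int_def conj_commute)
      finally show ?thesis .
    qed
    then show "\<exists>N\<ge>1. l * real N < (\<Sum>n=1..N. indicator F (- (z - 1 * int n)))"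
      using x(1) by (auto simp: B2_def)
  qed (use I l in \<open>auto simp: E_def B2_def\<close>)
  then obtain W where W: "finite W" "l * real (card E) \<le> 2 * (\<Sum>z\<in>W. indicator F (- z))" by blast
  have "(\<Sum>z\<in>W. indicator F (- z) :: real) = (\<Sum>z\<in>uminus ` W. indicator F z)"
    by (simp add: sum.reindex inj_on_def)
  also have "\<dots> \<le> real (card F)" using W(1) by (intro sum_le) simp
  finally have "l * real (card E) \<le> 2 * real (card F)" using W(2) by linarith
  moreover have "card E = card B2" unfolding E_def by (rule card_image) (simp add: inj_on_def)
  ultimately have b2: "l * real (card B2) \<le> 2 * real (card F)" by simp
  have "B = B1 \<union> B2" by (auto simp: B_def B1_def B2_def)
  then have "card B \<le> card B1 + card B2" by (simp add: card_Un_le)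
  then have "l * real (card B) \<le> l * real (card B1 + card B2)" using l by (intro mult_left_mono) auto
  then show ?thesis using b1 b2 by (simp add: algebra_simps)
qed

definition cell_start :: "int \<Rightarrow> nat \<Rightarrow> int \<Rightarrow> int" where
  "cell_start a j x = a + ((x - a) div 2 ^ j) * 2 ^ j"

text \<open>
  The dyadic cell of length \<open>2^j\<close> that contains \<open>x\<close>, in the grid with origin \<open>a\<close>.
\<close>

definition cell :: "int \<Rightarrow> nat \<Rightarrow> int \<Rightarrow> int set" where
  "cell a j x = {cell_start a j x..<cell_start a j x + 2 ^ j}"

lemma mem_cell_iff: "y \<in> cell a j x \<longleftrightarrow> (y - a) div 2 ^ j = (x - a) div 2 ^ j"
proof -
  define q where "q = (x - a) div 2 ^ j"
  have "y \<in> cell a j x \<longleftrightarrow> q * 2 ^ j \<le> y - a \<and> y - a < (q + 1) * 2 ^ j"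
    by (auto simp: cell_def cell_start_def q_def algebra_simps)
  also have "\<dots> \<longleftrightarrow> (y - a) div 2 ^ j = q"
  proof
    assume "q * 2 ^ j \<le> y - a \<and> y - a < (q + 1) * 2 ^ j"
    then show "(y - a) div 2 ^ j = q"
      by (intro int_div_pos_eq[of _ _ _ "y - a - q * 2 ^ j"]) (auto simp: algebra_simps)
  next
    assume "(y - a) div 2 ^ j = q"
    then have "y - a = q * 2 ^ j + (y - a) mod 2 ^ j" by (metis div_mult_mod_eq)
    moreover have "0 \<le> (y - a) mod 2 ^ j" "(y - a) mod 2 ^ j < 2 ^ j" by simp_all
    moreover have "(q + 1) * 2 ^ j = q * 2 ^ j + 2 ^ j" by (simp add: algebra_simps)
    ultimately show "q * 2 ^ j \<le> y - a \<and> y - a < (q + 1) * 2 ^ j" by linarith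
  qed
  finally show ?thesis by (simp add: q_def)
qed

lemma self_mem_cell: "x \<in> cell a j x"
  by (simp add: mem_cell_iff)

lemma cell_eq: "y \<in> cell a j x \<Longrightarrow> cell a j y = cell a j x"
  by (auto simp: mem_cell_iff)

lemma cell_start_eq: "y \<in> cell a j x \<Longrightarrow> cell_start a j y = cell_start a j x"
  by (simp add: mem_cell_iff cell_start_def)

lemma cell_mono:
  assumes "i \<le> j"
  shows "cell a i x \<subseteq> cell a j x"
proof
  fix y assume "y \<in> cell a i x"
  then have *: "(y - a) div 2 ^ i = (x - a) div 2 ^ i" by (simp add: mem_cell_iff)
  have "z div 2 ^ j = z div 2 ^ i div 2 ^ (j - i)" for z :: int
  proof -
    have "(2::int) ^ j = 2 ^ i * 2 ^ (j - i)" using assms by (simp flip: power_add)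
    then show ?thesis by (simp add: zdiv_zmult2_eq)
  qed
  then show "y \<in> cell a j x" using * by (simp add: mem_cell_iff)
qed

lemma cell_zero: "cell a 0 x = {x}"
  by (auto simp: cell_def cell_start_def)

lemma cell_top:
  assumes "x \<in> dyadic_cell a m"
  shows "cell a m x = dyadic_cell a m"
  using assms by (simp add: cell_def cell_start_def div_pos_pos_trivial)

text \<open>
  The maximal dyadic cells inside \<open>B\<close> partition \<open>B\<close>: \<open>j x\<close> is the size of the one around \<open>x\<close>, and it is constant on it.
\<close>

lemma maximal_cells:
  assumes B: "B \<subset> dyadic_cell a m"
  shows "\<exists>j. (\<forall>x\<in>B. j x < m \<and> cell a (j x) x \<subseteq> B \<and> \<not> cell a (Suc (j x)) x \<subseteq> B)
    \<and> (\<forall>x\<in>B. \<forall>y\<in>cell a (j x) x. j y = j x)"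
proof -
  define ok where "ok x i \<longleftrightarrow> cell a i x \<subseteq> B" for x i
  define j where "j x = (GREATEST i. ok x i)" for x
  have ok0: "ok x 0" if "x \<in> B" for x using that by (simp add: ok_def cell_zero)
  have bound: "i < m" if "x \<in> B" "ok x i" for x i
  proof (rule ccontr)
    assume "\<not> i < m"
    then have "cell a m x \<subseteq> B" using cell_mono[of m i a x] that(2) by (auto simp: ok_def)
    moreover have "cell a m x = dyadic_cell a m" using that(1) B by (intro cell_top) auto
    ultimately show False using B by auto
  qed
  have okj: "ok x (j x)" if "x \<in> B" for x
    unfolding j_def by (rule GreatestI_nat[where b = m]) (use ok0[OF that] bound[OF that] in \<open>auto intro: less_imp_le\<close>)
  have jmax: "i \<le> j x" if "x \<in> B" "ok x i" for x i
    unfolding j_def by (rule Greatest_le_nat[where b = m]) (use that bound[OF that(1)] in \<open>auto intro: less_imp_le\<close>)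
  have same: "j y = j x" if x: "x \<in> B" and y: "y \<in> cell a (j x) x" for x y
  proof -
    have yB: "y \<in> B" using okj[OF x] y by (auto simp: ok_def)
    have "ok y (j x)" using okj[OF x] cell_eq[OF y] by (simp add: ok_def)
    then have le: "j x \<le> j y" by (rule jmax[OF yB])
    have "y \<in> cell a (j y) x" using y cell_mono[OF le] by auto
    then have "cell a (j y) y = cell a (j y) x" by (rule cell_eq)
    then have "ok x (j y)" using okj[OF yB] by (simp add: ok_def)
    then have "j y \<le> j x" by (rule jmax[OF x])
    with le show ?thesis by simp
  qed
  have "\<not> cell a (Suc (j x)) x \<subseteq> B" if "x \<in> B" for x
    using jmax[OF that, of "Suc (j x)"] by (auto simp: ok_def)
  then show ?thesis using okj bound same by (intro exI[of _ j]) (auto simp: ok_def)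
qed

text \<open>
  The local estimate on one cell, restricted to those scales at which \<open>F\<close> has no more than its usual
  density near \<open>x\<close>. The plain averages are then \<open>O(\<delta>)\<close>, and for the high frequency part the choice
  \<open>decay ^ s \<le> \<surd>u\<close> balances the Cauchy-Schwarz bound against the product \<open>u\<close> of the two densities.
\<close>

lemma mscale_tree_sum_le:
  "\<exists>C>0. \<forall>F G a m. finite F \<longrightarrow> finite G \<longrightarrow> cell_density F a m > 0 \<longrightarrow> cell_density G a m > 0 \<longrightarrow>
     (\<exists>V. (\<Sum>x\<in>G \<inter> dyadic_cell a m. V x) \<le> C * cell_weight F G a m \<and>
       (\<forall>k\<le>m. \<forall>x\<in>dyadic_cell a m.
          real (card (F \<inter> {x - 2 ^ k..<x})) \<le> 96 * cell_density F a m * 2 ^ k \<longrightarrow>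
          mscale (indicator F) k x \<le> V x))"
proof -
  from mangoldt_avg_dominated obtain C where C': "C > 0 \<and> (\<forall>s\<ge>100. \<forall>M f S. finite S \<longrightarrow>
      (\<forall>x. f x \<ge> 0) \<longrightarrow> (\<forall>x. x \<notin> S \<longrightarrow> f x = 0) \<longrightarrow> (\<exists>V. controls C s M f S V))"
    by (elim exE)
  note C = C'[THEN conjunct1] and dom = C'[THEN conjunct2, rule_format]
  have "\<exists>V. (\<Sum>x\<in>G \<inter> dyadic_cell a m. V x) \<le> 9797 * C * cell_weight F G a m \<and>
       (\<forall>k\<le>m. \<forall>x\<in>dyadic_cell a m.
          real (card (F \<inter> {x - 2 ^ k..<x})) \<le> 96 * cell_density F a m * 2 ^ k \<longrightarrow>
          mscale (indicator F) k x \<le> V x)"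
    if F: "finite F" and G: "finite G" and dF: "cell_density F a m > 0" and dG: "cell_density G a m > 0" for F G a m
  proof -
    define u where "u = cell_density F a m * cell_density G a m"
    have u: "0 < u" "u \<le> 1"
      using dF dG cell_density_bounds[of F a m] cell_density_bounds[of G a m] by (auto simp: u_def mult_le_one)
    (* Cauchy-Schwarz gives the factor sqrt u, so decay ^ s must supply the other half of u. *)
    define v where "v = sqrt u"
    have v: "0 < v" "v \<le> 1" "v * v = u" using u by (auto simp: v_def)
    obtain s where s: "s \<ge> 100" "real s \<le> 101 * Log v" "decay ^ s \<le> v" using ex_level_for_decay[OF v(1,2)] by auto
    have Lv: "Log v \<le> Log u" using u by (simp add: Log_def v_def ln_sqrt)
    have sL: "real s \<le> 101 * Log u" using s(2) Lv by linarith
    define F' where "F' = F \<inter> double_cell a m"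
    define f where "f = (ind F')"
    have finF': "finite F'" using F by (simp add: F'_def)
    have f0: "f x \<ge> 0" and fF: "x \<notin> F' \<Longrightarrow> f x = 0" for x by (auto simp: f_def)
    obtain V where V: "l2_bounded V (C * real s * decay ^ s * L2_set f F')" "\<forall>x. V x \<ge> 0"
      "\<forall>k\<le>m. \<forall>x. (\<Sum>n=1..2^k. mangoldt n * f (x - int n)) \<le> C * real s * (\<Sum>n=1..2^k. f (x - int n)) + 2 ^ k * V x"
      using dom[where f = f and S = F' and s = s and M = m, OF s(1) finF' f0 fF] unfolding controls_def by blast
    define GI where "GI = G \<inter> dyadic_cell a m"
    have finGI: "finite GI" using G by (simp add: GI_def)
    have cF: "real (card F') = 2 ^ Suc m * cell_density F a m" by (simp add: cell_density_def F'_def)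
    have cG: "real (card GI) \<le> 2 ^ Suc m * cell_density G a m"
    proof -
      have "GI \<subseteq> G \<inter> double_cell a m" by (auto simp: GI_def intro: order_trans[of _ a])
      then have "card GI \<le> card (G \<inter> double_cell a m)" using G by (intro card_mono) auto
      then show ?thesis by (simp add: cell_density_def)
    qed
    have sumV: "(\<Sum>x\<in>GI. V x) \<le> C * real s * (2 ^ Suc m * u)"
    proof -
      have "(\<Sum>x\<in>GI. V x) \<le> (\<Sum>x\<in>GI. \<bar>1\<bar> * \<bar>V x\<bar>)" by (intro sum_mono) simp
      also have "\<dots> \<le> L2_set (\<lambda>_. 1) GI * L2_set V GI" by (rule L2_set_mult_ineq)
      also have "\<dots> \<le> L2_set (\<lambda>_. 1) GI * (C * real s * decay ^ s * L2_set f F')"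
        by (intro mult_left_mono l2_boundedD[OF V(1) finGI]) simp
      also have "\<dots> = C * real s * decay ^ s * (sqrt (real (card GI)) * sqrt (real (card F')))"
      proof -
        have "L2_set f F' = sqrt (real (card F'))"
          using L2_set_indicator[OF finF'] by (metis L2_set_nonneg f_def real_sqrt_abs abs_of_nonneg)
        then show ?thesis by (simp add: L2_set_def)
      qed
      also have "\<dots> \<le> C * real s * v * (sqrt (2 ^ Suc m * cell_density G a m) * sqrt (2 ^ Suc m * cell_density F a m))"
        using s(3) cG cF C decay_bounds dF dG v by (intro mult_mono mult_left_mono) auto
      also have "sqrt (2 ^ Suc m * cell_density G a m) * sqrt (2 ^ Suc m * cell_density F a m) = 2 ^ Suc m * v"
      proof -
        have "sqrt (2 ^ Suc m * cell_density G a m) * sqrt (2 ^ Suc m * cell_density F a m) = sqrt ((2 ^ Suc m)\<^sup>2 * u)"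
          unfolding real_sqrt_mult[symmetric] by (simp add: u_def power2_eq_square mult_ac)
        also have "\<dots> = 2 ^ Suc m * v" by (simp add: real_sqrt_mult v_def)
        finally show ?thesis .
      qed
      also have "C * real s * v * (2 ^ Suc m * v) = C * real s * (2 ^ Suc m * (v * v))" by (simp add: mult_ac)
      finally show ?thesis by (simp only: v(3))
    qed
    define V' where "V' x = C * real s * (96 * cell_density F a m) + V x" for x
    have "(\<Sum>x\<in>GI. V' x) = real (card GI) * (C * real s * (96 * cell_density F a m)) + (\<Sum>x\<in>GI. V x)"
      by (simp add: V'_def sum.distrib)
    also have "\<dots> \<le> (2 ^ Suc m * cell_density G a m) * (C * real s * (96 * cell_density F a m)) + C * real s * (2 ^ Suc m * u)"
      using cG sumV C dF by (intro add_mono mult_right_mono) auto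
    also have "\<dots> = 97 * C * (2 ^ Suc m * u) * real s" by (simp add: u_def algebra_simps)
    also have "\<dots> \<le> 97 * C * (2 ^ Suc m * u) * (101 * Log u)"
      using sL C u by (intro mult_left_mono) auto
    also have "\<dots> = 9797 * C * cell_weight F G a m"
      using u by (simp add: cell_weight_def Let_def u_def[symmetric])
    finally have 1: "(\<Sum>x\<in>GI. V' x) \<le> 9797 * C * cell_weight F G a m" .
    have 2: "mscale (indicator F) k x \<le> V' x"
      if k: "k \<le> m" and x: "x \<in> dyadic_cell a m" and den: "real (card (F \<inter> {x - 2 ^ k..<x})) \<le> 96 * cell_density F a m * 2 ^ k" for k x
    proof -
      have km: "(2::int) ^ k \<le> 2 ^ m" using k by (intro power_increasing) auto
      have loc: "f (x - int n) = indicator F (x - int n)" if n: "n \<in> {1..2 ^ k}" for n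
      proof -
        have "int n \<le> 2 ^ k" using n by (metis atLeastAtMost_iff of_nat_le_iff of_nat_numeral of_nat_power)
        moreover have "a \<le> x" "x < a + 2 ^ m" using x by auto
        ultimately have "a - 2 ^ m \<le> x - int n \<and> x - int n < a + 2 ^ m" using km by linarith
        then have "x - int n \<in> double_cell a m" by simp
        then show ?thesis by (simp add: f_def F'_def indicator_def)
      qed
      have "2 ^ k * mscale (indicator F) k x = (\<Sum>n=1..2^k. mangoldt n * f (x - int n))"
      proof -
        have "(\<Sum>n=1..2^k. mangoldt n * indicator F (x - int n)) = (\<Sum>n=1..2^k. mangoldt n * f (x - int n))"
          by (intro sum.cong refl arg_cong2[of _ _ _ _ "(*)"]) (simp only: loc)
        then show ?thesis by (simp only: mscale_def) simp
      qed
      also have "\<dots> \<le> C * real s * (\<Sum>n=1..2^k. f (x - int n)) + 2 ^ k * V x" using V(3) k by blast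
      also have "(\<Sum>n=1..2^k. f (x - int n)) = (\<Sum>n=1..2^k. indicator F (x - int n))"
        using loc by (intro sum.cong refl)
      also have "\<dots> = real (card (F \<inter> {x - 2 ^ k..<x}))" using sum_indicator_window[of F x "2 ^ k"] by simp
      also have "C * real s * real (card (F \<inter> {x - 2 ^ k..<x})) \<le> C * real s * (96 * cell_density F a m * 2 ^ k)"
        using den C by (intro mult_left_mono) auto
      finally have "2 ^ k * mscale (indicator F) k x \<le> 2 ^ k * V' x" by (simp add: V'_def algebra_simps)
      then show ?thesis by simp
    qed
    show ?thesis using 1 2 unfolding GI_def by (intro exI[of _ V']) blast
  qed
  moreover have "9797 * C > 0" using C by simp
  ultimately show ?thesis by blast
qed

text \<open>
  A triple \<open>(b, j, E)\<close> stands for the cell \<open>dyadic_cell b j\<close> with its private set \<open>E\<close>. The strict inequality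
  \<open>2^j < 2 card E\<close> ensures that no cell can occur with two different private sets.
\<close>

definition sparse_cells ::
    "real \<Rightarrow> int set \<Rightarrow> int set \<Rightarrow> nat \<Rightarrow> int \<Rightarrow> (int \<times> nat \<times> int set) set \<Rightarrow> bool" where
  "sparse_cells C F G m a T \<longleftrightarrow> finite T \<and>
      (\<forall>(b, j, E)\<in>T. E \<subseteq> dyadic_cell b j \<and> E \<subseteq> dyadic_cell a m \<and> 2 ^ j < 2 * card E) \<and>
      (\<forall>t\<in>T. \<forall>t'\<in>T. t \<noteq> t' \<longrightarrow> snd (snd t) \<inter> snd (snd t') = {}) \<and>
      (\<Sum>x\<in>G \<inter> dyadic_cell a m. mscale_max (indicator F) m x) \<le> C * (\<Sum>(b, j, E)\<in>T. cell_weight F G b j)"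

text \<open>
  Stopping time induction on the size of the cell. The set \<open>B\<close> of points at which \<open>F\<close> is more than 32 times denser
  than on the whole cell covers at most a quarter of the cell. At points outside \<open>B\<close> the local estimate
  covers all scales; at a point of \<open>B\<close> it covers the scales above the size of the maximal cell
  in \<open>B\<close> around it, because the parent of that cell contains a point outside \<open>B\<close>. The smaller scales
  are left to the induction hypothesis on the maximal cells.
\<close>

lemma cell_recursion:
  "\<exists>C>0. \<forall>F G m a. finite F \<longrightarrow> finite G \<longrightarrow> (\<exists>T. sparse_cells C F G m a T)"
proof -
  from mscale_tree_sum_le obtain C where C': "C > 0 \<and> (\<forall>F G a m. finite F \<longrightarrow> finite G \<longrightarrow> cell_density F a m > 0 \<longrightarrow> cell_density G a m > 0 \<longrightarrow>
     (\<exists>V. (\<Sum>x\<in>G \<inter> dyadic_cell a m. V x) \<le> C * cell_weight F G a m \<and>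
       (\<forall>k\<le>m. \<forall>x\<in>dyadic_cell a m.
          real (card (F \<inter> {x - 2 ^ k..<x})) \<le> 96 * cell_density F a m * 2 ^ k \<longrightarrow>
          mscale (indicator F) k x \<le> V x)))"
    by (elim exE)
  note C = C'[THEN conjunct1] and tree = C'[THEN conjunct2, rule_format]
  have key: "\<exists>T. sparse_cells C F G m a T" if F: "finite F" and G: "finite G" for F G m a
  proof (induction m arbitrary: a rule: less_induct)
    case (less m)
    define I where "I = dyadic_cell a m"
    define \<delta> where "\<delta> = cell_density F a m"
    define g where "g x = mscale_max (indicator F) m x" for x
    have cardI: "card I = 2 ^ m" by (simp add: I_def nat_power_eq)
    show ?case
    proof (cases "cell_density F a m > 0 \<and> cell_density G a m > 0")
      case False
      have "(\<Sum>x\<in>G \<inter> I. g x) \<le> 0"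
      proof (rule sum_nonpos)
        fix x assume x: "x \<in> G \<inter> I"
        have "G \<inter> double_cell a m \<noteq> {}" using x by (auto simp: I_def intro: order_trans[of _ a])
        then have "cell_density G a m > 0" using G by (simp add: cell_density_def card_gt_0_iff)
        with False have "\<not> cell_density F a m > 0" by simp
        then have "card (F \<inter> double_cell a m) = 0" by (simp add: cell_density_def zero_less_divide_iff)
        then have F0: "F \<inter> double_cell a m = {}" using F by simp
        show "g x \<le> 0" unfolding g_def
        proof (rule mscale_max_le)
          fix k assume k: "k \<le> m"
          have "(\<Sum>n=1..2^k. mangoldt n * indicator F (x - int n) :: real) = 0"
          proof (rule sum.neutral, rule ballI)
            fix n :: nat assume n: "n \<in> {1..2^k}"
            have km: "(2::nat) ^ k \<le> 2 ^ m" using k by (intro power_increasing) auto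
            have "n \<le> 2 ^ m" by (rule order_trans[OF _ km]) (use n in simp)
            then have "int n \<le> 2 ^ m" by (metis of_nat_le_iff of_nat_numeral of_nat_power)
            moreover have "a \<le> x" "x < a + 2 ^ m" using x by (auto simp: I_def)
            ultimately have "a - 2 ^ m \<le> x - int n \<and> x - int n < a + 2 ^ m" by linarith
            then have "x - int n \<notin> F" using F0 by auto
            then show "mangoldt n * indicator F (x - int n) = (0::real)" by simp
          qed
          then show "mscale (indicator F) k x \<le> 0" by (simp only: mscale_def)
        qed
      qed
      then show ?thesis by (intro exI[of _ "{}"]) (auto simp: sparse_cells_def I_def g_def)
    next
      case True
      then have \<delta>: "\<delta> > 0" by (simp add: \<delta>_def)
      obtain V where V: "(\<Sum>x\<in>G \<inter> I. V x) \<le> C * cell_weight F G a m"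
        "\<And>k x. k \<le> m \<Longrightarrow> x \<in> I \<Longrightarrow> real (card (F \<inter> {x - 2 ^ k..<x})) \<le> 96 * \<delta> * 2 ^ k \<Longrightarrow> mscale (indicator F) k x \<le> V x"
        using tree[OF F G, of a m] True unfolding I_def \<delta>_def by blast
      define F' where "F' = F \<inter> double_cell a m"
      have finF': "finite F'" using F by (simp add: F'_def)
      have cF': "real (card F') = 2 * 2 ^ m * \<delta>" by (simp add: \<delta>_def cell_density_def F'_def)
      (* Each one-sided maximal bound costs a factor 2, and the doubled cell has twice the
         length: this leaves 8 / 32 of the cell. *)
      define B where "B = {x\<in>I. (\<exists>N\<ge>1. (32 * \<delta>) * real N < real (card (F' \<inter> {x - int N..<x})))
        \<or> (\<exists>N\<ge>1. (32 * \<delta>) * real N < real (card (F' \<inter> {x..<x + int N})))}"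
      have BI: "B \<subseteq> I" by (auto simp: B_def)
      have finB: "finite B" using BI by (rule finite_subset) (simp add: I_def)
      have "(32 * \<delta>) * real (card B) \<le> 4 * real (card F')"
        unfolding B_def by (rule card_two_sided_maximal_le) (use finF' \<delta> in \<open>auto simp: I_def\<close>)
      then have "\<delta> * (32 * real (card B)) \<le> \<delta> * (8 * 2 ^ m)" by (simp add: cF')
      then have "32 * real (card B) \<le> 8 * 2 ^ m" using \<delta> by simp
      then have "4 * real (card B) \<le> real (2 ^ m)" by simp
      then have cB: "4 * card B \<le> 2 ^ m" by (metis of_nat_le_iff of_nat_mult of_nat_numeral)
      have "B \<noteq> I" using cB cardI by auto
      then have BI': "B \<subset> dyadic_cell a m" using BI by (auto simp: I_def)
      obtain j where j: "\<And>x. x \<in> B \<Longrightarrow> j x < m" "\<And>x. x \<in> B \<Longrightarrow> cell a (j x) x \<subseteq> B"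
        "\<And>x. x \<in> B \<Longrightarrow> \<not> cell a (Suc (j x)) x \<subseteq> B" "\<And>x y. x \<in> B \<Longrightarrow> y \<in> cell a (j x) x \<Longrightarrow> j y = j x"
        using maximal_cells[OF BI'] by blast
      define J where "J = (\<lambda>x. (cell_start a (j x) x, j x)) ` B"
      define cl where "cl t = {fst t..<fst t + 2 ^ snd t}" for t :: "int \<times> nat"
      have finJ: "finite J" using finB by (simp add: J_def)
      have Jm: "snd t < m" if "t \<in> J" for t using that j(1) by (auto simp: J_def)
      have cl_cell: "cl (cell_start a (j x) x, j x) = cell a (j x) x" for x by (simp add: cl_def cell_def)
      have clB: "cl t \<subseteq> B" if "t \<in> J" for t
      proof -
        obtain x where "x \<in> B" "t = (cell_start a (j x) x, j x)" using \<open>t \<in> J\<close> unfolding J_def by blast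
        then show ?thesis using j(2) by (simp only: cl_cell)
      qed
      have clU: "(\<Union>t\<in>J. cl t) = B"
      proof
        show "(\<Union>t\<in>J. cl t) \<subseteq> B" using clB by auto
        show "B \<subseteq> (\<Union>t\<in>J. cl t)"
        proof
          fix x assume "x \<in> B"
          then have "(cell_start a (j x) x, j x) \<in> J" by (simp add: J_def)
          moreover have "x \<in> cl (cell_start a (j x) x, j x)" by (simp only: cl_cell self_mem_cell)
          ultimately show "x \<in> (\<Union>t\<in>J. cl t)" by blast
        qed
      qed
      have cl_unique: "t = (cell_start a (j y) y, j y)" if "t \<in> J" "y \<in> cl t" for t y
      proof -
        obtain x where x: "x \<in> B" "t = (cell_start a (j x) x, j x)" using \<open>t \<in> J\<close> unfolding J_def by blast
        then have y: "y \<in> cell a (j x) x" using that(2) by (simp only: cl_cell)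
        then show ?thesis using x j(4)[OF x(1) y] cell_start_eq[OF y] by simp
      qed
      have disj: "cl t \<inter> cl t' = {}" if "t \<in> J" "t' \<in> J" "t \<noteq> t'" for t t'
        using cl_unique[OF that(1)] cl_unique[OF that(2)] that(3) by blast
      have "\<exists>T. sparse_cells C F G (snd t) (fst t) T" if "t \<in> J" for t using less.IH[OF Jm[OF that]] by blast
      then obtain TT where TT: "\<And>t. t \<in> J \<Longrightarrow> sparse_cells C F G (snd t) (fst t) (TT t)" by metis
      define T where "T = insert (a, m, I - B) (\<Union>t\<in>J. TT t)"
      have TTfin: "finite (TT t)" if "t \<in> J" for t using TT[OF that] by (simp add: sparse_cells_def)
      have TTsub: "E \<subseteq> cl t" "E \<subseteq> dyadic_cell b i" "2 ^ i < 2 * card E" if "t \<in> J" "(b, i, E) \<in> TT t" for t b i E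
        using TT[OF that(1)] that(2) by (auto simp: sparse_cells_def cl_def)
      have TTdisj: "snd (snd u) \<inter> snd (snd u') = {}" if "t \<in> J" "u \<in> TT t" "u' \<in> TT t" "u \<noteq> u'" for t u u'
        using TT[OF that(1)] that by (auto simp: sparse_cells_def)
      have TTne: "snd (snd u) \<noteq> {}" and TTcl: "snd (snd u) \<subseteq> cl t" if "t \<in> J" "u \<in> TT t" for t u
        using TTsub[of t "fst u" "fst (snd u)" "snd (snd u)"] that by auto
      have TTinter: "TT t \<inter> TT t' = {}" if "t \<in> J" "t' \<in> J" "t \<noteq> t'" for t t'
        using TTne TTcl disj[OF that] that by blast
      have top_new: "(a, m, I - B) \<notin> (\<Union>t\<in>J. TT t)"
      proof
        assume "(a, m, I - B) \<in> (\<Union>t\<in>J. TT t)"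
        then obtain t where t: "t \<in> J" "(a, m, I - B) \<in> TT t" by auto
        from TTcl[OF t] TTne[OF t] clB[OF t(1)] show False by auto
      qed
      have top_size: "2 ^ m < 2 * card (I - B)"
      proof -
        have "card (I - B) = 2 ^ m - card B" using BI finB cardI by (simp add: card_Diff_subset)
        moreover have "(2::nat) ^ m > 0" by simp
        ultimately show ?thesis using cB by linarith
      qed
      have "(\<Sum>x\<in>G \<inter> I. g x) \<le> (\<Sum>x\<in>G \<inter> I. V x + (if x \<in> B then mscale_max (indicator F) (j x) x else 0))"
      proof (rule sum_mono)
        fix x assume x: "x \<in> G \<inter> I"
        have mm0: "mscale_max (indicator F) i x \<ge> 0" for i
          using mscale_le_max[of 0 i "indicator F" x] mscale_nonneg[of "indicator F" 0 x] by simp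
        have inF': "F \<inter> W = F' \<inter> W" if "W \<subseteq> double_cell a m" for W using that by (auto simp: F'_def)
        have notB: "real (card (F' \<inter> {z - 2 ^ i..<z})) \<le> 32 * \<delta> * 2 ^ i" "real (card (F' \<inter> dyadic_cell z i)) \<le> 32 * \<delta> * 2 ^ i"
          if "z \<in> I" "z \<notin> B" for z i
        proof -
          have "\<not> (32 * \<delta>) * real (2 ^ i) < real (card (F' \<inter> {z - int (2 ^ i)..<z}))"
            "\<not> (32 * \<delta>) * real (2 ^ i) < real (card (F' \<inter> {z..<z + int (2 ^ i)}))"
            using that unfolding B_def by (auto simp del: of_nat_power dest!: spec[of _ "2 ^ i"])
          then show "real (card (F' \<inter> {z - 2 ^ i..<z})) \<le> 32 * \<delta> * 2 ^ i" "real (card (F' \<inter> dyadic_cell z i)) \<le> 32 * \<delta> * 2 ^ i"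
            by simp_all
        qed
        have V0: "V x \<ge> 0" if "real (card (F \<inter> {x - 2 ^ k..<x})) \<le> 96 * \<delta> * 2 ^ k" "k \<le> m" for k
          using V(2)[OF that(2) _ that(1)] x mscale_nonneg[of "indicator F" k x] by (auto intro: order_trans)
        have window: "{x - 2 ^ k..<x} \<subseteq> double_cell a m" if "k \<le> m" for k
        proof -
          have "(2::int) ^ k \<le> 2 ^ m" using that by (intro power_increasing) auto
          moreover have "a \<le> x" "x < a + 2 ^ m" using x by (auto simp: I_def)
          ultimately have "a - 2 ^ m \<le> y \<and> y < a + 2 ^ m" if "x - 2 ^ k \<le> y" "y < x" for y
            using that by linarith
          then show ?thesis by (intro subsetI) simp
        qed
        show "g x \<le> V x + (if x \<in> B then mscale_max (indicator F) (j x) x else 0)"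
        proof (cases "x \<in> B")
          case False
          have "mscale (indicator F) k x \<le> V x" if k: "k \<le> m" for k
          proof (rule V(2)[OF k])
            have "real (card (F \<inter> {x - 2 ^ k..<x})) \<le> 32 * \<delta> * 2 ^ k"
              using notB(1)[of x k] False x inF'[OF window[OF k]] by simp
            also have "\<dots> \<le> 96 * \<delta> * 2 ^ k" using \<delta> by simp
            finally show "real (card (F \<inter> {x - 2 ^ k..<x})) \<le> 96 * \<delta> * 2 ^ k" .
          qed (use x in auto)
          then show ?thesis using False by (simp add: g_def mscale_max_le)
        next
          case xB: True
          (* The parent of the maximal cell around x is not contained in B. *)
          obtain z where z: "z \<in> cell a (Suc (j x)) x" "z \<notin> B" using j(3)[OF xB] by auto
          have "cell a (Suc (j x)) x \<subseteq> cell a m x" using j(1)[OF xB] by (intro cell_mono) simp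
          also have "\<dots> = I" using x cell_top[of x a m] by (auto simp: I_def)
          finally have zI: "z \<in> I" using z by auto
          have zx: "\<bar>z - x\<bar> < 2 ^ Suc (j x)"
            using z(1) self_mem_cell[of x a "Suc (j x)"] unfolding cell_def by auto
          have large: "mscale (indicator F) k x \<le> V x \<and> V x \<ge> 0" if k: "k \<le> m" "j x < k" for k
          proof -
            have le: "(2::int) ^ Suc (j x) \<le> 2 ^ k" using k(2) by (intro power_increasing) auto
            (* The good point z lies in the parent cell, so within distance 2^k of x; the three windows
               of length 2^k account for the constant 96 = 3 * 32. *)
            have "{x - 2 ^ k..<x} \<subseteq> {z - 2 ^ Suc k..<z} \<union> dyadic_cell z k" using zx le by auto
            then have "F' \<inter> {x - 2 ^ k..<x} \<subseteq> (F' \<inter> {z - 2 ^ Suc k..<z}) \<union> (F' \<inter> dyadic_cell z k)" by auto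
            then have "card (F' \<inter> {x - 2 ^ k..<x}) \<le> card ((F' \<inter> {z - 2 ^ Suc k..<z}) \<union> (F' \<inter> dyadic_cell z k))"
              using finF' by (intro card_mono) auto
            also have "\<dots> \<le> card (F' \<inter> {z - 2 ^ Suc k..<z}) + card (F' \<inter> dyadic_cell z k)" by (rule card_Un_le)
            finally have "real (card (F' \<inter> {x - 2 ^ k..<x})) \<le> real (card (F' \<inter> {z - 2 ^ Suc k..<z})) + real (card (F' \<inter> dyadic_cell z k))"
              by (metis of_nat_add of_nat_le_iff)
            also have "\<dots> \<le> 32 * \<delta> * 2 ^ Suc k + 32 * \<delta> * 2 ^ k" by (intro add_mono notB zI z(2))
            also have "\<dots> = 96 * \<delta> * 2 ^ k" by simp
            finally have "real (card (F \<inter> {x - 2 ^ k..<x})) \<le> 96 * \<delta> * 2 ^ k" using inF'[OF window[OF k(1)]] by simp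
            then show ?thesis using V(2)[OF k(1)] V0[OF _ k(1)] x by auto
          qed
          have V0x: "V x \<ge> 0" using large[of m] j(1)[OF xB] by simp
          have "mscale (indicator F) k x \<le> V x + mscale_max (indicator F) (j x) x" if k: "k \<le> m" for k
          proof (cases "k \<le> j x")
            case True
            then show ?thesis using mscale_le_max[OF True, of "indicator F" x] V0x by linarith
          next
            case False
            then show ?thesis using large[OF k] mm0[of "j x"] by simp
          qed
          then show ?thesis using xB by (simp add: g_def mscale_max_le)
        qed
      qed
      also have "\<dots> = (\<Sum>x\<in>G \<inter> I. V x) + (\<Sum>x\<in>G \<inter> I. if x \<in> B then mscale_max (indicator F) (j x) x else 0)"
        by (rule sum.distrib)
      also have "(\<Sum>x\<in>G \<inter> I. if x \<in> B then mscale_max (indicator F) (j x) x else 0)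
          = (\<Sum>x\<in>(\<Union>t\<in>J. G \<inter> cl t). mscale_max (indicator F) (j x) x)"
      proof (rule sum.mono_neutral_cong_right)
        have U: "(\<Union>t\<in>J. G \<inter> cl t) = G \<inter> B" using clU by auto
        show "(\<Union>t\<in>J. G \<inter> cl t) \<subseteq> G \<inter> I" unfolding U using BI by auto
        show "\<forall>x\<in>G \<inter> I - (\<Union>t\<in>J. G \<inter> cl t). (if x \<in> B then mscale_max (indicator F) (j x) x else 0) = 0"
          unfolding U by auto
        show "(if x \<in> B then mscale_max (indicator F) (j x) x else 0) = mscale_max (indicator F) (j x) x"
          if "x \<in> (\<Union>t\<in>J. G \<inter> cl t)" for x using that unfolding U by auto
      qed (use G in auto)
      also have "\<dots> = (\<Sum>t\<in>J. \<Sum>x\<in>G \<inter> cl t. mscale_max (indicator F) (j x) x)"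
      proof (rule sum.UNION_disjoint[OF finJ])
        show "\<forall>t\<in>J. \<forall>t'\<in>J. t \<noteq> t' \<longrightarrow> (G \<inter> cl t) \<inter> (G \<inter> cl t') = {}" using disj by blast
      qed (use G in auto)
      also have "\<dots> \<le> (\<Sum>t\<in>J. C * (\<Sum>(b, j, E)\<in>TT t. cell_weight F G b j))"
      proof (rule sum_mono)
        fix t assume t: "t \<in> J"
        have "j x = snd t" if "x \<in> cl t" for x using cl_unique[OF t that] by simp
        then have "(\<Sum>x\<in>G \<inter> cl t. mscale_max (indicator F) (j x) x) = (\<Sum>x\<in>G \<inter> cl t. mscale_max (indicator F) (snd t) x)"
          by (intro sum.cong refl) simp
        also have "\<dots> \<le> C * (\<Sum>(b, j, E)\<in>TT t. cell_weight F G b j)"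
          using TT[OF t] by (simp add: sparse_cells_def cl_def)
        finally show "(\<Sum>x\<in>G \<inter> cl t. mscale_max (indicator F) (j x) x) \<le> C * (\<Sum>(b, j, E)\<in>TT t. cell_weight F G b j)" .
      qed
      also have "\<dots> = C * (\<Sum>(b, j, E)\<in>(\<Union>t\<in>J. TT t). cell_weight F G b j)"
        unfolding sum_distrib_left[symmetric]
        by (subst sum.UNION_disjoint[OF finJ]) (use TTfin TTinter in auto)
      finally have fin1: "(\<Sum>x\<in>G \<inter> I. g x)
          \<le> (\<Sum>x\<in>G \<inter> I. V x) + C * (\<Sum>(b, j, E)\<in>(\<Union>t\<in>J. TT t). cell_weight F G b j)" by simp
      have main: "(\<Sum>x\<in>G \<inter> I. g x) \<le> C * (\<Sum>(b, j, E)\<in>T. cell_weight F G b j)"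
      proof -
        have "finite (\<Union>t\<in>J. TT t)" using finJ TTfin by blast
        then have "(\<Sum>(b, j, E)\<in>T. cell_weight F G b j)
            = cell_weight F G a m + (\<Sum>(b, j, E)\<in>(\<Union>t\<in>J. TT t). cell_weight F G b j)"
          unfolding T_def using sum.insert[OF _ top_new, of "\<lambda>(b, j, E). cell_weight F G b j"] by simp
        then have "C * (\<Sum>(b, j, E)\<in>T. cell_weight F G b j)
            = C * cell_weight F G a m + C * (\<Sum>(b, j, E)\<in>(\<Union>t\<in>J. TT t). cell_weight F G b j)"
          by (simp only: distrib_left)
        with V(1) fin1 show ?thesis by linarith
      qed
      have "sparse_cells C F G m a T"
        unfolding sparse_cells_def
      proof (intro conjI)
        show "finite T" using finJ TTfin by (simp add: T_def)
        show "\<forall>(b, j, E)\<in>T. E \<subseteq> dyadic_cell b j \<and> E \<subseteq> dyadic_cell a m \<and> 2 ^ j < 2 * card E"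
        proof (clarify, intro conjI)
          fix b i E assume t: "(b, i, E) \<in> T"
          from t consider "b = a" "i = m" "E = I - B" | t' where "t' \<in> J" "(b, i, E) \<in> TT t'"
            unfolding T_def by blast
          then have "E \<subseteq> dyadic_cell b i \<and> E \<subseteq> dyadic_cell a m \<and> 2 ^ i < 2 * card E"
          proof cases
            case 1
            then show ?thesis using top_size by (auto simp: I_def)
          next
            case 2
            then show ?thesis using TTsub[OF 2] clB[OF 2(1)] BI unfolding I_def by blast
          qed
          then show "E \<subseteq> dyadic_cell b i" "E \<subseteq> dyadic_cell a m" "2 ^ i < 2 * card E" by blast+
        qed
        show "\<forall>t\<in>T. \<forall>t'\<in>T. t \<noteq> t' \<longrightarrow> snd (snd t) \<inter> snd (snd t') = {}"
        proof (intro ballI impI)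
          fix u u' assume u: "u \<in> T" "u' \<in> T" "u \<noteq> u'"
          have top: "(I - B) \<inter> snd (snd w) = {}" if "w \<in> (\<Union>t\<in>J. TT t)" for w
            using that TTcl clB by blast
          consider "u = (a, m, I - B)" "u' \<in> (\<Union>t\<in>J. TT t)" | "u' = (a, m, I - B)" "u \<in> (\<Union>t\<in>J. TT t)"
            | t t' where "t \<in> J" "t' \<in> J" "u \<in> TT t" "u' \<in> TT t'"
            using u unfolding T_def by blast
          then show "snd (snd u) \<inter> snd (snd u') = {}"
          proof cases
            case 1 then show ?thesis using top by simp
          next
            case 2 then show ?thesis using top by (simp add: Int_commute)
          next
            case 3
            then show ?thesis using TTdisj[OF 3(1,3)] u(3) disj[OF 3(1,2)] TTcl[OF 3(1,3)] TTcl[OF 3(2,4)]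
              by (cases "t = t'") blast+
          qed
        qed
        show "(\<Sum>x\<in>G \<inter> dyadic_cell a m. mscale_max (indicator F) m x) \<le> C * (\<Sum>(b, j, E)\<in>T. cell_weight F G b j)"
          using main by (simp add: g_def I_def)
      qed
      then show ?thesis by blast
    qed
  qed
  show ?thesis
    by (intro exI[of _ C] conjI allI impI C key) assumption+
qed

section \<open>Sparse domination\<close>

lemma mult_Log_le_powr:
  assumes u: "0 < u" "u \<le> (1::real)" and p: "1 < p" "p < 2"
  shows "u * Log u \<le> 3 / (p - 1) * u powr (1 / p)"
proof -
  define e where "e = 1 - 1 / p"
  have e: "e \<ge> (p - 1) / 2" "e > 0"
  proof -
    have "e = (p - 1) / p" using p by (simp add: e_def field_simps)
    moreover have "(p - 1) / p \<ge> (p - 1) / 2" using p by (intro divide_left_mono) auto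
    ultimately show "e \<ge> (p - 1) / 2" by simp
    then show "e > 0" using p by simp
  qed
  define y where "y = u powr (- e)"
  have y1: "y \<ge> 1"
  proof -
    have "u powr e \<le> 1" "u powr e > 0" using u e by (auto intro: powr_le1)
    then show ?thesis by (simp add: y_def powr_minus_divide)
  qed
  have "ln y = - e * ln u" using u by (simp add: y_def ln_powr)
  then have "- ln u = ln y / e" using e by (simp add: field_simps)
  also have "\<dots> \<le> y / e" using e y1 ln_le_minus_one[of y] by (intro divide_right_mono) auto
  also have "\<dots> \<le> y / ((p - 1) / 2)" using e p y1 by (intro divide_left_mono) auto
  finally have l: "- ln u \<le> 2 / (p - 1) * y" by (simp add: field_simps)
  have "1 \<le> 1 / (p - 1)" using p by simp
  then have "1 * 1 \<le> 1 / (p - 1) * y" using y1 p by (intro mult_mono) auto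
  moreover have "3 / (p - 1) * y = 2 / (p - 1) * y + 1 / (p - 1) * y"
    by (simp add: add_divide_distrib[symmetric] distrib_right[symmetric])
  moreover have "Log u = 1 - ln u" using u by (simp add: Log_def abs_of_nonpos)
  ultimately have "Log u \<le> 3 / (p - 1) * y" using l by linarith
  then have "u * Log u \<le> u * (3 / (p - 1) * y)" using u by (intro mult_left_mono) auto
  also have "\<dots> = 3 / (p - 1) * (u powr 1 * u powr (- e))" using u by (simp add: y_def)
  also have "u powr 1 * u powr (- e) = u powr (1 / p)" by (simp only: powr_add[symmetric] e_def) simp
  finally show ?thesis .
qed

lemma card_cell_star: "real (card (double_cell b j)) = 2 ^ Suc j" for b :: int
  by (simp add: nat_mult_distrib nat_power_eq)

lemma local_avg_indicator:
  "local_avg p (double_cell b j) (ind F) = cell_density F b j powr (1 / p)"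
proof -
  have "(\<Sum>x\<in>double_cell b j. norm (indicator F x :: real) powr p) = (\<Sum>x\<in>double_cell b j. indicator F x)"
    by (intro sum.cong refl) (simp add: indicator_def)
  also have "\<dots> = real (card (F \<inter> double_cell b j))"
    by (simp add: indicator_def sum.If_cases Int_def conj_commute)
  finally show ?thesis unfolding local_avg_def card_cell_star by (simp add: cell_density_def)
qed

lemma cell_weight_le_local_avg:
  assumes p: "1 < p" "p < 2"
  defines "I \<equiv> \<lambda>b j. double_cell b j"
  shows "cell_weight F G b j \<le> 3 / (p - 1) *
    (local_avg p (I b j) (ind F) * local_avg p (I b j) (ind G) * real (card (I b j)))"
proof -
  define u where "u = cell_density F b j * cell_density G b j"
  have u: "0 \<le> u" "u \<le> 1" using cell_density_bounds[of F b j] cell_density_bounds[of G b j] by (auto simp: u_def mult_le_one)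
  have eq: "local_avg p (I b j) (ind F) * local_avg p (I b j) (ind G) * real (card (I b j))
     = 2 ^ Suc j * u powr (1 / p)"
    unfolding I_def local_avg_indicator card_cell_star u_def
    using cell_density_bounds[of F b j] cell_density_bounds[of G b j] by (simp add: powr_mult)
  show ?thesis
  proof (cases "u = 0")
    case True
    then show ?thesis unfolding eq using p by (simp add: cell_weight_def Let_def u_def[symmetric])
  next
    case False
    then have "u * Log u \<le> 3 / (p - 1) * u powr (1 / p)" using u p by (intro mult_Log_le_powr) auto
    then have "2 ^ Suc j * (u * Log u) \<le> 2 ^ Suc j * (3 / (p - 1) * u powr (1 / p))" by (intro mult_left_mono) auto
    then show ?thesis unfolding eq using False by (simp add: cell_weight_def Let_def u_def[symmetric] mult_ac)
  qed
qed

text \<open>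
  Once a window reaches past all points of \<open>F\<close> to the left of \<open>x\<close>, longer windows only decrease the average.
\<close>

lemma A_star_le_mscale_max:
  fixes F :: "int set"
  assumes "\<And>y. y \<in> F \<Longrightarrow> y < x \<Longrightarrow> x - 2 ^ m \<le> y"
  shows "A_star (ind F) x \<le> ennreal (2 * mscale_max (indicator F) m x)"
  unfolding A_star_def
proof (rule SUP_least, rule ennreal_leI)
  fix N :: nat assume "N \<in> {1..}"
  then have N: "N \<ge> 1" by simp
  define f where "f = (ind F)"
  have f0: "f y \<ge> 0" for y by (simp add: f_def)
  show "norm (avg_N N (indicator F) x :: real) \<le> 2 * mscale_max (indicator F) m x"
  proof (cases "N \<le> 2 ^ m")
    case True
    obtain k where k: "2 ^ k < 2 * N" "norm (avg_N N f x) \<le> 2 * mscale f k x"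
      using avg_N_le_mscale[of f N x, OF f0 N] by blast
    have "(2::nat) ^ k < 2 ^ Suc m" using k(1) True by simp
    then have "k \<le> m" by (simp only: power_strict_increasing_iff less_Suc_eq_le)
    then have "mscale f k x \<le> mscale_max f m x" by (rule mscale_le_max)
    with k(2) show ?thesis by (simp add: f_def)
  next
    case False
    have "norm (avg_N N f x) = (\<Sum>n=1..N. mangoldt n * f (x - int n)) / real N"
      using f0 by (simp add: avg_N_def sum_nonneg mangoldt_nonneg divide_inverse mult.commute)
    also have "(\<Sum>n=1..N. mangoldt n * f (x - int n)) = (\<Sum>n=1..2^m. mangoldt n * f (x - int n))"
    proof (rule sum.mono_neutral_right)
      show "\<forall>n\<in>{1..N} - {1..2 ^ m}. mangoldt n * f (x - int n) = 0"
      proof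
        fix n assume n: "n \<in> {1..N} - {1..(2::nat) ^ m}"
        then have "2 ^ m < n" by auto
        then have "(2::int) ^ m < int n" by (metis of_nat_less_iff of_nat_numeral of_nat_power)
        then have "x - int n \<notin> F" using assms[of "x - int n"] n by auto
        then show "mangoldt n * f (x - int n) = 0" by (simp add: f_def)
      qed
    qed (use False in auto)
    also have "(\<Sum>n=1..2^m. mangoldt n * f (x - int n)) / real N \<le> (\<Sum>n=1..2^m. mangoldt n * f (x - int n)) / 2 ^ m"
    proof (rule divide_left_mono)
      have "real (2 ^ m) \<le> real N" using False by (intro of_nat_mono) simp
      then show "2 ^ m \<le> real N" by simp
    qed (use f0 N in \<open>auto simp: sum_nonneg mangoldt_nonneg\<close>)
    also have "\<dots> = mscale f m x" by (simp add: mscale_def)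
    also have "\<dots> \<le> mscale_max f m x" by (rule mscale_le_max) simp
    also have "\<dots> \<le> 2 * mscale_max f m x"
      using mscale_le_max[of m m f x] mscale_nonneg[of f m x] f0 by simp
    finally show ?thesis by (simp add: f_def)
  qed
qed

lemma pairing_indicator:
  assumes "finite G"
  shows "pairing u (indicator G) = (\<Sum>x\<in>G. u x)"
proof -
  have "pairing u (indicator G) = (\<Sum>\<^sub>\<infinity>x\<in>G. u x)"
    unfolding pairing_def by (rule infsum_cong_neutral) (auto simp: indicator_def)
  then show ?thesis using assms by simp
qed

text \<open>
  One cell large enough to contain \<open>F\<close> and \<open>G\<close> is fed into \<open>cell_recursion\<close>. The intervals of the sparse
  family are the doubled cells, of which the private sets still fill more than a quarter.
\<close>

theorem sparse_bound:
  "\<exists>C>0. \<forall>(p::real) (F::int set) (G::int set). 1 < p \<longrightarrow> p < 2 \<longrightarrow> finite F \<longrightarrow> finite G \<longrightarrow>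
     (\<exists>S. sparse_family S \<and> pairing (A_star (ind F)) (indicator G)
       \<le> ennreal (C / (p - 1)) * sparse_form p S (ind F) (ind G))"
proof -
  from cell_recursion obtain C where C': "C > 0 \<and> (\<forall>F G m a. finite F \<longrightarrow> finite G \<longrightarrow> (\<exists>T. sparse_cells C F G m a T))"
    by (elim exE)
  note C = C'[THEN conjunct1] and rec = C'[THEN conjunct2, rule_format]
  have "\<exists>S. sparse_family S \<and> pairing (A_star (ind F)) (indicator G)
       \<le> ennreal (6 * C / (p - 1)) * sparse_form p S (ind F) (ind G)"
    if p: "1 < p" "p < 2" and F: "finite F" and G: "finite G" for p and F G :: "int set"
  proof -
    (* The cell [-M, -M + 2^m) contains F and G, and windows of length 2^m reach across both. *)
    define M where "M = nat (Max (insert 1 (abs ` (F \<union> G)))) + 1"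
    have M: "\<bar>z\<bar> < int M" if "z \<in> F \<union> G" for z
    proof -
      have "\<bar>z\<bar> \<le> Max (insert 1 (abs ` (F \<union> G)))" using that F G by (intro Max_ge) auto
      then show ?thesis unfolding M_def by linarith
    qed
    define m where "m = 2 * M"
    define a where "a = - int M"
    have "2 * M < 2 ^ m" unfolding m_def by (rule less_exp)
    then have "int (2 * M) < int (2 ^ m)" by (simp only: of_nat_less_iff)
    then have Mm: "2 * int M < 2 ^ m" by simp
    have GI: "G \<inter> dyadic_cell a m = G"
    proof -
      have "a \<le> z \<and> z < a + 2 ^ m" if "z \<in> G" for z using M[of z] that Mm unfolding a_def by auto
      then show ?thesis by auto
    qed
    obtain T where T: "finite T"
      "\<And>b j E. (b, j, E) \<in> T \<Longrightarrow> E \<subseteq> dyadic_cell b j \<and> 2 ^ j < 2 * card E"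
      "\<And>t t'. t \<in> T \<Longrightarrow> t' \<in> T \<Longrightarrow> t \<noteq> t' \<Longrightarrow> snd (snd t) \<inter> snd (snd t') = {}"
      "(\<Sum>x\<in>G. mscale_max (indicator F) m x) \<le> C * (\<Sum>(b, j, E)\<in>T. cell_weight F G b j)"
    proof -
      obtain T where "sparse_cells C F G m a T" using rec[OF F G, of m a] by (elim exE)
      note Tc = this[unfolded sparse_cells_def GI]
      note T = Tc[THEN conjunct1] Tc[THEN conjunct2, THEN conjunct1]
        Tc[THEN conjunct2, THEN conjunct2, THEN conjunct1] Tc[THEN conjunct2, THEN conjunct2, THEN conjunct2]
      show ?thesis
      proof (rule that[OF T(1) _ _ T(4)])
        fix b j E assume "(b, j, E) \<in> T"
        from bspec[OF T(2) this] show "E \<subseteq> dyadic_cell b j \<and> 2 ^ j < 2 * card E" by simp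
      qed (use T(3) in blast)
    qed
    define iv where "iv t = {fst t - 2 ^ fst (snd t)..<fst t + 2 ^ fst (snd t)}" for t :: "int \<times> nat \<times> int set"
    have inj: "inj_on iv T"
    proof (rule inj_onI)
      fix t t' assume t: "t \<in> T" "t' \<in> T" "iv t = iv t'"
      obtain b j E b' j' E' where e: "t = (b, j, E)" "t' = (b', j', E')" by (metis prod.collapse)
      have ne: "b - 2 ^ j < b + 2 ^ j" "b' - 2 ^ j' < b' + 2 ^ j'"
      proof -
        have "(0::int) < 2 ^ j" "(0::int) < 2 ^ j'" by simp_all
        then show "b - 2 ^ j < b + 2 ^ j" "b' - 2 ^ j' < b' + 2 ^ j'" by linarith+
      qed
      have "double_cell b j = double_cell b' j'" using t(3) by (simp add: iv_def e)
      then have "b - 2 ^ j = b' - 2 ^ j' \<and> b + 2 ^ j = b' + 2 ^ j'" using ne by (simp add: atLeastLessThan_eq_iff)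
      then have bj: "b = b'" "(2::int) ^ j = 2 ^ j'" by linarith+
      then have "j = j'" by simp
      show "t = t'"
      proof (rule ccontr)
        assume ne: "t \<noteq> t'"
        have E: "E \<subseteq> dyadic_cell b j" "2 ^ j < 2 * card E" "E' \<subseteq> dyadic_cell b j" "2 ^ j < 2 * card E'"
          using T(2)[of b j E] T(2)[of b' j' E'] t e bj \<open>j = j'\<close> by auto
        have "E \<inter> E' = {}" using T(3)[OF t(1,2) ne] by (simp add: e)
        then have "card E + card E' = card (E \<union> E')"
          using E by (intro card_Un_disjoint[symmetric]) (auto intro: finite_subset)
        also have "\<dots> \<le> card (dyadic_cell b j)" using E by (intro card_mono) auto
        also have "\<dots> = 2 ^ j" by (simp add: nat_power_eq)
        finally show False using E by linarith
      qed
    qed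
    define S where "S = iv ` T"
    have finS: "finite S" using T(1) by (simp add: S_def)
    have sp: "sparse_family S"
      unfolding sparse_family_def
    proof (intro conjI ballI)
      fix I assume "I \<in> S"
      then obtain t where t: "t \<in> T" "I = iv t" by (auto simp: S_def)
      have "(1::int) \<le> 2 ^ fst (snd t)" by simp
      then have "fst t - 2 ^ fst (snd t) \<le> fst t + 2 ^ fst (snd t) - 1" by linarith
      moreover have "iv t = {fst t - 2 ^ fst (snd t)..fst t + 2 ^ fst (snd t) - 1}" by (auto simp: iv_def)
      ultimately show "is_interval_int I" unfolding is_interval_int_def t(2) by blast
    next
      define Ef where "Ef I = snd (snd (inv_into T iv I))" for I
      have Ef: "Ef (iv t) = snd (snd t)" if "t \<in> T" for t using inj that by (simp add: Ef_def)
      show "\<exists>E. (\<forall>I\<in>S. E I \<subseteq> I \<and> card I \<le> 4 * card (E I)) \<and> (\<forall>I\<in>S. \<forall>J\<in>S. I \<noteq> J \<longrightarrow> E I \<inter> E J = {})"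
      proof (intro exI[of _ Ef] conjI ballI impI)
        fix I assume "I \<in> S"
        then obtain t where t: "t \<in> T" "I = iv t" by (auto simp: S_def)
        obtain b j E where e: "t = (b, j, E)" by (metis prod.collapse)
        have E: "E \<subseteq> dyadic_cell b j" "2 ^ j < 2 * card E" using T(2)[of b j E] t e by auto
        have sub: "dyadic_cell b j \<subseteq> double_cell b j" by (auto intro: order_trans[of _ b])
        have "Ef I = snd (snd t)" unfolding t(2) by (rule Ef[OF t(1)])
        then have EI: "Ef I = E" using e by simp
        have Ib: "I = double_cell b j" unfolding t(2) iv_def e by simp
        show "Ef I \<subseteq> I" unfolding EI unfolding Ib using E(1) sub by (rule order_trans)
        have "card I = 2 * 2 ^ j" by (simp add: Ib nat_mult_distrib nat_power_eq)
        then show "card I \<le> 4 * card (Ef I)" unfolding EI using E(2) by linarith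
      next
        fix I J assume IJ: "I \<in> S" "J \<in> S" "I \<noteq> J"
        from IJ(1) obtain t where t: "t \<in> T" "I = iv t" unfolding S_def by blast
        from IJ(2) obtain t' where t': "t' \<in> T" "J = iv t'" unfolding S_def by blast
        have "t \<noteq> t'" using IJ(3) t(2) t'(2) by blast
        then show "Ef I \<inter> Ef J = {}" using T(3)[OF t(1) t'(1)] Ef[OF t(1)] Ef[OF t'(1)] t(2) t'(2) by simp
      qed
    qed
    define la where "la I = local_avg p I (ind F) * local_avg p I (ind G) * real (card I)" for I
    have la0: "la I \<ge> 0" for I by (simp add: la_def local_avg_def)
    have "(\<Sum>(b, j, E)\<in>T. cell_weight F G b j) \<le> (\<Sum>t\<in>T. 3 / (p - 1) * la (iv t))"
    proof (rule sum_mono)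
      fix t assume "t \<in> T"
      show "(case t of (b, j, E) \<Rightarrow> cell_weight F G b j) \<le> 3 / (p - 1) * la (iv t)"
        using cell_weight_le_local_avg[OF p, of F G "fst t" "fst (snd t)"] by (simp add: la_def iv_def case_prod_beta)
    qed
    also have "\<dots> = 3 / (p - 1) * (\<Sum>I\<in>S. la I)"
      unfolding S_def sum.reindex[OF inj] sum_distrib_left by simp
    finally have cw: "(\<Sum>(b, j, E)\<in>T. cell_weight F G b j) \<le> 3 / (p - 1) * (\<Sum>I\<in>S. la I)" .
    have "pairing (A_star (ind F)) (indicator G) = (\<Sum>x\<in>G. A_star (ind F) x)"
      by (rule pairing_indicator[OF G])
    also have "\<dots> \<le> (\<Sum>x\<in>G. ennreal (2 * mscale_max (indicator F) m x))"
    proof (rule sum_mono, rule A_star_le_mscale_max)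
      fix x y assume "x \<in> G" "y \<in> F" "y < x"
      then show "x - 2 ^ m \<le> y" using M[of x] M[of y] Mm by auto
    qed
    also have "\<dots> = ennreal (\<Sum>x\<in>G. 2 * mscale_max (indicator F) m x)"
    proof (rule sum_ennreal)
      fix x
      show "0 \<le> 2 * mscale_max (indicator F) m x"
        using mscale_le_max[of 0 m "indicator F" x] mscale_nonneg[of "indicator F" 0 x] by simp
    qed
    also have "\<dots> \<le> ennreal (6 * C / (p - 1) * (\<Sum>I\<in>S. la I))"
    proof (rule ennreal_leI)
      have "(\<Sum>x\<in>G. 2 * mscale_max (indicator F) m x) = 2 * (\<Sum>x\<in>G. mscale_max (indicator F) m x)"
        by (rule sum_distrib_left[symmetric])
      also have "\<dots> \<le> 2 * (C * (3 / (p - 1) * (\<Sum>I\<in>S. la I)))"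
        using T(4) cw C by (intro mult_left_mono order_trans[OF T(4)]) auto
      finally show "(\<Sum>x\<in>G. 2 * mscale_max (indicator F) m x) \<le> 6 * C / (p - 1) * (\<Sum>I\<in>S. la I)" by simp
    qed
    also have "\<dots> = ennreal (6 * C / (p - 1)) * ennreal (\<Sum>I\<in>S. la I)"
      using C p la0 by (intro ennreal_mult) (auto simp: sum_nonneg)
    also have "ennreal (\<Sum>I\<in>S. la I) = sparse_form p S (ind F) (ind G)"
      using finS la0 by (simp add: sparse_form_def la_def[symmetric] sum_ennreal)
    finally show ?thesis using sp by blast
  qed
  moreover have "6 * C > 0" using C by simp
  ultimately show ?thesis by blast
qed

section \<open>The Lorentz bound\<close>

text \<open>
  The largest scale with \<open>2^k \<le> v k\<close>, if there is one: up to there the number of prime powers, of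
  order \<open>2^k / k\<close>, stays below a multiple of \<open>v\<close>.
\<close>

lemma ex_critical_scale:
  fixes v :: real
  assumes "v \<ge> 0"
  shows "\<exists>k0. (k0 = 0 \<or> 2 ^ k0 \<le> v * real k0) \<and> (\<forall>k>k0. v * real k < 2 ^ k)"
proof -
  define N where "N = nat \<lceil>4 * v\<rceil> + 1"
  have big: "v * real k < 2 ^ k" if k: "k \<ge> N" for k
  proof -
    define h where "h = k div 2"
    have "h < 2 ^ h" "k - h < 2 ^ (k - h)" by (rule less_exp)+
    then have "h + 1 \<le> 2 ^ h" "k - h + 1 \<le> 2 ^ (k - h)" by (simp_all add: Suc_le_eq)
    then have "(h + 1) * (k - h + 1) \<le> 2 ^ h * 2 ^ (k - h)" by (rule mult_mono) auto
    also have "\<dots> = 2 ^ k" by (simp add: h_def flip: power_add)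
    finally have 1: "real ((h + 1) * (k - h + 1)) \<le> 2 ^ k" by (metis of_nat_le_iff of_nat_numeral of_nat_power)
    have "(real k / 2) * (real k / 2) \<le> real (h + 1) * real (k - h + 1)"
      by (intro mult_mono) (auto simp: h_def)
    moreover have "real ((h + 1) * (k - h + 1)) = real (h + 1) * real (k - h + 1)" by (rule of_nat_mult)
    moreover have "real k / 4 * real k = (real k / 2) * (real k / 2)" by simp
    ultimately have 2: "real k / 4 * real k \<le> real ((h + 1) * (k - h + 1))" by linarith
    have "v < real k / 4" using k unfolding N_def by linarith
    moreover have "real k > 0" using k by (simp add: N_def)
    ultimately have "v * real k < real k / 4 * real k" by (intro mult_strict_right_mono)
    with 1 2 show ?thesis by linarith
  qed
  define P where "P k \<longleftrightarrow> k = 0 \<or> 2 ^ k \<le> v * real k" for k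
  define k0 where "k0 = (GREATEST k. P k)"
  have bnd: "k \<le> N" if "P k" for k using that big[of k] by (auto simp: P_def) (meson nle_le not_le)
  have "P k0" unfolding k0_def by (rule GreatestI_nat[of P 0 N]) (auto simp: P_def[of 0] bnd)
  moreover have "v * real k < 2 ^ k" if "k > k0" for k
  proof (rule ccontr)
    assume "\<not> v * real k < 2 ^ k"
    then have "P k" by (simp add: P_def)
    then have "k \<le> k0" unfolding k0_def by (rule Greatest_le_nat[of P k N]) (rule bnd)
    with that show False by simp
  qed
  ultimately show ?thesis by (intro exI[of _ k0]) (auto simp: P_def)
qed

lemma power_ge_linear_mult:
  "i \<ge> 8 + 4 * l \<Longrightarrow> real (Suc i) * (8 * 4 ^ l) \<le> 2 ^ i"
proof (induction i rule: dec_induct)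
  case base
  have "72 + 32 * real l \<le> 256 * 4 ^ l"
  proof (induction l)
    case (Suc l)
    have "(1::real) \<le> 4 ^ l" by simp
    with Suc show ?case by simp
  qed simp
  then have "(9 + 4 * real l) * 8 * 4 ^ l \<le> 256 * 4 ^ l * 4 ^ l" by (intro mult_right_mono) auto
  also have "256 * 4 ^ l * 4 ^ l = (2::real) ^ (8 + 4 * l)"
  proof -
    have "(4::real) ^ l * 4 ^ l = 16 ^ l" by (simp flip: power_mult_distrib)
    moreover have "(2::real) ^ (4 * l) = 16 ^ l" by (simp add: power_mult)
    ultimately show ?thesis by (simp add: power_add mult.assoc)
  qed
  finally show ?case by (simp add: algebra_simps)
next
  case (step i)
  have "real (Suc (Suc i)) * (8 * 4 ^ l) \<le> (2 * real (Suc i)) * (8 * 4 ^ l)" by (intro mult_right_mono) auto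
  also have "\<dots> = 2 * (real (Suc i) * (8 * 4 ^ l))" by (simp only: mult.assoc)
  also have "\<dots> \<le> 2 * 2 ^ i" by (intro mult_left_mono step.IH) simp
  finally show ?case by simp
qed

text \<open>
  The position of \<open>y\<close> when the support is listed by decreasing values of \<open>f\<close>, ties being broken by the order of
  the integers to make ranks distinct.
\<close>

definition decr_rank :: "(int \<Rightarrow> real) \<Rightarrow> int \<Rightarrow> nat" where
  "decr_rank f y = card {z. f z \<noteq> 0 \<and> (f y < f z \<or> (f z = f y \<and> z \<le> y))}"

context
  fixes f :: "int \<Rightarrow> real"
  assumes fin: "finite {x. f x \<noteq> 0}" and f0: "\<And>x. f x \<ge> 0"
begin

definition upper :: "int \<Rightarrow> int set" where
  "upper y = {z. f z \<noteq> 0 \<and> (f y < f z \<or> (f z = f y \<and> z \<le> y))}"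

lemma finite_upper: "finite (upper y)"
  unfolding upper_def by (rule finite_subset[OF _ fin]) auto

lemma decr_rank_eq: "decr_rank f y = card (upper y)"
  by (simp add: decr_rank_def upper_def)

lemma decr_rank_pos: "f y \<noteq> 0 \<Longrightarrow> decr_rank f y \<ge> 1"
  unfolding decr_rank_eq using finite_upper[of y] by (auto simp: Suc_le_eq card_gt_0_iff upper_def)

lemma inj_on_decr_rank: "inj_on (decr_rank f) {x. f x \<noteq> 0}"
proof -
  have lt: "decr_rank f y < decr_rank f z"
    if "f y \<noteq> 0" "f z \<noteq> 0" "f z < f y \<or> (f y = f z \<and> y < z)" for y z
    unfolding decr_rank_eq
  proof (rule psubset_card_mono[OF finite_upper], rule psubsetI)
    show "upper y \<subseteq> upper z" using that by (auto simp: upper_def)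
    have "z \<notin> upper y"
    proof
      assume "z \<in> upper y"
      then have "f y < f z \<or> (f z = f y \<and> z \<le> y)" by (simp add: upper_def)
      with that(3) show False by (elim disjE conjE) linarith+
    qed
    moreover have "z \<in> upper z" using that by (simp add: upper_def)
    ultimately show "upper y \<noteq> upper z" by blast
  qed
  show ?thesis
  proof (rule inj_onI, rule ccontr)
    fix y z assume yz: "y \<in> {x. f x \<noteq> 0}" "z \<in> {x. f x \<noteq> 0}" "decr_rank f y = decr_rank f z" "y \<noteq> z"
    then have "(f z < f y \<or> (f y = f z \<and> y < z)) \<or> (f y < f z \<or> (f z = f y \<and> z < y))" by auto
    then show False using lt[of y z] lt[of z y] yz by auto
  qed
qed

lemma decr_rearr_ge:
  assumes y: "f y \<noteq> 0" and s: "0 < s" "s < real (decr_rank f y)"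
  shows "f y \<le> decr_rearr f s"
  unfolding decr_rearr_def
proof (rule cInf_greatest)
  define m0 where "m0 = Max (insert 0 (f ` {x. f x \<noteq> 0}))"
  have m0: "m0 \<ge> 0" unfolding m0_def using fin by (intro Max_ge) auto
  have "f x \<le> m0" for x
  proof (cases "f x = 0")
    case False
    then show ?thesis unfolding m0_def using fin by (intro Max_ge) auto
  qed (use m0 in simp)
  then have "{x. norm (f x) > m0} = {}" using f0 by (auto simp: not_less)
  then have "counting {x. norm (f x) > m0} = 0" by (simp only: counting_def emeasure_empty)
  then have "m0 \<in> {l. 0 \<le> l \<and> counting {x. norm (f x) > l} \<le> ennreal s}" using m0 by simp
  then show "{l. 0 \<le> l \<and> counting {x. norm (f x) > l} \<le> ennreal s} \<noteq> {}" by blast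
  fix l assume l: "l \<in> {l. 0 \<le> l \<and> counting {x. norm (f x) > l} \<le> ennreal s}"
  show "f y \<le> l"
  proof (rule ccontr)
    assume "\<not> f y \<le> l"
    define R where "R = upper y"
    have finR: "finite R" by (simp add: R_def finite_upper)
    have sub: "R \<subseteq> {x. norm (f x) > l}" using \<open>\<not> f y \<le> l\<close> f0 by (auto simp: R_def upper_def)
    have "ennreal (real (decr_rank f y)) = counting R"
      using finR by (simp add: counting_def emeasure_count_space_finite decr_rank_eq R_def ennreal_of_nat_eq_real_of_nat)
    also have "\<dots> \<le> counting {x. norm (f x) > l}" unfolding counting_def by (rule emeasure_mono[OF sub]) simp
    also have "\<dots> \<le> ennreal s" using l by simp
    finally have "real (decr_rank f y) \<le> s" using s by (simp add: ennreal_le_iff)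
    with s show False by simp
  qed
qed

text \<open>
  The decreasing rearrangement is at least \<open>f y\<close> up to the rank \<open>r\<close> of \<open>y\<close>, and on the unit interval \<open>(r - 1, r)\<close> the weight
  is at least \<open>(1 + ln r) / 4\<close>. These unit intervals are disjoint for different \<open>y\<close>.
\<close>

lemma lorentz_norm_ge:
  assumes t: "t \<ge> 1"
  shows "ennreal ((\<Sum>y | f y \<noteq> 0. f y * (1 + ln (real (decr_rank f y)))) / 4)
    \<le> lorentz_norm (\<lambda>s. Log s ^ t * Log (Log s)) f"
proof -
  define Z where "Z = {y. f y \<noteq> 0}"
  have finZ: "finite Z" using fin by (simp add: Z_def)
  define r where "r y = real (decr_rank f y)" for y
  have r1: "r y \<ge> 1" if "y \<in> Z" for y using decr_rank_pos[of y] that by (simp add: Z_def r_def)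
  define c where "c y = f y * (1 + ln (r y)) / 4" for y
  have c0: "c y \<ge> 0" if "y \<in> Z" for y using r1[OF that] f0[of y] by (simp add: c_def)
  define h where "h s = ennreal (decr_rearr f s * (Log s ^ t * Log (Log s)))" for s
  have le: "c y \<le> decr_rearr f s * (Log s ^ t * Log (Log s))" if y: "y \<in> Z" and s: "r y - 1 < s" "s < r y" for y s
  proof -
    have s0: "s > 0" using s r1[OF y] by linarith
    have "Log s \<ge> (1 + ln (r y)) / 4"
    proof (cases "decr_rank f y = 1")
      case True
      then show ?thesis using Log_ge_1[of s] by (simp add: r_def)
    next
      case False
      then have "r y \<ge> 2" using decr_rank_pos[of y] y by (simp add: r_def Z_def)
      then have half: "s \<ge> r y / 2" using s by linarith
      have "ln (r y / 2) \<le> ln s" using half \<open>r y \<ge> 2\<close> s0 by (subst ln_le_cancel_iff) auto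
      then have a: "ln (r y) - ln 2 \<le> ln s" using \<open>r y \<ge> 2\<close> by (simp add: ln_div)
      have b: "ln 2 \<le> ln (r y)" using \<open>r y \<ge> 2\<close> by (subst ln_le_cancel_iff) auto
      have "ln s \<le> \<bar>ln s\<bar>" by simp
      with a b ln_2_less_1 have "1 + ln (r y) \<le> 4 + 4 * \<bar>ln s\<bar>" by linarith
      then show ?thesis by (simp add: Log_def)
    qed
    also have "Log s \<le> Log s ^ t" using Log_ge_1[of s] t by (intro self_le_power) auto
    also have "\<dots> \<le> Log s ^ t * Log (Log s)"
      using Log_ge_1[of "Log s"] Log_ge_1[of s] mult_left_mono[of 1 "Log (Log s)" "Log s ^ t"] by simp
    finally have 1: "(1 + ln (r y)) / 4 \<le> Log s ^ t * Log (Log s)" .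
    have 2: "f y \<le> decr_rearr f s" using y s s0 by (intro decr_rearr_ge) (auto simp: Z_def r_def)
    have "f y * ((1 + ln (r y)) / 4) \<le> decr_rearr f s * (Log s ^ t * Log (Log s))"
      using 1 2 f0[of y] r1[OF y] by (intro mult_mono) auto
    then show ?thesis by (simp add: c_def)
  qed
  have "ennreal ((\<Sum>y\<in>Z. f y * (1 + ln (r y))) / 4) = (\<Sum>y\<in>Z. ennreal (c y))"
    using c0 by (simp add: sum_ennreal c_def sum_divide_distrib)
  also have "\<dots> = (\<Sum>y\<in>Z. \<integral>\<^sup>+s. ennreal (c y) * indicator {r y - 1<..<r y} s \<partial>lborel)"
    by (simp add: nn_integral_cmult_indicator)
  also have "\<dots> = (\<integral>\<^sup>+s. (\<Sum>y\<in>Z. ennreal (c y) * indicator {r y - 1<..<r y} s) \<partial>lborel)"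
    by (rule nn_integral_sum[symmetric]) auto
  also have "\<dots> \<le> (\<integral>\<^sup>+s\<in>{0<..}. h s \<partial>lborel)"
  proof (rule nn_integral_mono)
    fix s :: real
    show "(\<Sum>y\<in>Z. ennreal (c y) * indicator {r y - 1<..<r y} s) \<le> h s * indicator {0<..} s"
    proof (cases "\<exists>y\<in>Z. r y - 1 < s \<and> s < r y")
      case True
      then obtain y where y: "y \<in> Z" "r y - 1 < s" "s < r y" by blast
      have other: "z = y" if "z \<in> Z" "r z - 1 < s" "s < r z" for z
      proof -
        have "decr_rank f z = decr_rank f y" using that y unfolding r_def by linarith
        then show ?thesis using inj_on_decr_rank that(1) y(1) by (auto simp: inj_on_def Z_def)
      qed
      have "(\<Sum>w\<in>Z. ennreal (c w) * indicator {r w - 1<..<r w} s) = (\<Sum>w\<in>{y}. ennreal (c w) * indicator {r w - 1<..<r w} s)"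
      proof (rule sum.mono_neutral_right[OF finZ])
        show "\<forall>w\<in>Z - {y}. ennreal (c w) * indicator {r w - 1<..<r w} s = 0"
        proof
          fix w assume w: "w \<in> Z - {y}"
          then have "\<not> (r w - 1 < s \<and> s < r w)" using other[of w] by blast
          then have "s \<notin> {r w - 1<..<r w}" by (simp only: greaterThanLessThan_iff not_False_eq_True)
          then have "indicator {r w - 1<..<r w} s = (0::ennreal)" by (rule indicator_simps(2))
          then show "ennreal (c w) * indicator {r w - 1<..<r w} s = 0" by (simp only: mult_zero_right)
        qed
      qed (use y in simp)
      also have "\<dots> = ennreal (c y)" using y by simp
      also have "\<dots> \<le> h s" unfolding h_def using y by (intro ennreal_leI le) auto
      also have "\<dots> = h s * indicator {0<..} s" using y r1[OF y(1)] by simp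
      finally show ?thesis .
    next
      case False
      then have "(\<Sum>y\<in>Z. ennreal (c y) * indicator {r y - 1<..<r y} s) = 0"
        by (intro sum.neutral) (auto simp: indicator_def)
      then show ?thesis by simp
    qed
  qed
  finally show ?thesis by (simp add: lorentz_norm_def h_def Z_def r_def)
qed

text \<open>
  With \<open>v y = f y / l\<close> and \<open>r y\<close> the rank of \<open>y\<close>, the scales are cut at \<open>k0 y\<close> and \<open>k1 y\<close>. Up to \<open>k0 y\<close> only the
  \<open>O(v y)\<close> points of \<open>E y\<close> receive anything from \<open>y\<close>, and they are thrown away. From \<open>k1 y\<close> on, \<open>y\<close> contributes at most
  \<open>1 / (8 (r y)\<^sup>2)\<close>, in total no more than 1/4. So every other point of the level set receives at least 1/4 from the
  \<open>O(1 + ln (r y))\<close> scales in between, at each of which \<open>y\<close> distributes a total mass of at most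
  \<open>4 v y\<close>.
\<close>

lemma weak_type_rank_sum:
  assumes l: "l > 0"
  shows "counting {x. A_star f x > ennreal l}
    \<le> ennreal (320 * (\<Sum>y | f y \<noteq> 0. f y * (1 + ln (real (decr_rank f y)))) / l)"
proof (rule counting_le)
  define Z where "Z = {y. f y \<noteq> 0}"
  have finZ: "finite Z" using fin by (simp add: Z_def)
  define r where "r y = decr_rank f y" for y
  have r1: "r y \<ge> 1" if "y \<in> Z" for y using decr_rank_pos[of y] that by (simp add: Z_def r_def)
  show "0 \<le> 320 * (\<Sum>y | f y \<noteq> 0. f y * (1 + ln (real (decr_rank f y)))) / l"
    using l f0 decr_rank_pos by (intro divide_nonneg_pos mult_nonneg_nonneg sum_nonneg) (auto intro!: add_nonneg_nonneg simp: Suc_le_eq)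
  fix S assume S: "finite S" "S \<subseteq> {x. A_star f x > ennreal l}"
  define v where "v y = f y / l" for y
  have v0: "v y \<ge> 0" for y using f0 l by (simp add: v_def)
  define el where "el y = nat \<lceil>log 2 (real (r y))\<rceil>" for y
  have el: "real (r y) \<le> 2 ^ el y" "real (el y) \<le> 1 + 2 * ln (real (r y))" if "y \<in> Z" for y
  proof -
    have pos: "real (r y) > 0" "log 2 (real (r y)) \<ge> 0" "ln (real (r y)) \<ge> 0" using r1[OF that] by auto
    have "real (r y) = 2 powr (log 2 (real (r y)))" using pos by simp
    also have "\<dots> \<le> 2 powr (real (el y))" by (intro powr_mono) (auto simp: el_def intro: real_nat_ceiling_ge)
    finally show "real (r y) \<le> 2 ^ el y" by (simp add: powr_realpow)
    have "real (el y) \<le> 1 + log 2 (real (r y))" unfolding el_def using pos by linarith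
    also have "log 2 (real (r y)) = ln (real (r y)) / ln 2" by (simp add: log_def)
    also have "\<dots> \<le> ln (real (r y)) / (1 / 2)" using half_le_ln_2 pos by (intro divide_left_mono) auto
    finally show "real (el y) \<le> 1 + 2 * ln (real (r y))" by simp
  qed
  obtain k0 where k0: "\<And>y. k0 y = 0 \<or> 2 ^ k0 y \<le> v y * real (k0 y)" "\<And>y k. k > k0 y \<Longrightarrow> v y * real k < 2 ^ k"
    using ex_critical_scale[OF v0] by metis
  define k1 where "k1 y = k0 y + 9 + 4 * el y" for y
  (* The mass that a unit point sends over the distance d at scale k. *)
  define w where "w k d = (if 1 \<le> d \<and> d \<le> 2 ^ k then mangoldt (nat d) / 2 ^ k else 0 :: real)" for k and d :: int
  have w0: "w k d \<ge> 0" for k d by (simp add: w_def mangoldt_nonneg)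
  have mscale_w: "mscale f k x = (\<Sum>y\<in>Z. f y * w k (x - y))" for k x
  proof -
    have "(\<Sum>n=1..2^k. mangoldt n * f (x - int n)) = (\<Sum>y\<in>{x - 2 ^ k..x - 1}. mangoldt (nat (x - y)) * f y)"
      by (rule sum.reindex_bij_witness[of _ "\<lambda>y. nat (x - y)" "\<lambda>n. x - int n"])
         (auto simp: nat_le_iff of_nat_le_numeral_power_cancel_iff)
    also have "\<dots> = (\<Sum>y\<in>Z \<inter> {x - 2 ^ k..x - 1}. mangoldt (nat (x - y)) * f y)"
      by (rule sum.mono_neutral_right) (auto simp: Z_def)
    also have "\<dots> = (\<Sum>y\<in>Z. if x - 2 ^ k \<le> y \<and> y \<le> x - 1 then mangoldt (nat (x - y)) * f y else 0)"
      by (rule sum.mono_neutral_cong_left) (use finZ in auto)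
    finally show ?thesis
      by (simp add: mscale_def sum_divide_distrib w_def) (intro sum.cong refl, auto)
  qed
  define E where "E y = (\<lambda>n. y + int n) ` {n\<in>{1..2 ^ k0 y}. mangoldt n \<noteq> (0::real)}" for y
  have finE: "finite (E y)" for y by (simp add: E_def)
  have cE: "real (card (E y)) \<le> 64 * v y" for y
  proof (cases "k0 y = 0")
    case True
    have "{n. n = Suc 0 \<and> mangoldt n \<noteq> (0::real)} = {}" by auto
    then have "E y = {}" unfolding E_def True by auto
    then show ?thesis using v0 by simp
  next
    case False
    have "card (E y) \<le> card {n\<in>{1..2 ^ k0 y::nat}. mangoldt n \<noteq> (0::real)}"
      unfolding E_def by (rule card_image_le) simp
    then have "real (k0 y) * real (card (E y)) \<le> real (k0 y) * real (card {n\<in>{1..2 ^ k0 y::nat}. mangoldt n \<noteq> (0::real)})"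
      by (intro mult_left_mono of_nat_mono) auto
    also have "\<dots> \<le> 64 * 2 ^ k0 y" by (rule card_primepow_le)
    also have "\<dots> \<le> 64 * (v y * real (k0 y))" using k0(1)[of y] False by simp
    finally have "real (k0 y) * real (card (E y)) \<le> real (k0 y) * (64 * v y)" by (simp add: mult_ac)
    then show ?thesis using False by simp
  qed
  define U where "U = (\<Union>y\<in>Z. E y)"
  have "card U \<le> (\<Sum>y\<in>Z. card (E y))" unfolding U_def by (rule card_UN_le[OF finZ])
  then have "real (card U) \<le> (\<Sum>y\<in>Z. real (card (E y)))" by (metis of_nat_le_iff of_nat_sum)
  also have "\<dots> \<le> (\<Sum>y\<in>Z. 64 * v y)" by (intro sum_mono cE)
  finally have cU: "real (card U) \<le> (\<Sum>y\<in>Z. 64 * v y)" .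
  have small: "v y * w k (x - y) = 0" if "x \<notin> U" "y \<in> Z" "k \<le> k0 y" for x y k
  proof (cases "1 \<le> x - y \<and> x - y \<le> 2 ^ k")
    case True
    have "(2::int) ^ k \<le> 2 ^ k0 y" using that(3) by (intro power_increasing) auto
    moreover have "int (nat (x - y)) = x - y" "int (2 ^ k0 y) = 2 ^ k0 y" using True by simp_all
    ultimately have "int (nat (x - y)) \<le> int (2 ^ k0 y)" using True by linarith
    then have "nat (x - y) \<le> 2 ^ k0 y" by (simp only: of_nat_le_iff)
    then have n: "nat (x - y) \<in> {1..2 ^ k0 y}" using True by auto
    have "mangoldt (nat (x - y)) = (0::real)"
    proof (rule ccontr)
      assume "mangoldt (nat (x - y)) \<noteq> (0::real)"
      then have "x \<in> E y" unfolding E_def using n True by (intro image_eqI[of _ _ "nat (x - y)"]) auto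
      then show False using that by (auto simp: U_def)
    qed
    then show ?thesis by (simp add: w_def)
  qed (auto simp: w_def)
  have large: "v y * w k d \<le> 1 / (8 * (real (r y))\<^sup>2)" if y: "y \<in> Z" and k: "k1 y \<le> k" for y k d
  proof -
    define i where "i = k - Suc (k0 y)"
    have ki: "k = Suc (k0 y) + i" "i \<ge> 8 + 4 * el y" using k by (auto simp: i_def k1_def)
    have wk: "w k d \<le> real k / 2 ^ k"
    proof (cases "1 \<le> d \<and> d \<le> 2 ^ k")
      case True
      have "mangoldt (nat d) \<le> ln (real (nat d))" using True by (intro mangoldt_le) auto
      also have "\<dots> \<le> ln (2 ^ k)"
      proof -
        have "real_of_int d \<le> 2 ^ k" using True by (metis of_int_le_iff of_int_numeral of_int_power)
        then show ?thesis using True by (subst ln_le_cancel_iff) auto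
      qed
      also have "\<dots> = real k * ln 2" by (simp add: ln_realpow)
      also have "\<dots> \<le> real k * 1" using ln_2_less_1 by (intro mult_left_mono) auto
      finally show ?thesis using True by (simp add: w_def divide_right_mono)
    qed (auto simp: w_def)
    have "real k \<le> real (Suc (k0 y)) * real (Suc i)" by (simp add: ki(1) algebra_simps)
    then have "v y * real k \<le> (v y * real (Suc (k0 y))) * real (Suc i)"
      using mult_left_mono[OF _ v0[of y]] by (simp add: mult.assoc)
    also have "\<dots> \<le> 2 ^ Suc (k0 y) * real (Suc i)"
      using k0(2)[of y "Suc (k0 y)"] by (intro mult_right_mono) auto
    finally have "v y * real k / 2 ^ k \<le> 2 ^ Suc (k0 y) * real (Suc i) / 2 ^ k" by (rule divide_right_mono) simp
    also have "\<dots> = real (Suc i) / 2 ^ i" by (simp add: ki(1) power_add field_simps)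
    also have "\<dots> \<le> 1 / (8 * 4 ^ el y)" using power_ge_linear_mult[OF ki(2)] by (simp add: field_simps)
    also have "\<dots> \<le> 1 / (8 * (real (r y))\<^sup>2)"
    proof -
      have "(real (r y))\<^sup>2 \<le> (2 ^ el y)\<^sup>2" using el(1)[OF y] by (intro power_mono) auto
      also have "\<dots> = 4 ^ el y" by (simp add: power2_eq_square flip: power_mult_distrib)
      finally show ?thesis using r1[OF y] by (intro divide_left_mono) auto
    qed
    finally have *: "v y * (real k / 2 ^ k) \<le> 1 / (8 * (real (r y))\<^sup>2)" by simp
    have "v y * w k d \<le> v y * (real k / 2 ^ k)" by (intro mult_left_mono wk v0)
    with * show ?thesis by linarith
  qed
  have sum_r: "(\<Sum>y\<in>Z. 1 / (8 * (real (r y))\<^sup>2)) \<le> 1 / 4"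
  proof -
    have inj: "inj_on r Z" using inj_on_decr_rank unfolding r_def Z_def by simp
    define RR where "RR = r ` Z"
    have RR: "finite RR" "\<And>n. n \<in> RR \<Longrightarrow> n \<ge> 1" using finZ r1 by (auto simp: RR_def)
    have "(\<Sum>y\<in>Z. 1 / (8 * (real (r y))\<^sup>2)) = 1 / 8 * (\<Sum>n\<in>RR. 1 / (real n)\<^sup>2)"
      unfolding RR_def sum.reindex[OF inj] sum_distrib_left by simp
    also have "(\<Sum>n\<in>RR. 1 / (real n)\<^sup>2) \<le> (\<Sum>n\<in>insert 1 (RR - {1}). 1 / (real n)\<^sup>2)"
      using RR(1) by (intro sum_mono2) auto
    also have "\<dots> = 1 + (\<Sum>n\<in>RR - {1}. 1 / (real n)\<^sup>2)" using RR(1) by (subst sum.insert) auto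
    also have "(\<Sum>n\<in>RR - {1}. 1 / (real n)\<^sup>2) \<le> (\<Sum>n\<in>RR - {1}. 1 / (real n * (real n - 1)))"
    proof (rule sum_mono)
      fix n assume "n \<in> RR - {1}"
      then have "n \<ge> 2" using RR(2)[of n] by auto
      then show "1 / (real n)\<^sup>2 \<le> 1 / (real n * (real n - 1))"
        unfolding power2_eq_square by (intro divide_left_mono mult_left_mono) auto
    qed
    also have "\<dots> \<le> 1"
    proof (rule sum_inverse_pronic_le)
      show "n \<ge> 2" if "n \<in> RR - {1}" for n using RR(2)[of n] that by auto
    qed (use RR in auto)
    finally show ?thesis by simp
  qed
  (* The points for which the scale k is neither too small nor too large. *)
  define mid where "mid k = {y\<in>Z. k0 y < k \<and> k < k1 y}" for k
  have "\<exists>k. 1 / 4 < (\<Sum>y\<in>mid k. v y * w k (x - y))" if x: "x \<in> S - U" for x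
  proof -
    obtain k where k: "l < 2 * mscale f k x"
      using A_star_gt_imp_mscale[of f l x] f0 S(2) x l by auto
    have "2 * (\<Sum>y\<in>Z. v y * w k (x - y)) = 2 * mscale f k x / l"
      by (simp add: mscale_w v_def sum_divide_distrib sum_distrib_left)
    also have "\<dots> > 1" using k l by simp
    finally have tot: "1 / 2 < (\<Sum>y\<in>Z. v y * w k (x - y))" by simp
    have "(\<Sum>y\<in>Z. v y * w k (x - y)) = (\<Sum>y\<in>mid k. v y * w k (x - y)) + (\<Sum>y\<in>Z - mid k. v y * w k (x - y))"
      using sum.subset_diff[of "mid k" Z "\<lambda>y. v y * w k (x - y)"] finZ by (simp add: mid_def)
    moreover have "(\<Sum>y\<in>Z - mid k. v y * w k (x - y)) \<le> (\<Sum>y\<in>Z - mid k. 1 / (8 * (real (r y))\<^sup>2))"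
    proof (rule sum_mono)
      fix y assume y: "y \<in> Z - mid k"
      then consider "k \<le> k0 y" | "k1 y \<le> k" by (auto simp: mid_def not_less)
      then show "v y * w k (x - y) \<le> 1 / (8 * (real (r y))\<^sup>2)"
      proof cases
        case 1
        have "v y * w k (x - y) = 0" using small[of x y k] 1 x y by blast
        moreover have "0 \<le> 1 / (8 * (real (r y))\<^sup>2)" by simp
        ultimately show ?thesis by linarith
      next
        case 2
        then show ?thesis using large[of y k] y by simp
      qed
    qed
    moreover have "(\<Sum>y\<in>Z - mid k. 1 / (8 * (real (r y))\<^sup>2)) \<le> (\<Sum>y\<in>Z. 1 / (8 * (real (r y))\<^sup>2))"
      using finZ by (intro sum_mono2) auto
    ultimately have "1 / 4 < (\<Sum>y\<in>mid k. v y * w k (x - y))" using tot sum_r by linarith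
    then show ?thesis by blast
  qed
  then obtain kk where kk: "\<And>x. x \<in> S - U \<Longrightarrow> 1 / 4 < (\<Sum>y\<in>mid (kk x). v y * w (kk x) (x - y))" by metis
  define Ks where "Ks = kk ` (S - U)"
  have finKs: "finite Ks" using S(1) by (simp add: Ks_def)
  have sumw: "(\<Sum>x\<in>S - U. w k (x - y)) \<le> 4" for k y
  proof -
    have "(\<Sum>x\<in>S - U. w k (x - y)) = (\<Sum>x\<in>(S - U) \<inter> {y + 1..y + 2 ^ k}. w k (x - y))"
      by (rule sum.mono_neutral_right) (use S(1) in \<open>auto simp: w_def\<close>)
    also have "\<dots> \<le> (\<Sum>x\<in>{y + 1..y + 2 ^ k}. w k (x - y))" using w0 by (intro sum_mono2) auto
    also have "\<dots> = (\<Sum>n=1..2^k. mangoldt n / 2 ^ k)"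
      by (rule sum.reindex_bij_witness[of _ "\<lambda>n. y + int n" "\<lambda>x. nat (x - y)"])
         (auto simp: w_def nat_le_iff of_nat_le_numeral_power_cancel_iff)
    also have "\<dots> \<le> 4 * real (2 ^ k) / 2 ^ k"
      unfolding sum_divide_distrib[symmetric] by (intro divide_right_mono sum_mangoldt_le) auto
    finally show ?thesis by simp
  qed
  have "real (card (S - U)) * (1 / 4) = (\<Sum>x\<in>S - U. 1 / 4)" by simp
  also have "\<dots> \<le> (\<Sum>x\<in>S - U. \<Sum>k\<in>Ks. \<Sum>y\<in>mid k. v y * w k (x - y))"
  proof (rule sum_mono)
    fix x assume x: "x \<in> S - U"
    have "(\<Sum>y\<in>mid (kk x). v y * w (kk x) (x - y)) \<le> (\<Sum>k\<in>Ks. \<Sum>y\<in>mid k. v y * w k (x - y))"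
      by (rule member_le_sum) (use x finKs v0 w0 in \<open>auto simp: Ks_def intro!: sum_nonneg\<close>)
    then show "1 / 4 \<le> (\<Sum>k\<in>Ks. \<Sum>y\<in>mid k. v y * w k (x - y))" using kk[OF x] by linarith
  qed
  also have "\<dots> = (\<Sum>k\<in>Ks. \<Sum>y\<in>mid k. v y * (\<Sum>x\<in>S - U. w k (x - y)))"
    unfolding sum_distrib_left
    by (subst sum.swap, rule sum.cong[OF refl], rule sum.swap)
  also have "\<dots> \<le> (\<Sum>k\<in>Ks. \<Sum>y\<in>mid k. v y * 4)"
    by (intro sum_mono mult_left_mono sumw v0)
  also have "\<dots> = (\<Sum>k\<in>Ks. \<Sum>y\<in>Z. if k0 y < k \<and> k < k1 y then v y * 4 else 0)"
    unfolding mid_def by (intro sum.cong refl sum.inter_filter finZ)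
  also have "\<dots> = (\<Sum>y\<in>Z. \<Sum>k\<in>Ks. if k0 y < k \<and> k < k1 y then v y * 4 else 0)" by (rule sum.swap)
  also have "\<dots> \<le> (\<Sum>y\<in>Z. (8 + 4 * real (el y)) * (v y * 4))"
  proof (rule sum_mono)
    fix y
    have "(\<Sum>k\<in>Ks. if k0 y < k \<and> k < k1 y then v y * 4 else 0) = (\<Sum>k\<in>{k\<in>Ks. k0 y < k \<and> k < k1 y}. v y * 4)"
      by (rule sum.inter_filter[symmetric, OF finKs])
    also have "\<dots> \<le> (\<Sum>k\<in>{k0 y<..<k1 y}. v y * 4)" using v0 by (intro sum_mono2) auto
    also have "\<dots> = (8 + 4 * real (el y)) * (v y * 4)" by (simp add: k1_def)
    finally show "(\<Sum>k\<in>Ks. if k0 y < k \<and> k < k1 y then v y * 4 else 0) \<le> (8 + 4 * real (el y)) * (v y * 4)" .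
  qed
  finally have cSU: "real (card (S - U)) \<le> (\<Sum>y\<in>Z. (128 + 64 * real (el y)) * v y)"
    by (simp add: sum_distrib_left sum_distrib_right algebra_simps)
  have "card S \<le> card (U \<union> (S - U))"
    using S(1) finZ finE by (intro card_mono) (auto simp: U_def)
  also have "\<dots> \<le> card U + card (S - U)" by (rule card_Un_le)
  finally have "real (card S) \<le> real (card U) + real (card (S - U))" by (metis of_nat_add of_nat_le_iff)
  also have "\<dots> \<le> (\<Sum>y\<in>Z. 64 * v y) + (\<Sum>y\<in>Z. (128 + 64 * real (el y)) * v y)" by (intro add_mono cU cSU)
  also have "\<dots> = (\<Sum>y\<in>Z. (192 + 64 * real (el y)) * v y)" by (simp add: algebra_simps flip: sum.distrib)
  also have "\<dots> \<le> (\<Sum>y\<in>Z. (320 * (1 + ln (real (r y)))) * v y)"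
  proof (intro sum_mono mult_right_mono v0)
    fix y assume y: "y \<in> Z"
    have "ln (real (r y)) \<ge> 0" using r1[OF y] by simp
    then have "192 + 64 * real (el y) \<le> 320 + 320 * ln (real (r y))" using el(2)[OF y] by linarith
    then show "192 + 64 * real (el y) \<le> 320 * (1 + ln (real (r y)))" by (simp add: distrib_left)
  qed
  also have "\<dots> = 320 * (\<Sum>y | f y \<noteq> 0. f y * (1 + ln (real (decr_rank f y)))) / l"
    by (simp add: v_def r_def Z_def sum_distrib_left sum_divide_distrib mult_ac)
  finally show "real (card S) \<le> 320 * (\<Sum>y | f y \<noteq> 0. f y * (1 + ln (real (decr_rank f y)))) / l" .
qed

lemma weak_type_lorentz:
  assumes t: "t \<ge> 1"
  shows "(SUP l\<in>{(0::real)<..}. ennreal l * counting {x. A_star f x > ennreal l})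
    \<le> ennreal 1280 * lorentz_norm (\<lambda>s. Log s ^ t * Log (Log s)) f"
proof (rule SUP_least)
  fix l :: real assume "l \<in> {0<..}"
  then have l: "l > 0" by simp
  define A where "A = (\<Sum>y | f y \<noteq> 0. f y * (1 + ln (real (decr_rank f y))))"
  have A0: "A \<ge> 0" unfolding A_def
    using f0 decr_rank_pos by (intro mult_nonneg_nonneg sum_nonneg) (auto intro!: add_nonneg_nonneg simp: Suc_le_eq)
  have "ennreal l * counting {x. A_star f x > ennreal l} \<le> ennreal l * ennreal (320 * A / l)"
    unfolding A_def by (intro mult_left_mono weak_type_rank_sum l) simp
  also have "\<dots> = ennreal (l * (320 * A / l))" using l A0 by (intro ennreal_mult[symmetric]) auto
  also have "l * (320 * A / l) = 1280 * (A / 4)" using l by simp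
  also have "ennreal \<dots> = ennreal 1280 * ennreal (A / 4)" using A0 by (intro ennreal_mult) auto
  also have "\<dots> \<le> ennreal 1280 * lorentz_norm (\<lambda>s. Log s ^ t * Log (Log s)) f"
    unfolding A_def by (intro mult_left_mono lorentz_norm_ge t) simp
  finally show "ennreal l * counting {x. A_star f x > ennreal l}
    \<le> ennreal 1280 * lorentz_norm (\<lambda>s. Log s ^ t * Log (Log s)) f" .
qed

end

section \<open>The three bounds\<close>

theorem corollary1p4:
  fixes t :: nat
  assumes "t = 2 \<or> (t = 1 \<and> GRH)"
  shows "\<exists>C::real. C > 0 \<and>
    (\<forall>(p::real) (F::int set) (G::int set). 1 < p \<and> p < 2 \<and> finite F \<and> finite G \<longrightarrow>
       pairing (A_star (indicator F :: int \<Rightarrow> real)) (indicator G)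
         \<le> ennreal (C / (p - 1) ^ t) *
           (SUP S\<in>{S. sparse_family S}.
              sparse_form p S (indicator F :: int \<Rightarrow> real) (indicator G :: int \<Rightarrow> real))) \<and>
    (\<forall>F::int set. finite F \<longrightarrow>
       (SUP l\<in>{(0::real)<..<1}. ennreal (l / Log l ^ t) *
           counting {x. A_star (indicator F :: int \<Rightarrow> real) x > ennreal l})
         \<le> ennreal (C * real (card F))) \<and>
    (\<forall>f::int \<Rightarrow> real. finite {x. f x \<noteq> 0} \<and> (\<forall>x. f x \<ge> 0) \<longrightarrow>
       (SUP l\<in>{(0::real)<..}. ennreal l * counting {x. A_star f x > ennreal l})
         \<le> ennreal C * lorentz_norm (\<lambda>s. Log s ^ t * Log (Log s)) f)"
proof -
  have t: "t \<ge> 1" using assms by auto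
  from sparse_bound obtain C1 where C1: "C1 > 0 \<and> (\<forall>(p::real) (F::int set) (G::int set). 1 < p \<longrightarrow> p < 2 \<longrightarrow> finite F \<longrightarrow> finite G \<longrightarrow>
     (\<exists>S. sparse_family S \<and> pairing (A_star (indicator F :: int \<Rightarrow> real)) (indicator G)
       \<le> ennreal (C1 / (p - 1)) * sparse_form p S (indicator F :: int \<Rightarrow> real) (indicator G :: int \<Rightarrow> real)))"
    by (elim exE)
  from restricted_weak_type obtain C2 where C2: "C2 > 0 \<and> (\<forall>F l. finite F \<longrightarrow> 0 < l \<longrightarrow> l < 1 \<longrightarrow>
    counting {x. A_star (indicator F :: int \<Rightarrow> real) x > ennreal l} \<le> ennreal (C2 * Log l / l * real (card F)))"
    by (elim exE)
  define C where "C = C1 + C2 + 1280"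
  have C: "C > 0" "C1 \<le> C" "C2 \<le> C" "1280 \<le> C" using C1 C2 by (auto simp: C_def)
  have 1: "pairing (A_star (indicator F :: int \<Rightarrow> real)) (indicator G)
         \<le> ennreal (C / (p - 1) ^ t) *
           (SUP S\<in>{S. sparse_family S}.
              sparse_form p S (indicator F :: int \<Rightarrow> real) (indicator G :: int \<Rightarrow> real))"
    if p: "1 < p" "p < 2" and fin: "finite F" "finite G" for p and F G :: "int set"
  proof -
    obtain S where S: "sparse_family S" "pairing (A_star (indicator F :: int \<Rightarrow> real)) (indicator G)
       \<le> ennreal (C1 / (p - 1)) * sparse_form p S (indicator F :: int \<Rightarrow> real) (indicator G :: int \<Rightarrow> real)"
      using C1[THEN conjunct2, rule_format, OF p fin] by blast
    note S(2)
    also have "ennreal (C1 / (p - 1)) \<le> ennreal (C / (p - 1) ^ t)"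
    proof (rule ennreal_leI, rule frac_le)
      show "(p - 1) ^ t \<le> p - 1" using power_decreasing[of 1 t "p - 1"] t p by simp
    qed (use p C C1 in auto)
    also have "sparse_form p S (indicator F :: int \<Rightarrow> real) (indicator G :: int \<Rightarrow> real)
      \<le> (SUP S\<in>{S. sparse_family S}. sparse_form p S (indicator F :: int \<Rightarrow> real) (indicator G :: int \<Rightarrow> real))"
      using S(1) by (intro SUP_upper) simp
    finally show ?thesis by (simp add: mult_right_mono mult_left_mono)
  qed
  have 2: "(SUP l\<in>{(0::real)<..<1}. ennreal (l / Log l ^ t) *
           counting {x. A_star (indicator F :: int \<Rightarrow> real) x > ennreal l}) \<le> ennreal (C * real (card F))"
    if F: "finite F" for F :: "int set"
  proof (rule SUP_least)
    fix l :: real assume "l \<in> {0<..<1}"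
    then have l: "0 < l" "l < 1" by auto
    have L: "Log l \<ge> 1" by (rule Log_ge_1)
    have "ennreal (l / Log l ^ t) * counting {x. A_star (indicator F :: int \<Rightarrow> real) x > ennreal l}
       \<le> ennreal (l / Log l ^ t) * ennreal (C2 * Log l / l * real (card F))"
      using C2 F l by (intro mult_left_mono) auto
    also have "\<dots> = ennreal (l / Log l ^ t * (C2 * Log l / l * real (card F)))"
      using C2 l L by (intro ennreal_mult[symmetric]) auto
    also have "\<dots> \<le> ennreal (C * real (card F))"
    proof (rule ennreal_leI)
      have "Log l \<le> Log l ^ t" using L t by (intro self_le_power) auto
      then have "Log l / Log l ^ t \<le> 1" using L by (simp add: divide_le_eq_1)
      then have "C2 * real (card F) * (Log l / Log l ^ t) \<le> C2 * real (card F) * 1"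
        using C2 by (intro mult_left_mono) auto
      also have "\<dots> \<le> C * real (card F)" using C by (simp add: mult_right_mono)
      finally show "l / Log l ^ t * (C2 * Log l / l * real (card F)) \<le> C * real (card F)"
        using l by (simp add: mult_ac)
    qed
    finally show "ennreal (l / Log l ^ t) * counting {x. A_star (indicator F :: int \<Rightarrow> real) x > ennreal l}
       \<le> ennreal (C * real (card F))" .
  qed
  have 3: "(SUP l\<in>{(0::real)<..}. ennreal l * counting {x. A_star f x > ennreal l})
         \<le> ennreal C * lorentz_norm (\<lambda>s. Log s ^ t * Log (Log s)) f"
    if f: "finite {x. f x \<noteq> 0}" "\<And>x. f x \<ge> 0" for f :: "int \<Rightarrow> real"
    by (rule order_trans[OF weak_type_lorentz[OF f t]]) (intro mult_right_mono ennreal_leI C, simp)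
  show ?thesis
    using C(1) 1 2 3 by (intro exI[of _ C] conjI allI impI) auto
qed

end
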